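(* Let $r\geq t\geq 3$ and $0<\epsilon<1$. There exists $\delta>0$ depending on $t$, $r$ and $\epsilon$ such that the following holds. Let $n_1\geq\cdots\geq n_r$ with $n_{t-1}\geq 1/\delta$, $\mathcal{V}=(V_1,\ldots,V_r)$ with $|V_i|=n_i$, and let $G$ be a $K_t$-free spanning subgraph of $K_{n_1,\ldots,n_r}$ with $e(G)\geq f(n_1,\ldots,n_r,1,t)-\delta n_{t-1}^2$. Then there exist a set $X$ and a $(t-1)$-partition $\mathcal{P}$ of $V$ which is an $(X,\epsilon)$-stable partition of $G$; moreover, the integral part (with respect to $\mathcal{V}_X$) of each class of $\mathcal{P}_X$ has size larger than $(1-\epsilon)n_{t-1}$.
   Context: $V=V_1\cup\cdots\cup V_r$ disjoint, $K_{n_1,\ldots,n_r}$ the complete $r$-partite graph with parts $V_i$. For $I\subseteq[r]$, $n_I=\sum_{i\in I}n_i$; $f(n_1,\ldots,n_r,1,t)=\max_{\mathcal{Q}}\sum n_In_{I'}$, maximum over partitions $\mathcal{Q}$ of $[r]$ into $t-1$ parts, sum over unordered pairs of distinct parts. For a partition $\mathcal{P}=(P_1,\ldots,P_{t-1})$ of $V$, $K_{n_1,\ldots,n_r}[\mathcal{P}]$ is the subgraph of $K_{n_1,\ldots,n_r}$ of edges joining different classes of $\mathcal{P}$. For $X\subseteq V$: $\mathcal{P}_X=(P_1\setminus X,\ldots,P_{t-1}\setminus X)$, $\mathcal{V}_X=(V_1\setminus X,\ldots,V_r\setminus X)$. For partitions $\mathcal{P}=(P_j)$, $\mathcal{V}=(V_i)$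 of a common set: $V_i$ is integral in $P_j$ if $V_i\subseteq P_j$, partial in $P_j$ if $V_i\cap P_j\neq\emptyset$ and $V_i\not\subseteq P_j$; $V_i$ is a partial class if partial in some $P_j$. Integral part of $P_j$: union of $V_i$ integral in $P_j$; partial part: union of $V_i\cap P_j$ over $V_i$ partial in $P_j$; $P_j$ is partial if its partial part is nonempty, integral otherwise. $\mathcal{P}$ is stable to $\mathcal{V}$ if: (1) each $P_j$ has at most one $V_i$ partial in it; (2) integral parts of partial classes of $\mathcal{P}$ all have equal size, at most the size of every integral class; (3) the integral part of every class of $\mathcal{P}$ has size at least that of every partial class of $\mathcal{V}$; (4) for every $j$ and $V_i$ integral in $P_j$, $|P_j\setminus V_i|$ is at most the size of the integral part of every $P_{j'}$, $j'\neq j$. $F'$ is $\alpha$-close to $H$ (same vertex set) if $|N_H(v)\triangle N_{F'}(v)|\leq\alpha$ for every vertex $v$. A $(t-1)$-partition $\mathcal{P}$ of $V$ is an $(X,\epsilon)$-stable partition of $G$ if $X\subseteq V$, $|X|\leq\epsilon n_{t-1}$, $G-X$ is $\epsilon n_{t-1}$-close to $K_{n_1,\ldots,n_r}[\mathcal{P}]-X$, and $\mathcal{P}_X$ is stable to $\mathcal{V}_X$.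
   Formalization: An emptied class V_i∖X = ∅ is not counted as integral in any P_j; otherwise condition (4) fails, e.g. for t=3, parts n,n,n,1 and G the complete bipartite graph between V_1∪V_2 and V_3 with the vertex of V_4 isolated. *)

theory Defs
  imports Complex_Main "HOL-Library.Disjoint_Sets"
begin

text \<open>
  A finite simple graph is given by a vertex set and a set of edges, each edge being a two-element
  set of vertices. Partitions into numbered classes are families of pairwise disjoint sets indexed
  by \<open>{1..k}\<close>. Removing a set \<open>X\<close> may leave some members of such a family empty; an empty member
  is then not a class of the partition.
\<close>

definition indexed_partition :: "nat set \<Rightarrow> (nat \<Rightarrow> 'a set) \<Rightarrow> 'a set \<Rightarrow> bool" where
  "indexed_partition J P W \<longleftrightarrow> disjoint_family_on P J \<and> (\<Union>j\<in>J. P j) = W"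

definition complete_multipartite :: "nat set \<Rightarrow> (nat \<Rightarrow> 'a set) \<Rightarrow> 'a set set" where
  "complete_multipartite I V = {{u, v} | u v. \<exists>i\<in>I. \<exists>j\<in>I. i \<noteq> j \<and> u \<in> V i \<and> v \<in> V j}"

definition neighbourhood :: "'a set set \<Rightarrow> 'a \<Rightarrow> 'a set" where
  "neighbourhood E v = {w. {v, w} \<in> E}"

definition delete_vertices :: "'a set set \<Rightarrow> 'a set \<Rightarrow> 'a set set" where
  "delete_vertices E X = {e \<in> E. e \<inter> X = {}}"

definition clique_free :: "'a set \<Rightarrow> 'a set set \<Rightarrow> nat \<Rightarrow> bool" where
  "clique_free W E t \<longleftrightarrow>
     \<not> (\<exists>S\<subseteq>W. finite S \<and> card S = t \<and> (\<forall>u\<in>S. \<forall>v\<in>S. u \<noteq> v \<longrightarrow> {u, v} \<in> E))"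

text \<open>\<open>multipartite_turan n r t\<close> is the number written \<open>f(n\<^sub>1, ..., n\<^sub>r, 1, t)\<close>;
  unordered pairs of distinct parts are the two-element subsets of \<open>Q\<close>.\<close>

definition multipartite_turan :: "(nat \<Rightarrow> nat) \<Rightarrow> nat \<Rightarrow> nat \<Rightarrow> nat" where
  "multipartite_turan n r t =
     Max {\<Sum>p | p \<subseteq> Q \<and> card p = 2. \<Prod>I\<in>p. \<Sum>i\<in>I. n i | Q.
            partition_on {1..r} Q \<and> card Q = t - 1}"

text \<open>\<open>integral_in A B\<close> and \<open>partial_in A B\<close>: \<open>A = V i\<close> is integral, resp. partial, in \<open>B = P j\<close>.
  Integral sets are required to be nonempty, since otherwise an empty \<open>V i - X\<close> would count as
  integral in every \<open>P j - X\<close>.\<close>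

definition integral_in :: "'a set \<Rightarrow> 'a set \<Rightarrow> bool" where
  "integral_in A B \<longleftrightarrow> A \<noteq> {} \<and> A \<subseteq> B"

definition partial_in :: "'a set \<Rightarrow> 'a set \<Rightarrow> bool" where
  "partial_in A B \<longleftrightarrow> A \<inter> B \<noteq> {} \<and> \<not> A \<subseteq> B"

definition integral_part :: "nat set \<Rightarrow> (nat \<Rightarrow> 'a set) \<Rightarrow> 'a set \<Rightarrow> 'a set" where
  "integral_part I V B = \<Union>{V i | i. i \<in> I \<and> integral_in (V i) B}"

definition partial_part :: "nat set \<Rightarrow> (nat \<Rightarrow> 'a set) \<Rightarrow> 'a set \<Rightarrow> 'a set" where
  "partial_part I V B = \<Union>{V i \<inter> B | i. i \<in> I \<and> partial_in (V i) B}"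

definition partial_class :: "nat set \<Rightarrow> (nat \<Rightarrow> 'a set) \<Rightarrow> 'a set \<Rightarrow> bool" where
  "partial_class I V B \<longleftrightarrow> partial_part I V B \<noteq> {}"

definition stable_to :: "nat set \<Rightarrow> (nat \<Rightarrow> 'a set) \<Rightarrow> nat set \<Rightarrow> (nat \<Rightarrow> 'a set) \<Rightarrow> bool" where
  "stable_to J P I V \<longleftrightarrow>
     (\<forall>j\<in>J. \<forall>i\<in>I. \<forall>i'\<in>I. partial_in (V i) (P j) \<and> partial_in (V i') (P j) \<longrightarrow> i = i') \<and>
     (\<forall>j\<in>J. \<forall>k\<in>J. partial_class I V (P j) \<longrightarrow>
        (if partial_class I V (P k)
         then card (integral_part I V (P j)) = card (integral_part I V (P k))
         else card (integral_part I V (P j)) \<le> card (P k))) \<and>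
     (\<forall>j\<in>J. \<forall>i\<in>I. (\<exists>k\<in>J. partial_in (V i) (P k)) \<longrightarrow>
        card (V i) \<le> card (integral_part I V (P j))) \<and>
     (\<forall>j\<in>J. \<forall>i\<in>I. integral_in (V i) (P j) \<longrightarrow>
        (\<forall>k\<in>J. k \<noteq> j \<longrightarrow> card (P j - V i) \<le> card (integral_part I V (P k))))"

definition close_to :: "'a set \<Rightarrow> real \<Rightarrow> 'a set set \<Rightarrow> 'a set set \<Rightarrow> bool" where
  "close_to W \<alpha> F H \<longleftrightarrow>
     (\<forall>v\<in>W. real (card (sym_diff (neighbourhood H v) (neighbourhood F v))) \<le> \<alpha>)"

text \<open>\<open>complete_multipartite {1..r} V \<inter> complete_multipartite {1..t - 1} P\<close> consists of the edges of
  the complete \<open>r\<close>-partite graph that join different classes of \<open>P\<close>.\<close>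

definition stable_partition ::
  "nat \<Rightarrow> nat \<Rightarrow> (nat \<Rightarrow> 'a set) \<Rightarrow> 'a set set \<Rightarrow> 'a set \<Rightarrow> real \<Rightarrow> (nat \<Rightarrow> 'a set) \<Rightarrow> bool" where
  "stable_partition r t V E X \<epsilon> P \<longleftrightarrow>
     indexed_partition {1..t - 1} P (\<Union>i\<in>{1..r}. V i) \<and>
     X \<subseteq> (\<Union>i\<in>{1..r}. V i) \<and>
     real (card X) \<le> \<epsilon> * real (card (V (t - 1))) \<and>
     close_to ((\<Union>i\<in>{1..r}. V i) - X) (\<epsilon> * real (card (V (t - 1))))
       (delete_vertices E X)
       (delete_vertices (complete_multipartite {1..r} V \<inter> complete_multipartite {1..t - 1} P) X) \<and>
     stable_to {1..t - 1} (\<lambda>j. P j - X) {1..r} (\<lambda>i. V i - X)"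

end

theory Submission
  imports Defs
begin

text \<open>
  Write \<open>s = t - 1\<close> and \<open>N = n\<^sub>s\<close>. Pick one vertex from every part at random. The induced graph \<open>H\<close>
  on \<open>[r]\<close>, an edge \<open>ik\<close> weighing \<open>n\<^sub>i n\<^sub>k\<close>, has expected weight \<open>e(G)\<close>, and it is \<open>K\<^sub>t\<close>-free, so its
  weight is at most \<open>f\<close>; hence the expected deficit is at most \<open>\<delta>N\<^sup>2\<close>. Fueredi's degree
  majorization shows that a small deficit forces \<open>H\<close>, restricted to the parts with
  \<open>n\<^sub>i \<ge> \<gamma>N\<close>, to be complete \<open>s\<close>-partite with a partition that no single move of a part improves
  by much. Here \<open>\<gamma>\<close> is chosen by pigeonhole so that all other parts are much smaller than \<open>\<gamma>N\<close>;
  they go to \<open>X\<close>. Parts much larger than \<open>N\<close> miss only \<open>O(\<delta>N\<^sup>2)\<close> edges, so the remaining analysis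
  is a dense one.

  Resampling one coordinate of a good transversal assigns a class to every vertex of a part, and
  resampling two coordinates shows that adjacency agrees with these classes up to few pairs. If
  \<open>supp i\<close> is the set of classes that contain a substantial piece of \<open>V\<^sub>i\<close>, every selection from
  the sets \<open>supp i\<close> is the type of some good transversal and therefore nearly optimal. Comparing
  selections that differ in one or two parts yields the stability conditions up to an additive
  error \<open>h \<le> \<zeta>N\<close> with \<open>\<zeta>\<close> much smaller than \<open>\<gamma>\<close>, and deleting \<open>O(h)\<close> further vertices makes them exact.
\<close>

text \<open>The hypothesis speaks on the scale N^2, whereas the first s - 1 parts may be arbitrarily
  larger than N, so counting edges directly loses control of such parts. Transversals avoid this:
  resampling a coordinate preserves the uniform measure whatever the part sizes are, and only the
  proportion of bad transversals has to be small. Another obstacle is that every good transversal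
  brings its own colouring, determined at best up to the names of the colours. Colourings are
  therefore compared through the relation of having equal colours, and surjectivity onto
  \<open>{1..s}\<close> is carried along in order to align the names with those of one reference
  colouring. The gain of a single move is proportional to the size of the part that moves. This is
  why the parts that are kept need a lower bound \<open>\<gamma> * N\<close>, and why all errors
  must be small compared with it.\<close>

declare sum_mult_of_bool_eq [simp del] sum_of_bool_mult_eq [simp del]

section \<open>Weighted graphs and degree majorization\<close>

text \<open>Ordered pairs are summed, so an edge of a symmetric \<open>H\<close> counts twice; hence
  the factor 2 in \<open>F\<close> and in the recolouring formula.\<close>

definition pair_weight :: "'i set \<Rightarrow> ('i \<Rightarrow> real) \<Rightarrow> ('i \<Rightarrow> 'i \<Rightarrow> bool) \<Rightarrow> real" where
  "pair_weight R a H = (\<Sum>i\<in>R. \<Sum>k\<in>R. a i * a k * of_bool (H i k))"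

abbreviation cut_weight :: "'i set \<Rightarrow> ('i \<Rightarrow> real) \<Rightarrow> ('i \<Rightarrow> 'c) \<Rightarrow> real" where
  "cut_weight R a c \<equiv> pair_weight R a (\<lambda>i k. c i \<noteq> c k)"

lemma pair_weight_prod:
  "pair_weight R a H = (\<Sum>(i, k)\<in>R \<times> R. a i * a k * of_bool (H i k))"
  by (simp add: pair_weight_def sum.cartesian_product)

lemma pair_weight_nonneg:
  assumes "\<And>i. i \<in> R \<Longrightarrow> 0 \<le> a i"
  shows "0 \<le> pair_weight R a H"
  unfolding pair_weight_def using assms by (intro sum_nonneg) auto

lemma pair_weight_mono:
  assumes "\<And>i. i \<in> R \<Longrightarrow> 0 \<le> a i"
    and "\<And>i k. i \<in> R \<Longrightarrow> k \<in> R \<Longrightarrow> H i k \<Longrightarrow> H' i k"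
  shows "pair_weight R a H \<le> pair_weight R a H'"
  unfolding pair_weight_def
  using assms by (intro sum_mono) (auto intro!: mult_left_mono mult_nonneg_nonneg simp: of_bool_def)

lemma pair_weight_subset:
  assumes "finite R" "R' \<subseteq> R" and "\<And>i. i \<in> R \<Longrightarrow> 0 \<le> a i"
  shows "pair_weight R' a H \<le> pair_weight R a H"
  unfolding pair_weight_prod
  using assms by (intro sum_mono2) auto

lemma pair_weight_cong:
  assumes "\<And>i k. i \<in> R \<Longrightarrow> k \<in> R \<Longrightarrow> H i k \<longleftrightarrow> H' i k"
  shows "pair_weight R a H = pair_weight R a H'"
  unfolding pair_weight_def using assms by (intro sum.cong refl) auto

lemma pair_weight_split:
  "pair_weight R a H =
     pair_weight R a (\<lambda>i k. H i k \<and> Q i k) + pair_weight R a (\<lambda>i k. H i k \<and> \<not> Q i k)"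
  unfolding pair_weight_def sum.distrib[symmetric] by (intro sum.cong refl) auto

lemma pair_weight_ge_pair:
  assumes "finite R" "\<And>i. i \<in> R \<Longrightarrow> 0 \<le> a i" "i \<in> R" "k \<in> R" "i \<noteq> k" "H i k" "H k i"
  shows "2 * (a i * a k) \<le> pair_weight R a H"
proof -
  have "2 * (a i * a k) = (\<Sum>(i, k)\<in>{(i, k), (k, i)}. a i * a k * of_bool (H i k))"
    using assms by simp
  also have "\<dots> \<le> pair_weight R a H"
    unfolding pair_weight_prod using assms by (intro sum_mono2) auto
  finally show ?thesis .
qed

lemma pair_weight_insert:
  assumes "finite R" "i \<notin> R" "\<And>k l. H k l \<longleftrightarrow> H l k" "\<not> H i i"
  shows "pair_weight (insert i R) a H =
    pair_weight R a H + 2 * a i * (\<Sum>k\<in>R. a k * of_bool (H i k))"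
proof -
  have "(\<Sum>k\<in>R. a k * a i * of_bool (H k i)) = a i * (\<Sum>k\<in>R. a k * of_bool (H i k))"
    unfolding sum_distrib_left by (intro sum.cong refl) (simp add: assms(3)[of i])
  moreover have "(\<Sum>k\<in>R. a i * a k * of_bool (H i k)) = a i * (\<Sum>k\<in>R. a k * of_bool (H i k))"
    unfolding sum_distrib_left by (intro sum.cong refl) simp
  ultimately show ?thesis
    using assms unfolding pair_weight_def by (simp add: sum.distrib)
qed

text \<open>Only pairs through \<open>i\<close> change. Before the move \<open>i\<close> is
  separated from everything outside its class, afterwards from everything outside class
  \<open>j\<close>; the term \<open>- a i\<close> takes \<open>i\<close> out of its own
  class.\<close>

lemma cut_weight_recolour:
  fixes c :: "'i \<Rightarrow> 'c"
  assumes "finite R" "i \<in> R" "j \<noteq> c i"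
  shows "cut_weight R a (c(i := j)) =
    cut_weight R a c + 2 * a i * (sum a {k \<in> R. c k = c i} - a i - sum a {k \<in> R. c k = j})"
proof -
  define R' where "R' = R - {i}"
  have R: "R = insert i R'" "i \<notin> R'" "finite R'"
    using assms by (auto simp: R'_def)
  have cls: "(\<Sum>k\<in>R'. a k * of_bool (b \<noteq> c k)) = sum a R' - sum a {k \<in> R'. c k = b}" for b
  proof -
    have "(\<Sum>k\<in>R'. a k * of_bool (b \<noteq> c k)) = (\<Sum>k\<in>R'. a k - (if c k = b then a k else 0))"
      by (intro sum.cong) auto
    then show ?thesis
      using R(3) by (simp add: sum_subtractf sum.inter_filter)
  qed
  have eq: "cut_weight R' a (c(i := j)) = cut_weight R' a c"
    using R(2) by (intro pair_weight_cong) auto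
  have "{k \<in> R. c k = c i} = insert i {k \<in> R'. c k = c i}" "{k \<in> R. c k = j} = {k \<in> R'. c k = j}"
    using R assms(3) by auto
  then have fibres: "sum a {k \<in> R. c k = c i} = a i + sum a {k \<in> R'. c k = c i}"
    "sum a {k \<in> R. c k = j} = sum a {k \<in> R'. c k = j}"
    using R by auto
  have star: "(\<Sum>k\<in>R'. a k * of_bool ((c(i := j)) i \<noteq> (c(i := j)) k)) =
      (\<Sum>k\<in>R'. a k * of_bool (j \<noteq> c k))"
    using R(2) by (intro sum.cong) auto
  have ins: "cut_weight R a b = cut_weight R' a b + 2 * a i * (\<Sum>k\<in>R'. a k * of_bool (b i \<noteq> b k))"
    for b :: "'i \<Rightarrow> 'c"
    unfolding R(1) using R(2,3) by (intro pair_weight_insert) auto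
  show ?thesis
    unfolding ins[of c] ins[of "c(i := j)"] star eq cls fibres by (simp add: algebra_simps)
qed

text \<open>Induction on \<open>s\<close>: the non-neighbours of a vertex \<open>x\<close> of
  maximum weighted degree form the last colour class, and the neighbourhood of \<open>x\<close>,
  whose cliques are smaller by one, is coloured inductively. The monochromatic weight on the left is
  what turns the bound into a stability statement: a nearly optimal weight leaves little room for
  monochromatic edges.\<close>

lemma degree_majorization:
  fixes a :: "'i \<Rightarrow> real"
  assumes "finite R" "\<And>i. i \<in> R \<Longrightarrow> 0 \<le> a i" "\<And>i k. H i k \<longleftrightarrow> H k i" "\<And>i. \<not> H i i"
    and "\<not> (\<exists>S\<subseteq>R. card S = Suc s \<and> (\<forall>u\<in>S. \<forall>v\<in>S. u \<noteq> v \<longrightarrow> H u v))"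
  shows "\<exists>c :: 'i \<Rightarrow> nat. c ` R \<subseteq> {1..s} \<and>
    pair_weight R a H + pair_weight R a (\<lambda>i k. H i k \<and> c i = c k) \<le> cut_weight R a c"
  using assms
proof (induction s arbitrary: R)
  case 0
  have "R = {}"
  proof (rule ccontr)
    assume "R \<noteq> {}"
    then obtain x where "x \<in> R" by auto
    then have "{x} \<subseteq> R \<and> card {x} = Suc 0 \<and> (\<forall>u\<in>{x}. \<forall>v\<in>{x}. u \<noteq> v \<longrightarrow> H u v)" by auto
    with 0(5) show False by blast
  qed
  then show ?case by (simp add: pair_weight_def)
next
  case (Suc s)
  show ?case
  proof (cases "R = {}")
    case True
    then show ?thesis by (simp add: pair_weight_def)
  next
    case False
    define d where "d i = (\<Sum>k\<in>R. a k * of_bool (H i k))" for i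
    obtain x where x: "x \<in> R" "\<And>i. i \<in> R \<Longrightarrow> d i \<le> d x"
    proof -
      have "Max (d ` R) \<in> d ` R" using False Suc.prems(1) by simp
      then obtain x where "x \<in> R" "d x = Max (d ` R)" by auto
      then show ?thesis using that Suc.prems(1) by simp
    qed
    define R' where "R' = {k \<in> R. H x k}"
    define A where "A = {k \<in> R. \<not> H x k}"
    have RA: "R = A \<union> R'" "A \<inter> R' = {}" "finite A" "finite R'" "R' \<subseteq> R" "A \<subseteq> R"
      using Suc.prems(1) by (auto simp: A_def R'_def)
    have "\<not> (\<exists>S\<subseteq>R'. card S = Suc s \<and> (\<forall>u\<in>S. \<forall>v\<in>S. u \<noteq> v \<longrightarrow> H u v))"
    proof
      assume "\<exists>S\<subseteq>R'. card S = Suc s \<and> (\<forall>u\<in>S. \<forall>v\<in>S. u \<noteq> v \<longrightarrow> H u v)"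
      then obtain S where S: "S \<subseteq> R'" "card S = Suc s" "\<forall>u\<in>S. \<forall>v\<in>S. u \<noteq> v \<longrightarrow> H u v"
        by blast
      have "x \<notin> S" using S(1) Suc.prems(4) by (auto simp: R'_def)
      moreover have "finite S" using S(2) card.infinite by fastforce
      ultimately have "card (insert x S) = Suc (Suc s)" using S(2) by simp
      moreover have "insert x S \<subseteq> R" using S(1) x(1) by (auto simp: R'_def)
      moreover have "\<forall>u\<in>insert x S. \<forall>v\<in>insert x S. u \<noteq> v \<longrightarrow> H u v"
        using S Suc.prems(3) by (auto simp: R'_def)
      ultimately show False using Suc.prems(5) by blast
    qed
    moreover have "0 \<le> a i" if "i \<in> R'" for i
      using that RA(5) Suc.prems(2) by blast
    ultimately have "\<exists>c :: 'i \<Rightarrow> nat. c ` R' \<subseteq> {1..s} \<and>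
        pair_weight R' a H + pair_weight R' a (\<lambda>i k. H i k \<and> c i = c k) \<le> cut_weight R' a c"
      using Suc.IH[OF RA(4) _ Suc.prems(3) Suc.prems(4)] by blast
    then obtain c :: "'i \<Rightarrow> nat" where c: "c ` R' \<subseteq> {1..s}"
      "pair_weight R' a H + pair_weight R' a (\<lambda>i k. H i k \<and> c i = c k) \<le> cut_weight R' a c"
      by blast
    define c' where "c' i = (if i \<in> R' then c i else Suc s)" for i
    have c'R: "c' i = c i" "c' i \<noteq> Suc s" if "i \<in> R'" for i
      using that c(1) by (auto simp: c'_def)
    have c'A: "c' i = Suc s" if "i \<in> A" for i
      using that RA(2) by (auto simp: c'_def)
    have ne: "c' i \<noteq> c' k" if "i \<in> A" "k \<in> R'" for i k
      using c'A[OF that(1)] c'R[OF that(2)] by simp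
    have split: "pair_weight R a Q = pair_weight R' a Q +
        (2 * (\<Sum>i\<in>A. \<Sum>k\<in>R'. a i * a k * of_bool (Q i k)) +
        (\<Sum>i\<in>A. \<Sum>k\<in>A. a i * a k * of_bool (Q i k)))" if "\<And>i k. Q i k \<longleftrightarrow> Q k i" for Q
    proof -
      have "(\<Sum>i\<in>R'. \<Sum>k\<in>A. a i * a k * of_bool (Q i k)) =
          (\<Sum>i\<in>A. \<Sum>k\<in>R'. a i * a k * of_bool (Q i k))"
        by (subst sum.swap) (intro sum.cong refl, simp add: that mult.commute)
      then show ?thesis
        unfolding pair_weight_def RA(1)
        using RA(2,3,4) by (simp add: sum.union_disjoint sum.distrib)
    qed
    \<comment> \<open>Edges inside \<open>A\<close> enter this degree sum from both ends. Twice the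
      sum is thus the weight of all edges meeting \<open>A\<close> plus once more the weight inside
      \<open>A\<close>, and this surplus pays for the monochromatic edges of the new class.\<close>
    have deg: "(\<Sum>i\<in>A. a i * d i) = (\<Sum>i\<in>A. \<Sum>k\<in>R'. a i * a k * of_bool (H i k)) +
        (\<Sum>i\<in>A. \<Sum>k\<in>A. a i * a k * of_bool (H i k))"
      unfolding d_def RA(1) using RA(2,3,4)
      by (simp add: sum.union_disjoint sum.distrib sum_distrib_left algebra_simps)
    have dx: "d x = sum a R'"
      unfolding d_def R'_def using Suc.prems(1) by (simp add: of_bool_def if_distrib sum.inter_filter cong: if_cong)
    have "(\<Sum>i\<in>A. a i * d i) \<le> (\<Sum>i\<in>A. a i * sum a R')"
      using x(2) RA(6) Suc.prems(2) unfolding dx[symmetric]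
      by (intro sum_mono mult_left_mono) auto
    also have "\<dots> = (\<Sum>i\<in>A. \<Sum>k\<in>R'. a i * a k * of_bool (c' i \<noteq> c' k))"
      using ne by (simp add: sum_distrib_left)
    finally have maj: "(\<Sum>i\<in>A. a i * d i) \<le>
        (\<Sum>i\<in>A. \<Sum>k\<in>R'. a i * a k * of_bool (c' i \<noteq> c' k))" .
    have z1: "(\<Sum>i\<in>A. \<Sum>k\<in>A. a i * a k * of_bool (c' i \<noteq> c' k)) = 0"
      using c'A by (intro sum.neutral ballI) auto
    have z2: "(\<Sum>i\<in>A. \<Sum>k\<in>R'. a i * a k * of_bool (H i k \<and> c' i = c' k)) = 0"
      using ne by (intro sum.neutral ballI) auto
    have z3: "(\<Sum>i\<in>A. \<Sum>k\<in>A. a i * a k * of_bool (H i k \<and> c' i = c' k)) =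
        (\<Sum>i\<in>A. \<Sum>k\<in>A. a i * a k * of_bool (H i k))"
      using c'A by (intro sum.cong refl) auto
    have e1: "pair_weight R' a (\<lambda>i k. H i k \<and> c' i = c' k) = pair_weight R' a (\<lambda>i k. H i k \<and> c i = c k)"
      "cut_weight R' a c' = cut_weight R' a c"
      using c'R(1) by (auto intro!: pair_weight_cong)
    have "c' ` R \<subseteq> {1..Suc s}"
      using c(1) by (force simp: c'_def)
    moreover have "pair_weight R a H + pair_weight R a (\<lambda>i k. H i k \<and> c' i = c' k) \<le> cut_weight R a c'"
    proof -
      have sym: "H i k \<and> c' i = c' k \<longleftrightarrow> H k i \<and> c' k = c' i" "c' i \<noteq> c' k \<longleftrightarrow> c' k \<noteq> c' i" for i k
        using Suc.prems(3) by auto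
      show ?thesis
        using split[of H, OF Suc.prems(3)] split[of "\<lambda>i k. H i k \<and> c' i = c' k", OF sym(1)]
          split[of "\<lambda>i k. c' i \<noteq> c' k", OF sym(2)] deg maj z1 z2 z3 e1 c(2) by linarith
    qed
    ultimately show ?thesis by blast
  qed
qed

section \<open>Cut weights and the multipartite Turan number\<close>

text \<open>Translates the sum over two-element subsets in \<open>multipartite_turan\<close> into
  the ordered double sum of \<open>pair_weight\<close>; inserting \<open>x\<close> adds the pairs
  through \<open>x\<close> on both sides.\<close>

lemma sum_two_subsets:
  fixes g :: "'b \<Rightarrow> real"
  assumes "finite Q"
  shows "2 * (\<Sum>p | p \<subseteq> Q \<and> card p = 2. \<Prod>I\<in>p. g I) = pair_weight Q g (\<noteq>)"
  using assms
proof (induction Q rule: finite_induct)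
  case empty
  have "{p. p \<subseteq> {} \<and> card p = 2} = ({} :: 'b set set)" by auto
  then show ?case unfolding pair_weight_def by simp
next
  case (insert x Q)
  have eq: "{p. p \<subseteq> insert x Q \<and> card p = 2} = {p. p \<subseteq> Q \<and> card p = 2} \<union> (\<lambda>y. {x, y}) ` Q"
    (is "?L = ?A \<union> ?B")
  proof (intro equalityI subsetI)
    fix p assume "p \<in> ?L"
    then have p: "p \<subseteq> insert x Q" "card p = 2" by auto
    show "p \<in> ?A \<union> ?B"
    proof (cases "x \<in> p")
      case True
      obtain u v where "p = {u, v}" "u \<noteq> v" using p(2) by (auto simp: card_2_iff)
      then show ?thesis using True p(1) by auto
    qed (use p in auto)
  next
    fix p assume "p \<in> ?A \<union> ?B"
    then show "p \<in> ?L" using insert.hyps by (auto simp: card_insert_if)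
  qed
  have inj: "inj_on (\<lambda>y. {x, y}) Q"
    by (auto simp: inj_on_def doubleton_eq_iff)
  have "(\<Sum>p\<in>?L. \<Prod>I\<in>p. g I) = (\<Sum>p\<in>?A. \<Prod>I\<in>p. g I) + (\<Sum>p\<in>?B. \<Prod>I\<in>p. g I)"
    unfolding eq using insert.hyps by (intro sum.union_disjoint) auto
  also have "(\<Sum>p\<in>?B. \<Prod>I\<in>p. g I) = (\<Sum>y\<in>Q. g x * g y)"
    unfolding sum.reindex[OF inj]
  proof (intro sum.cong refl)
    fix y assume "y \<in> Q"
    then have "x \<noteq> y" using insert.hyps by auto
    then show "((\<lambda>p. \<Prod>I\<in>p. g I) \<circ> (\<lambda>y. {x, y})) y = g x * g y" by simp
  qed
  also have "\<dots> = g x * (\<Sum>k\<in>Q. g k * of_bool (x \<noteq> k))"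
    unfolding sum_distrib_left using insert.hyps by (intro sum.cong) auto
  finally show ?case
    using insert by (subst pair_weight_insert) auto
qed

text \<open>The double sum is grouped by the colours of both indices. Only attained colours occur,
  because several empty fibres would make the map from colours to fibres non-injective.\<close>

lemma cut_weight_fibres:
  assumes "finite R"
  shows "cut_weight R a c = pair_weight ((\<lambda>j. {i \<in> R. c i = j}) ` c ` R) (sum a) (\<noteq>)"
proof -
  let ?f = "\<lambda>j. {i \<in> R. c i = j}"
  have inj: "inj_on ?f (c ` R)"
    by (intro inj_onI) blast
  have "pair_weight (?f ` c ` R) (sum a) (\<noteq>) =
      (\<Sum>j\<in>c ` R. \<Sum>l\<in>c ` R. sum a (?f j) * sum a (?f l) * of_bool (?f j \<noteq> ?f l))"
    unfolding pair_weight_def by (simp add: sum.reindex[OF inj])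
  also have "\<dots> = (\<Sum>j\<in>c ` R. \<Sum>l\<in>c ` R. \<Sum>i\<in>?f j. \<Sum>k\<in>?f l. a i * a k * of_bool (c i \<noteq> c k))"
  proof (intro sum.cong refl)
    fix j l assume "j \<in> c ` R" "l \<in> c ` R"
    then have "of_bool (?f j \<noteq> ?f l) = (of_bool (j \<noteq> l) :: real)"
      using inj_on_eq_iff[OF inj] by simp
    moreover have "(\<Sum>i\<in>?f j. \<Sum>k\<in>?f l. a i * a k * of_bool (c i \<noteq> c k)) =
        (\<Sum>i\<in>?f j. \<Sum>k\<in>?f l. a i * a k * of_bool (j \<noteq> l))"
      by (intro sum.cong refl) auto
    ultimately show "sum a (?f j) * sum a (?f l) * of_bool (?f j \<noteq> ?f l) =
        (\<Sum>i\<in>?f j. \<Sum>k\<in>?f l. a i * a k * of_bool (c i \<noteq> c k))"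
      by (simp only: sum_product, simp only: sum_distrib_right)
  qed
  also have "\<dots> = (\<Sum>j\<in>c ` R. \<Sum>i\<in>?f j. \<Sum>l\<in>c ` R. \<Sum>k\<in>?f l. a i * a k * of_bool (c i \<noteq> c k))"
    by (intro sum.cong refl sum.swap)
  also have "\<dots> = (\<Sum>j\<in>c ` R. \<Sum>i\<in>?f j. \<Sum>k\<in>R. a i * a k * of_bool (c i \<noteq> c k))"
    using assms by (intro sum.cong refl sum.image_gen[symmetric])
  also have "\<dots> = cut_weight R a c"
    unfolding pair_weight_def using assms by (intro sum.image_gen[symmetric])
  finally show ?thesis by simp
qed

text \<open>Surjectivity makes the fibres a partition into exactly \<open>s\<close> nonempty parts,
  which is a competitor in the maximum.\<close>

lemma cut_weight_surj_le_turan: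
  fixes n :: "nat \<Rightarrow> nat"
  assumes "c ` {1..r} = {1..s}"
  shows "cut_weight {1..r} (\<lambda>i. real (n i)) c \<le> 2 * real (multipartite_turan n r (Suc s))"
proof -
  let ?f = "\<lambda>j. {i \<in> {1..r}. c i = j}"
  let ?g = "\<lambda>Q. \<Sum>p | p \<subseteq> Q \<and> card p = 2. \<Prod>I\<in>p. \<Sum>i\<in>I. n i"
  define Q where "Q = ?f ` {1..s}"
  have inj: "inj_on ?f {1..s}"
    unfolding assms[symmetric] by (intro inj_onI) blast
  have part: "partition_on {1..r} Q"
    unfolding Q_def
  proof (rule partition_onI)
    show "\<Union> (?f ` {1..s}) = {1..r}" using assms by auto
    show "disjnt A B" if "A \<in> ?f ` {1..s}" "B \<in> ?f ` {1..s}" "A \<noteq> B" for A B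
      using that by (auto simp: disjnt_iff)
    show "{} \<notin> ?f ` {1..s}"
    proof
      assume "{} \<in> ?f ` {1..s}"
      then obtain j where j: "j \<in> {1..s}" "?f j = {}" by (metis (no_types, lifting) imageE)
      then have "j \<in> c ` {1..r}" by (simp only: assms)
      then show False using j(2) by blast
    qed
  qed
  have card: "card Q = s" unfolding Q_def using card_image[OF inj] by simp
  have fin: "finite {?g Q | Q. partition_on {1..r} Q \<and> card Q = Suc s - 1}"
    by (rule finite_subset[OF _ finite_imageI[of "{Q. partition_on {1..r} Q}" ?g]])
      (auto simp: finitely_many_partition_on)
  have "?g Q \<in> {?g Q | Q. partition_on {1..r} Q \<and> card Q = Suc s - 1}"
    using part card by auto
  then have "?g Q \<le> multipartite_turan n r (Suc s)"
    unfolding multipartite_turan_def by (rule Max_ge[OF fin])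
  then have "2 * real (?g Q) \<le> 2 * real (multipartite_turan n r (Suc s))" by linarith
  moreover have "2 * real (?g Q) = pair_weight Q (sum (\<lambda>i. real (n i))) (\<noteq>)"
    using sum_two_subsets[of Q "sum (\<lambda>i. real (n i))"] by (simp add: Q_def)
  moreover have "cut_weight {1..r} (\<lambda>i. real (n i)) c = pair_weight Q (sum (\<lambda>i. real (n i))) (\<noteq>)"
    unfolding Q_def assms[symmetric] by (rule cut_weight_fibres) simp
  ultimately show ?thesis by linarith
qed

lemma cut_weight_le_turan:
  fixes n :: "nat \<Rightarrow> nat"
  assumes "c ` {1..r} \<subseteq> {1..s}" "s \<le> r"
  shows "cut_weight {1..r} (\<lambda>i. real (n i)) c \<le> 2 * real (multipartite_turan n r (Suc s))"
  using assms(1)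
proof (induction "s - card (c ` {1..r})" arbitrary: c rule: less_induct)
  case less
  show ?case
  proof (cases "c ` {1..r} = {1..s}")
    case True
    then show ?thesis by (rule cut_weight_surj_le_turan)
  next
    case False
    then obtain j where j: "j \<in> {1..s}" "j \<notin> c ` {1..r}" using less.prems by blast
    have lt: "card (c ` {1..r}) < s"
      using psubset_card_mono[of "{1..s}" "c ` {1..r}"] False less.prems by auto
    then have "\<not> inj_on c {1..r}"
      using assms(2) card_image[of c "{1..r}"] by auto
    then obtain i k where ik: "i \<in> {1..r}" "k \<in> {1..r}" "i \<noteq> k" "c i = c k"
      unfolding inj_on_def by blast
    have "(c(i := j)) ` {1..r} = insert j (c ` {1..r})"
    proof (intro equalityI subsetI)
      fix y assume "y \<in> insert j (c ` {1..r})"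
      then consider "y = j" | l where "l \<in> {1..r}" "y = c l" by auto
      then show "y \<in> (c(i := j)) ` {1..r}"
      proof cases
        case 1
        then show ?thesis using ik(1) by (auto intro!: image_eqI[of _ _ i])
      next
        case 2
        then show ?thesis using ik
          by (cases "l = i") (auto intro: image_eqI[of _ _ k] image_eqI[of _ _ l])
      qed
    qed auto
    then have img: "(c(i := j)) ` {1..r} \<subseteq> {1..s}" "card ((c(i := j)) ` {1..r}) = Suc (card (c ` {1..r}))"
      using j less.prems by auto
    then have "cut_weight {1..r} (\<lambda>i. real (n i)) (c(i := j)) \<le> 2 * real (multipartite_turan n r (Suc s))"
      using lt by (intro less.hyps) auto
    moreover have "cut_weight {1..r} (\<lambda>i. real (n i)) c \<le> cut_weight {1..r} (\<lambda>i. real (n i)) (c(i := j))"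
      using j(2) by (intro pair_weight_mono) (auto simp: image_iff split: if_splits)
    ultimately show ?thesis by linarith
  qed
qed

section \<open>Colourings and resampling\<close>

text \<open>On \<open>B\<close> the map \<open>f\<close> factors through \<open>g\<close>.
  Colourings of different transversals have unrelated colour names, so only their kernels can be
  compared.\<close>

lemma card_image_le_kernel:
  assumes "finite B" "\<And>k l. k \<in> B \<Longrightarrow> l \<in> B \<Longrightarrow> g k = g l \<Longrightarrow> f k = f l"
  shows "card (f ` B) \<le> card (g ` B)"
proof -
  have "f ` B \<subseteq> (\<lambda>y. f (inv_into B g y)) ` g ` B"
  proof
    fix y assume "y \<in> f ` B"
    then obtain k where k: "k \<in> B" "y = f k" by blast
    have "inv_into B g (g k) \<in> B" "g (inv_into B g (g k)) = g k"
      using k(1) by (auto intro: inv_into_into f_inv_into_f)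
    then have "f (inv_into B g (g k)) = y" using assms(2) k by metis
    then show "y \<in> (\<lambda>y. f (inv_into B g y)) ` g ` B" using k(1) by (auto intro!: image_eqI)
  qed
  then have "card (f ` B) \<le> card ((\<lambda>y. f (inv_into B g y)) ` g ` B)"
    using assms(1) by (intro card_mono) auto
  also have "\<dots> \<le> card (g ` B)" using assms(1) by (intro card_image_le) auto
  finally show ?thesis .
qed

lemma card_image_eq_kernel:
  assumes "finite B" "\<And>k l. k \<in> B \<Longrightarrow> l \<in> B \<Longrightarrow> f k = f l \<longleftrightarrow> g k = g l"
  shows "card (f ` B) = card (g ` B)"
  using card_image_le_kernel[of B g f] card_image_le_kernel[of B f g] assms by (metis antisym)

text \<open>If another index shares the colour of \<open>i\<close> under \<open>c'\<close>, its
  \<open>c\<close>-colour is the right \<open>j\<close>. Otherwise \<open>c'\<close>, and by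
  equality of kernels also \<open>c\<close>, takes fewer than \<open>card S\<close> values on
  \<open>B - {i}\<close>, so \<open>c\<close> leaves a colour free for \<open>i\<close>.\<close>

lemma surj_recolour:
  assumes "finite B" "i \<in> B" "c ` B = S" "c' ` B = S"
    and agree: "\<And>k l. k \<in> B - {i} \<Longrightarrow> l \<in> B - {i} \<Longrightarrow> c k = c l \<longleftrightarrow> c' k = c' l"
  shows "\<exists>j\<in>S. (c(i := j)) ` B = S \<and>
    (\<forall>k\<in>B. \<forall>l\<in>B. (c(i := j)) k = (c(i := j)) l \<longleftrightarrow> c' k = c' l)"
proof -
  have S: "finite S" using assms by auto
  have "\<exists>j\<in>S. \<forall>k\<in>B - {i}. c k = j \<longleftrightarrow> c' k = c' i"
  proof (cases "\<exists>k\<in>B - {i}. c' k = c' i")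
    case True
    then obtain k where k: "k \<in> B - {i}" "c' k = c' i" by blast
    have "c l = c k \<longleftrightarrow> c' l = c' i" if "l \<in> B - {i}" for l
      using agree[OF that k(1)] k(2) by simp
    moreover have "c k \<in> S" using k(1) assms(3) by blast
    ultimately show ?thesis by blast
  next
    case False
    have "card (c ` (B - {i})) = card (c' ` (B - {i}))"
      using assms(1) agree by (intro card_image_eq_kernel) auto
    moreover have "c' ` (B - {i}) = S - {c' i}"
      using False assms(2,4) by auto
    moreover have "c' i \<in> S" using assms(2,4) by blast
    ultimately have "card (c ` (B - {i})) < card S"
      using S card_Diff1_less[of S "c' i"] by simp
    then obtain j where "j \<in> S" "j \<notin> c ` (B - {i})"
      using assms(3) S by (metis card_mono finite_imageI assms(1) finite_Diff not_le subsetI)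
    then show ?thesis using False by (intro bexI[of _ j]) auto
  qed
  then obtain j where j: "j \<in> S" "\<And>k. k \<in> B - {i} \<Longrightarrow> c k = j \<longleftrightarrow> c' k = c' i" by blast
  have ker: "(c(i := j)) k = (c(i := j)) l \<longleftrightarrow> c' k = c' l" if "k \<in> B" "l \<in> B" for k l
    using that j(2)[of k] j(2)[of l] agree[of k l] by (cases "k = i"; cases "l = i") (auto simp: eq_commute)
  have "(c(i := j)) ` B \<subseteq> S" using j(1) assms(3) by auto
  moreover have "card ((c(i := j)) ` B) = card S"
    using card_image_eq_kernel[of B "c(i := j)" c'] assms(1,4) ker by simp
  ultimately have "(c(i := j)) ` B = S" using S by (simp add: card_subset_eq)
  then show ?thesis using j(1) ker by blast
qed

text \<open>Surjectivity makes the two recolourings compatible: if the colour \<open>q'\<close> that \<open>z\<close> dictates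
  for \<open>k\<close> after recolouring \<open>i\<close> differed from \<open>q\<close>, some colour would be missed by one of
  the four colourings.\<close>

lemma surj_recolour2:
  assumes "finite B" "i \<in> B" "k \<in> B" "i \<noteq> k"
    and "c ` B = S" "(c(i := p)) ` B = S" "(c(k := q)) ` B = S" "z ` B = S"
    and agree_i: "\<And>l m. l \<in> B - {k} \<Longrightarrow> m \<in> B - {k} \<Longrightarrow> (c(i := p)) l = (c(i := p)) m \<longleftrightarrow> z l = z m"
    and agree_k: "\<And>l m. l \<in> B - {i} \<Longrightarrow> m \<in> B - {i} \<Longrightarrow> (c(k := q)) l = (c(k := q)) m \<longleftrightarrow> z l = z m"
  shows "p = q \<longleftrightarrow> z i = z k"
proof -
  obtain q' where q': "q' \<in> S" "(c(i := p, k := q')) ` B = S"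
    "\<And>l m. l \<in> B \<Longrightarrow> m \<in> B \<Longrightarrow> (c(i := p, k := q')) l = (c(i := p, k := q')) m \<longleftrightarrow> z l = z m"
    using surj_recolour[OF assms(1,3,6,8) agree_i] by blast
  have "q = q'"
  proof (rule ccontr)
    assume ne: "q \<noteq> q'"
    have rest: "c l = q' \<longleftrightarrow> c l = q" if "l \<in> B" "l \<noteq> i" "l \<noteq> k" for l
      using q'(3)[OF that(1) assms(3)] agree_k[of l k] that assms(3,4) by auto
    have "(c(k := q)) k \<in> (c(k := q)) ` B" using assms(3) by (rule imageI)
    then have "q \<in> S" by (simp only: assms(7) fun_upd_same)
    then have mem: "q' \<in> (c(k := q)) ` B" "q \<in> (c(i := p, k := q')) ` B" "q \<in> c ` B"
      "q' \<in> (c(i := p)) ` B"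
      by (simp_all only: assms(5-7) q'(1,2))
    obtain l1 where l1: "l1 \<in> B" "(c(k := q)) l1 = q'" using mem(1) by (elim imageE) simp
    obtain l2 where l2: "l2 \<in> B" "(c(i := p, k := q')) l2 = q" using mem(2) by (elim imageE) simp
    obtain l3 where l3: "l3 \<in> B" "c l3 = q" using mem(3) by (elim imageE) simp
    obtain l4 where l4: "l4 \<in> B" "(c(i := p)) l4 = q'" using mem(4) by (elim imageE) simp
    note l = l1 l2 l3 l4
    have "c i = q'" using l(1,2) ne rest[of l1] by (auto split: if_splits)
    moreover have "p = q" using l(3,4) ne rest[of l2] assms(4) by (auto split: if_splits)
    moreover have "c k = q" using l(5,6) ne rest[of l3] \<open>c i = q'\<close> by metis
    ultimately show False using l(7,8) ne rest[of l4] by (auto split: if_splits)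
  qed
  then show ?thesis using q'(3)[OF assms(2,3)] assms(4) by auto
qed

section \<open>Averaging by resampling coordinates\<close>

text \<open>Exchanging the coordinate \<open>x i\<close> with \<open>v\<close> is an involution of
  transversals times \<open>V i\<close>: replacing one coordinate by a uniform vertex leaves the
  uniform measure unchanged.\<close>

lemma sum_resample:
  fixes g :: "('i \<Rightarrow> 'a) \<Rightarrow> real"
  assumes "i \<in> R"
  shows "(\<Sum>x\<in>PiE R V. \<Sum>v\<in>V i. g (x(i := v))) = real (card (V i)) * (\<Sum>x\<in>PiE R V. g x)"
proof -
  have "(\<Sum>x\<in>PiE R V. \<Sum>v\<in>V i. g (x(i := v))) = (\<Sum>(x, v)\<in>PiE R V \<times> V i. g (x(i := v)))"
    by (rule sum.cartesian_product)
  also have "\<dots> = (\<Sum>(x, v)\<in>PiE R V \<times> V i. g x)"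
    using assms by (intro sum.reindex_bij_witness[where i = "\<lambda>(x, v). (x(i := v), x i)"
          and j = "\<lambda>(x, v). (x(i := v), x i)"]) (auto simp: PiE_mem fun_upd_in_PiE PiE_fun_upd insert_absorb)
  also have "\<dots> = (\<Sum>x\<in>PiE R V. \<Sum>v\<in>V i. g x)"
    by (rule sum.cartesian_product[symmetric])
  finally show ?thesis by (simp add: sum_distrib_left)
qed

lemma sum_resample2:
  fixes g :: "('i \<Rightarrow> 'a) \<Rightarrow> real"
  assumes "i \<in> R" "k \<in> R"
  shows "(\<Sum>x\<in>PiE R V. \<Sum>v\<in>V i. \<Sum>w\<in>V k. g (x(i := v, k := w))) =
    real (card (V i)) * real (card (V k)) * (\<Sum>x\<in>PiE R V. g x)"
  using sum_resample[OF assms(1), of "\<lambda>y. \<Sum>w\<in>V k. g (y(k := w))" V] sum_resample[OF assms(2), of g V]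
  by simp

lemma card_filter_prod:
  assumes "finite A" "finite B"
  shows "real (card {(v, w) \<in> A \<times> B. Q v w}) = (\<Sum>v\<in>A. \<Sum>w\<in>B. of_bool (Q v w))"
proof -
  have "(\<Sum>v\<in>A. \<Sum>w\<in>B. of_bool (Q v w) :: real) = (\<Sum>(v, w)\<in>A \<times> B. of_bool (Q v w))"
    by (rule sum.cartesian_product)
  also have "\<dots> = (\<Sum>p\<in>A \<times> B. of_bool (case p of (v, w) \<Rightarrow> Q v w))"
    by (intro sum.cong) auto
  also have "\<dots> = real (card ((A \<times> B) \<inter> {p. case p of (v, w) \<Rightarrow> Q v w}))"
    using assms by (subst sum_of_bool_eq) auto
  also have "(A \<times> B) \<inter> {p. case p of (v, w) \<Rightarrow> Q v w} = {(v, w) \<in> A \<times> B. Q v w}" by auto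
  finally show ?thesis by simp
qed

text \<open>Two coordinates of a uniform transversal form a uniform pair of
  \<open>V i \<times> V k\<close>; the identity is multiplied out so that no size appears as a
  divisor.\<close>

lemma sum_transversals_pair:
  assumes "i \<in> R" "k \<in> R" "i \<noteq> k" "finite (V i)" "finite (V k)"
  shows "real (card (V i)) * real (card (V k)) * (\<Sum>x\<in>PiE R V. of_bool (Q (x i) (x k))) =
    real (card (PiE R V)) * real (card {(v, w) \<in> V i \<times> V k. Q v w})"
  using sum_resample2[OF assms(1,2), of "\<lambda>x. of_bool (Q (x i) (x k))" V] assms(3)
  unfolding card_filter_prod[OF assms(4,5)] by simp

lemma card_ordered_edges:
  assumes "finite E" "\<And>e. e \<in> E \<Longrightarrow> card e = 2"
  shows "card {(v, w). {v, w} \<in> E} = 2 * card E"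
proof -
  have "{(v, w). {v, w} \<in> E} = (\<Union>e\<in>E. {(v, w). {v, w} = e})" by auto
  also have "card \<dots> = (\<Sum>e\<in>E. card {(v, w). {v, w} = e})"
  proof (rule card_UN_disjoint[OF assms(1)])
    show "\<forall>e\<in>E. finite {(v, w). {v, w} = e}"
    proof
      fix e assume "e \<in> E"
      then have "finite e" using assms(2) by (metis card.infinite zero_neq_numeral)
      moreover have "{(v, w). {v, w} = e} \<subseteq> e \<times> e" by auto
      ultimately show "finite {(v, w). {v, w} = e}" by (meson finite_SigmaI finite_subset)
    qed
  qed auto
  also have "\<dots> = (\<Sum>e\<in>E. 2)"
  proof (rule sum.cong[OF refl])
    fix e assume "e \<in> E"
    then obtain a b where "e = {a, b}" "a \<noteq> b" using assms(2) by (meson card_2_iff)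
    then have "{(v, w). {v, w} = e} = {(a, b), (b, a)}" "(a, b) \<noteq> (b, a)"
      by (auto simp: doubleton_eq_iff)
    then show "card {(v, w). {v, w} = e} = 2" by simp
  qed
  finally show ?thesis by simp
qed

section \<open>Random transversals\<close>

locale multipartite_graph =
  fixes r s :: nat and n :: "nat \<Rightarrow> nat" and V :: "nat \<Rightarrow> 'a set" and E :: "'a set set"
  assumes s_pos: "1 \<le> s" and s_le: "s \<le> r"
    and n_antimono: "antimono_on {1..r} n"
    and V_finite: "\<And>i. i \<in> {1..r} \<Longrightarrow> finite (V i)"
    and card_V: "\<And>i. i \<in> {1..r} \<Longrightarrow> card (V i) = n i"
    and V_disjoint: "disjoint_family_on V {1..r}"
    and E_multipartite: "E \<subseteq> complete_multipartite {1..r} V"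
    and E_free: "clique_free (\<Union>i\<in>{1..r}. V i) E (Suc s)"
begin

text \<open>Empty parts are allowed, and a single one would leave no transversal at all.\<close>

definition R :: "nat set" where "R = {i \<in> {1..r}. V i \<noteq> {}}"
definition transversals :: "(nat \<Rightarrow> 'a) set" where "transversals = PiE R V"
text \<open>Doubled to match the ordered pairs of \<open>pair_weight\<close>; accordingly
  \<open>defect\<close> is twice the shortfall of the sampled graph.\<close>

definition F :: real where "F = 2 * real (multipartite_turan n r (Suc s))"
definition adj :: "(nat \<Rightarrow> 'a) \<Rightarrow> nat \<Rightarrow> nat \<Rightarrow> bool" where "adj x i k \<longleftrightarrow> {x i, x k} \<in> E"
definition defect :: "(nat \<Rightarrow> 'a) \<Rightarrow> real" where
  "defect x = F - pair_weight R (\<lambda>i. real (n i)) (adj x)"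

lemma R_sub: "R \<subseteq> {1..r}" and finite_R: "finite R"
  by (auto simp: R_def)

lemma R_r: "i \<in> R \<Longrightarrow> i \<in> {1..r}"
  by (simp add: R_def)

lemma V_unique: "v \<in> V i \<Longrightarrow> v \<in> V k \<Longrightarrow> i \<in> {1..r} \<Longrightarrow> k \<in> {1..r} \<Longrightarrow> i = k"
  using V_disjoint unfolding disjoint_family_on_def by blast

lemma n_pos: "i \<in> R \<Longrightarrow> 0 < n i"
  using card_V[of i, symmetric] V_finite[of i] by (simp add: R_def card_gt_0_iff)

lemma n_outside: "i \<in> {1..r} - R \<Longrightarrow> n i = 0"
  using card_V[of i] by (auto simp: R_def)

lemma edge_cases:
  assumes "e \<in> E"
  obtains i k v w where "e = {v, w}" "i \<in> {1..r}" "k \<in> {1..r}" "i \<noteq> k" "v \<in> V i" "w \<in> V k"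
  using assms E_multipartite unfolding complete_multipartite_def by blast

lemma no_edge_inside: "v \<in> V i \<Longrightarrow> w \<in> V i \<Longrightarrow> i \<in> {1..r} \<Longrightarrow> {v, w} \<notin> E"
  by (metis V_unique doubleton_eq_iff edge_cases)

lemma card_edge: "e \<in> E \<Longrightarrow> card e = 2"
  by (metis V_unique card_2_iff edge_cases)

lemma finite_E: "finite E"
proof (rule finite_subset)
  show "E \<subseteq> Pow (\<Union>i\<in>{1..r}. V i)" by (auto elim!: edge_cases)
qed (use V_finite in auto)

lemma V_R: "i \<in> R \<Longrightarrow> finite (V i)" "i \<in> R \<Longrightarrow> card (V i) = n i"
  using V_finite card_V R_r by blast+

lemma finite_transversals: "finite transversals"
  unfolding transversals_def using finite_R V_R(1) by (intro finite_PiE)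

lemma card_transversals: "0 < card transversals"
proof -
  have "card transversals = (\<Prod>i\<in>R. n i)"
    unfolding transversals_def using finite_R V_R by (simp add: card_PiE)
  then show ?thesis using n_pos by (simp add: prod_pos)
qed

lemma transversal_in: "x \<in> transversals \<Longrightarrow> i \<in> R \<Longrightarrow> x i \<in> V i"
  unfolding transversals_def by (rule PiE_mem)

lemma adj_sym: "adj x i k \<longleftrightarrow> adj x k i"
  by (simp add: adj_def insert_commute)

lemma adj_irrefl: "\<not> adj x i i"
  unfolding adj_def using card_edge by force

lemma adj_clique_free:
  assumes "x \<in> transversals"
  shows "\<not> (\<exists>S\<subseteq>R. card S = Suc s \<and> (\<forall>u\<in>S. \<forall>v\<in>S. u \<noteq> v \<longrightarrow> adj x u v))"
proof
  assume "\<exists>S\<subseteq>R. card S = Suc s \<and> (\<forall>u\<in>S. \<forall>v\<in>S. u \<noteq> v \<longrightarrow> adj x u v)"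
  then obtain S where S: "S \<subseteq> R" "card S = Suc s" "\<forall>u\<in>S. \<forall>v\<in>S. u \<noteq> v \<longrightarrow> adj x u v" by blast
  have "inj_on x S"
  proof (rule inj_onI)
    fix i k assume ik: "i \<in> S" "k \<in> S" "x i = x k"
    then show "i = k" using transversal_in[OF assms] S(1) V_unique R_r by (metis subsetD)
  qed
  then have "card (x ` S) = Suc s" using S(2) card_image by metis
  moreover have "finite (x ` S)" using S(1) finite_R finite_subset by blast
  moreover have "x ` S \<subseteq> (\<Union>i\<in>{1..r}. V i)"
    using transversal_in[OF assms] S(1) R_sub by blast
  moreover have "\<forall>u\<in>x ` S. \<forall>v\<in>x ` S. u \<noteq> v \<longrightarrow> {u, v} \<in> E"
    using S(3) unfolding adj_def by auto
  ultimately have "\<exists>T\<subseteq>\<Union>i\<in>{1..r}. V i. finite T \<and> card T = Suc s \<and>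
      (\<forall>u\<in>T. \<forall>v\<in>T. u \<noteq> v \<longrightarrow> {u, v} \<in> E)"
    by (intro exI[of _ "x ` S"] conjI)
  with E_free show False unfolding clique_free_def by (rule notE)
qed

lemma cut_weight_le_F:
  assumes "c ` R \<subseteq> {1..s}"
  shows "cut_weight R (\<lambda>i. real (n i)) c \<le> F"
proof -
  \<comment> \<open>Empty parts carry no weight, so any legal colour will do for them; 1 is legal
    because \<open>s\<close> is positive.\<close>
  define c' where "c' i = (if i \<in> R then c i else 1)" for i
  have "c' ` {1..r} \<subseteq> {1..s}" using assms s_pos by (auto simp: c'_def)
  then have "cut_weight {1..r} (\<lambda>i. real (n i)) c' \<le> F"
    unfolding F_def using s_le by (rule cut_weight_le_turan)
  moreover have "cut_weight R (\<lambda>i. real (n i)) c' \<le> cut_weight {1..r} (\<lambda>i. real (n i)) c'"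
    using R_sub by (intro pair_weight_subset) auto
  moreover have "cut_weight R (\<lambda>i. real (n i)) c' = cut_weight R (\<lambda>i. real (n i)) c"
    by (intro pair_weight_cong) (auto simp: c'_def)
  ultimately show ?thesis by linarith
qed

abbreviation class_size :: "nat set \<Rightarrow> (nat \<Rightarrow> nat) \<Rightarrow> nat \<Rightarrow> nat" where
  "class_size B c j \<equiv> sum n {k \<in> B. c k = j}"

text \<open>By \<open>degree_majorization\<close>, weight plus monochromatic weight is at most the
  cut, which is at most \<open>F\<close>. So the monochromatic weight is at most the defect, the
  weight of missing bichromatic pairs at most twice the defect, and the cut is within the defect of
  \<open>F\<close>. A disagreeing pair is counted in both orders, which makes up for the factor 2,
  and a cut this close to its maximum cannot gain more than the defect by moving one part.\<close>

lemma transversal_colouring: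
  assumes "x \<in> transversals"
  obtains c where "c ` R \<subseteq> {1..s}" "0 \<le> defect x"
    "\<And>i k. i \<in> R \<Longrightarrow> k \<in> R \<Longrightarrow> i \<noteq> k \<Longrightarrow> (adj x i k \<longleftrightarrow> c i = c k) \<Longrightarrow> real (n i) * real (n k) \<le> defect x"
    "\<And>i j. i \<in> R \<Longrightarrow> j \<in> {1..s} \<Longrightarrow> j \<noteq> c i \<Longrightarrow>
      2 * real (n i) * (real (class_size R c (c i)) - real (n i) - real (class_size R c j)) \<le> defect x"
proof -
  let ?w = "pair_weight R (\<lambda>i. real (n i))"
  obtain c :: "nat \<Rightarrow> nat" where c: "c ` R \<subseteq> {1..s}"
    "?w (adj x) + ?w (\<lambda>i k. adj x i k \<and> c i = c k) \<le> cut_weight R (\<lambda>i. real (n i)) c"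
    using degree_majorization[OF finite_R _ adj_sym adj_irrefl adj_clique_free[OF assms],
        where a = "\<lambda>i. real (n i)"] by auto
  let ?mono = "?w (\<lambda>i k. adj x i k \<and> c i = c k)" and ?miss = "?w (\<lambda>i k. c i \<noteq> c k \<and> \<not> adj x i k)"
  have eq: "?w (\<lambda>i k. adj x i k \<and> c i \<noteq> c k) = ?w (\<lambda>i k. c i \<noteq> c k \<and> adj x i k)"
    by (intro pair_weight_cong) auto
  have "?w (adj x) = ?mono + ?w (\<lambda>i k. adj x i k \<and> c i \<noteq> c k)"
    using pair_weight_split[of R "\<lambda>i. real (n i)" "adj x" "\<lambda>i k. c i = c k"] by simp
  moreover have "cut_weight R (\<lambda>i. real (n i)) c = ?w (\<lambda>i k. c i \<noteq> c k \<and> adj x i k) + ?miss"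
    by (rule pair_weight_split)
  moreover have "0 \<le> ?mono" by (intro pair_weight_nonneg) auto
  moreover have "defect x = F - ?w (adj x)" by (rule defect_def)
  moreover note cut_weight_le_F[OF c(1)] c(2) eq
  ultimately have defect: "?miss \<le> 2 * defect x" "?mono \<le> defect x"
    "F - cut_weight R (\<lambda>i. real (n i)) c \<le> defect x" "0 \<le> defect x"
    by linarith+
  show ?thesis
  proof (rule that[OF c(1) defect(4)])
    fix i k assume ik: "i \<in> R" "k \<in> R" "i \<noteq> k" "adj x i k \<longleftrightarrow> c i = c k"
    show "real (n i) * real (n k) \<le> defect x"
    proof (cases "adj x i k")
      case True
      then have "2 * (real (n i) * real (n k)) \<le> ?mono"
        using ik finite_R adj_sym by (intro pair_weight_ge_pair) auto
      then show ?thesis using defect by linarith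
    next
      case False
      then have "2 * (real (n i) * real (n k)) \<le> ?miss"
        using ik finite_R adj_sym by (intro pair_weight_ge_pair) auto
      then show ?thesis using defect by linarith
    qed
  next
    fix i j assume ij: "i \<in> R" "j \<in> {1..s}" "j \<noteq> c i"
    have "(c(i := j)) ` R \<subseteq> {1..s}" using c(1) ij by auto
    from cut_weight_le_F[OF this] defect(3)
      cut_weight_recolour[of R i j c "\<lambda>i. real (n i)", OF finite_R ij(1,3)]
    show "2 * real (n i) * (real (class_size R c (c i)) - real (n i) - real (class_size R c j)) \<le> defect x"
      by (simp add: of_nat_sum)
  qed
qed

lemma sum_adj:
  assumes "i \<in> R" "k \<in> R"
  shows "real (n i) * real (n k) * (\<Sum>x\<in>transversals. of_bool (adj x i k)) =
    real (card transversals) * real (card {(v, w) \<in> V i \<times> V k. {v, w} \<in> E})"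
proof (cases "i = k")
  case True
  then have "{(v, w) \<in> V i \<times> V k. {v, w} \<in> E} = {}"
    using no_edge_inside[OF _ _ R_r] assms by auto
  then have card0: "card {(v, w) \<in> V i \<times> V k. {v, w} \<in> E} = 0" by (simp only: card.empty)
  have sum0: "(\<Sum>x\<in>transversals. of_bool (adj x i k) :: real) = 0"
    using True adj_irrefl by simp
  show ?thesis unfolding card0 sum0 by simp
next
  case False
  then show ?thesis
    using sum_transversals_pair[of i R k V "\<lambda>v w. {v, w} \<in> E", OF assms False] V_R assms
    unfolding transversals_def adj_def by simp
qed

lemma sum_pairs_edges:
  "(\<Sum>i\<in>R. \<Sum>k\<in>R. real (card {(v, w) \<in> V i \<times> V k. {v, w} \<in> E})) = 2 * real (card E)"
proof -
  let ?S = "\<lambda>i k. {(v, w) \<in> V i \<times> V k. {v, w} \<in> E}"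
  have "{(v, w). {v, w} \<in> E} = (\<Union>(i, k)\<in>R \<times> R. ?S i k)"
  proof (intro equalityI subsetI)
    fix p assume "p \<in> {(v, w). {v, w} \<in> E}"
    then obtain v w where p: "p = (v, w)" "{v, w} \<in> E" by auto
    obtain a b i k where ab: "{v, w} = {a, b}" "i \<in> {1..r}" "k \<in> {1..r}" "a \<in> V i" "b \<in> V k"
      using edge_cases[OF p(2)] by metis
    then have "i \<in> R" "k \<in> R" by (auto simp: R_def)
    moreover have "v = a \<and> w = b \<or> v = b \<and> w = a" using ab(1) by (auto simp: doubleton_eq_iff)
    ultimately show "p \<in> (\<Union>(i, k)\<in>R \<times> R. ?S i k)" using p ab by auto
  qed auto
  then have "2 * card E = card (\<Union>(i, k)\<in>R \<times> R. ?S i k)"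
    using card_ordered_edges[OF finite_E card_edge] by simp
  also have "\<dots> = (\<Sum>(i, k)\<in>R \<times> R. card (?S i k))"
  proof (subst card_UN_disjoint)
    show "\<forall>i\<in>R \<times> R. finite (case i of (i, k) \<Rightarrow> ?S i k)"
    proof (clarify)
      fix i k assume "i \<in> R" "k \<in> R"
      then show "finite (?S i k)"
        using V_finite R_r by (intro finite_subset[of "?S i k" "V i \<times> V k"]) auto
    qed
    show "\<forall>i\<in>R \<times> R. \<forall>j\<in>R \<times> R. i \<noteq> j \<longrightarrow> (case i of (i, k) \<Rightarrow> ?S i k) \<inter> (case j of (i, k) \<Rightarrow> ?S i k) = {}"
    proof (clarify, rule ccontr)
      fix i k i' k' assume ik: "i \<in> R" "k \<in> R" "i' \<in> R" "k' \<in> R" "\<not> (i = i' \<and> k = k')" "?S i k \<inter> ?S i' k' \<noteq> {}"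
      then obtain v w where "v \<in> V i" "v \<in> V i'" "w \<in> V k" "w \<in> V k'" by blast
      then have "i = i'" "k = k'"
        using V_unique[OF _ _ R_r R_r] ik(1-4) by blast+
      then show False using ik(5) by blast
    qed
  qed (use finite_R in \<open>auto intro!: sum.cong\<close>)
  finally have "real (2 * card E) = real (\<Sum>(i, k)\<in>R \<times> R. card (?S i k))" by simp
  also have "\<dots> = (\<Sum>i\<in>R. \<Sum>k\<in>R. real (card (?S i k)))"
    by (simp add: sum.cartesian_product split_def)
  finally show ?thesis by simp
qed

text \<open>The weight of the pair \<open>i k\<close> cancels the denominator of the probability
  that it is sampled as an edge, so the mean weight is exactly the number of ordered edges.\<close>

lemma sum_defect: "(\<Sum>x\<in>transversals. defect x) = real (card transversals) * (F - 2 * real (card E))"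
proof -
  have "(\<Sum>x\<in>transversals. pair_weight R (\<lambda>i. real (n i)) (adj x)) =
      (\<Sum>i\<in>R. \<Sum>x\<in>transversals. \<Sum>k\<in>R. real (n i) * real (n k) * of_bool (adj x i k))"
    unfolding pair_weight_def by (rule sum.swap)
  also have "\<dots> = (\<Sum>i\<in>R. \<Sum>k\<in>R. \<Sum>x\<in>transversals. real (n i) * real (n k) * of_bool (adj x i k))"
    by (intro sum.cong refl sum.swap)
  also have "\<dots> = (\<Sum>i\<in>R. \<Sum>k\<in>R. real (card transversals) * real (card {(v, w) \<in> V i \<times> V k. {v, w} \<in> E}))"
    by (intro sum.cong refl) (simp only: sum_distrib_left[symmetric] sum_adj)
  also have "\<dots> = real (card transversals) * (2 * real (card E))"
    unfolding sum_distrib_left[symmetric] sum_pairs_edges ..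
  finally show ?thesis unfolding defect_def by (simp add: sum_subtractf algebra_simps)
qed

lemma n_le_ns: "i \<in> {1..r} \<Longrightarrow> s \<le> i \<Longrightarrow> n i \<le> n s"
  using n_antimono s_pos s_le unfolding monotone_on_def by auto

lemma n_ge_ns: "i \<in> {1..s} \<Longrightarrow> n s \<le> n i"
  using n_antimono s_pos s_le unfolding monotone_on_def by auto

text \<open>The \<open>s - 1\<close> indices below \<open>s\<close> cannot meet all \<open>s\<close>
  colours, and a class without them consists of at most \<open>r\<close> parts of size at most
  \<open>n s\<close>.\<close>

lemma small_class:
  assumes "B \<subseteq> {1..r}"
  shows "\<exists>j\<in>{1..s}. class_size B c j \<le> r * n s"
proof -
  have "card (c ` {1..<s}) < card {1..s}"
    using card_image_le[of "{1..<s}" c] s_pos by simp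
  then have "\<not> {1..s} \<subseteq> c ` {1..<s}"
    using card_mono[of "c ` {1..<s}" "{1..s}"] by auto
  then obtain j where j: "j \<in> {1..s}" "j \<notin> c ` {1..<s}" by blast
  have "class_size B c j \<le> (\<Sum>k | k \<in> B \<and> c k = j. n s)"
  proof (rule sum_mono)
    fix k assume "k \<in> {k \<in> B. c k = j}"
    then have "k \<in> {1..r}" "s \<le> k" using j(2) assms by (force simp: image_iff)+
    then show "n k \<le> n s" by (rule n_le_ns)
  qed
  also have "\<dots> = card {k \<in> B. c k = j} * n s" by simp
  also have "\<dots> \<le> r * n s"
    using card_mono[of "{1..r}" "{k \<in> B. c k = j}"] assms by (intro mult_right_mono) auto
  finally show ?thesis using j(1) by blast
qed

text \<open>The bound is absolute although \<open>V i \<times> V k\<close> may be huge, because a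
  non-adjacent pair costs its full weight in each transversal. If the colours of \<open>i\<close>
  and \<open>k\<close> differ, the missing edge itself is the loss; if they agree, moving
  \<open>k\<close> away from the large part \<open>i\<close> into a class of size at most
  \<open>r * n s\<close> would gain as much. Averaging over transversals gives the count.\<close>

lemma large_missing_edges:
  assumes "i \<in> R" "k \<in> R" "i \<noteq> k" and large: "2 * r * n s \<le> n i"
  shows "real (card {(v, w) \<in> V i \<times> V k. {v, w} \<notin> E}) \<le> F - 2 * real (card E)"
proof -
  have "real (n i) * real (n k) * of_bool (\<not> adj x i k) \<le> defect x" if x: "x \<in> transversals" for x
  proof -
    obtain c where c: "c ` R \<subseteq> {1..s}" "0 \<le> defect x"
      "\<And>i k. i \<in> R \<Longrightarrow> k \<in> R \<Longrightarrow> i \<noteq> k \<Longrightarrow> (adj x i k \<longleftrightarrow> c i = c k) \<Longrightarrow> real (n i) * real (n k) \<le> defect x"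
      "\<And>i j. i \<in> R \<Longrightarrow> j \<in> {1..s} \<Longrightarrow> j \<noteq> c i \<Longrightarrow>
        2 * real (n i) * (real (class_size R c (c i)) - real (n i) - real (class_size R c j)) \<le> defect x"
      by (rule transversal_colouring[OF x]) blast
    show ?thesis
    proof (cases "adj x i k \<or> c i \<noteq> c k")
      case True
      then show ?thesis using c(2) c(3)[OF assms(1-3)] by auto
    next
      case False
      obtain j where j: "j \<in> {1..s}" "class_size R c j \<le> r * n s"
        using small_class[OF R_sub] by blast
      have "sum n {i, k} \<le> class_size R c (c k)"
        using False assms finite_R by (intro sum_mono2) auto
      then have ck: "n i + n k \<le> class_size R c (c k)" using assms(3) by simp
      have jk: "j \<noteq> c k" using ck j(2) large n_pos[OF assms(2)] by auto
      \<comment> \<open>With \<open>m = r * n s\<close>, at least half of \<open>n i\<close>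
        survives the comparison with the small class, and the factor 2 of the recolouring inequality
        restores the whole.\<close>
      have "real a \<le> 2 * (real C - real b - real J)" if "a + b \<le> C" "2 * m \<le> a" "J \<le> m" for a b C J m :: nat
      proof -
        have "real (a + b) \<le> real C" "real (2 * m) \<le> real a" "real J \<le> real m"
          using that by (simp_all only: of_nat_le_iff)
        then show ?thesis by simp
      qed
      from this[OF ck _ j(2)] have "real (n i) \<le>
          2 * (real (class_size R c (c k)) - real (n k) - real (class_size R c j))"
        using large by simp
      then have "real (n k) * real (n i) \<le>
          real (n k) * (2 * (real (class_size R c (c k)) - real (n k) - real (class_size R c j)))"
        by (intro mult_left_mono) auto
      also have "\<dots> \<le> defect x" using c(4)[OF assms(2) j(1) jk] by (simp only: mult.assoc mult.left_commute)
      finally show ?thesis using False by (simp add: mult.commute)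
    qed
  qed
  then have "(\<Sum>x\<in>transversals. real (n i) * real (n k) * of_bool (\<not> adj x i k)) \<le> (\<Sum>x\<in>transversals. defect x)"
    by (rule sum_mono)
  moreover have "(\<Sum>x\<in>transversals. real (n i) * real (n k) * of_bool (\<not> adj x i k)) =
      real (card transversals) * real (card {(v, w) \<in> V i \<times> V k. {v, w} \<notin> E})"
    using sum_transversals_pair[of i R k V "\<lambda>v w. {v, w} \<notin> E", OF assms(1-3)] V_R assms(1,2)
    unfolding transversals_def adj_def sum_distrib_left[symmetric] by simp
  ultimately show ?thesis
    using sum_defect card_transversals by simp
qed

end

section \<open>Near-extremal graphs\<close>

text \<open>\<open>\<delta>\<close> is chosen last. A transversal is good if its defect is at most \<open>\<theta>N\<^sup>2\<close>, \<open>b\<close> bounds the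
  proportion of bad transversals, and \<open>\<sigma>N\<^sup>2\<close> the number of pairs of vertices of two given parts whose
  adjacency disagrees with their classes. \<open>\<gamma>'\<close> must be much smaller than \<open>\<gamma>\<close> because the parts below \<open>\<gamma>N\<close> perturb the sizes of the
  classes by an amount that has to be negligible against a part of size \<open>\<gamma>N\<close>.\<close>

locale near_extremal = multipartite_graph +
  fixes \<gamma> \<gamma>' \<delta> \<zeta> \<theta> \<mu> b \<psi> \<sigma> :: real
  assumes \<gamma>: "0 < \<gamma>" "\<gamma> \<le> 1"
    and \<zeta>: "0 < \<zeta>" "100 * real r ^ 2 * \<zeta> \<le> \<gamma>"
    and \<gamma>': "0 < \<gamma>'" "4 * real r * \<gamma>' \<le> \<zeta>"
    and \<theta>: "0 < \<theta>" "\<theta> < \<gamma> ^ 2" "2 * \<theta> \<le> \<gamma> * \<zeta>"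
    and \<mu>: "0 < \<mu>" "4 * real r ^ 2 * \<mu> \<le> \<zeta>"
    and b: "2 * \<delta> \<le> b * \<theta>" and \<delta>: "0 < \<delta>"
    and \<psi>: "\<psi> = (1 + real r) ^ 2 * b" "8 * real r ^ 2 * \<psi> \<le> \<zeta>"
    and \<sigma>: "\<sigma> = 4 * real r ^ 2 * \<psi> + 2 * \<delta>" "4 * real r ^ 2 * \<sigma> \<le> \<zeta> ^ 2"
    and count: "b + real r ^ 2 * (\<sigma> / \<gamma> ^ 2) < (\<mu> / (2 * real r)) ^ r"
    and n_s_pos: "0 < n s"
    and gap: "\<And>i. i \<in> {1..r} \<Longrightarrow> real (n i) < \<gamma> * real (n s) \<Longrightarrow> real (n i) < \<gamma>' * real (n s)"
    and dense: "real (multipartite_turan n r (Suc s)) - \<delta> * real (n s) ^ 2 \<le> real (card E)"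
begin

abbreviation N :: real where "N \<equiv> real (n s)"
definition B :: "nat set" where "B = {i \<in> {1..r}. \<gamma> * N \<le> real (n i)}"
text \<open>The parts of size comparable with \<open>N\<close>. Only these are resampled: a part of
  \<open>B - M\<close> is alone in its class in every balanced colouring
  (\<open>balanced_large\<close>), so its vertices need no individual colours.\<close>

definition M :: "nat set" where "M = {i \<in> B. n i < 2 * r * n s}"
definition good :: "(nat \<Rightarrow> 'a) \<Rightarrow> bool" where "good x \<longleftrightarrow> x \<in> transversals \<and> defect x \<le> \<theta> * N ^ 2"
text \<open>Sizes are natural numbers, so a slack of \<open>\<zeta> * N\<close> may be rounded down
  (\<open>le_add_h\<close>), after which all comparisons are made between integers.\<close>

definition h :: nat where "h = nat \<lfloor>\<zeta> * N\<rfloor>"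
text \<open>The target class is named by an index \<open>k\<close> instead of a colour. Apart from
  the range, the condition then depends only on which indices share a colour
  (\<open>balanced_kernel\<close>).\<close>

definition balanced :: "(nat \<Rightarrow> nat) \<Rightarrow> bool" where
  "balanced c \<longleftrightarrow> c ` B = {1..s} \<and>
     (\<forall>i\<in>B. \<forall>k\<in>B. c i \<noteq> c k \<longrightarrow> class_size B c (c i) \<le> class_size B c (c k) + n i + h)"
definition represents :: "(nat \<Rightarrow> 'a) \<Rightarrow> (nat \<Rightarrow> nat) \<Rightarrow> bool" where
  "represents x c \<longleftrightarrow> (\<forall>i\<in>B. \<forall>k\<in>B. adj x i k \<longleftrightarrow> c i \<noteq> c k)"

lemma N_pos: "0 < N"
  using n_s_pos by simp

lemma r_pos: "1 \<le> real r"
  using s_pos s_le by simp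

lemma b_pos: "0 < b"
  using b \<delta> \<theta>(1) by (metis less_le_trans mult_pos_pos zero_less_numeral zero_less_mult_pos2)

lemma \<psi>_pos: "0 < \<psi>"
  using \<psi>(1) b_pos r_pos by simp

lemma \<sigma>_pos: "0 < \<sigma>"
  using \<sigma>(1) \<psi>_pos r_pos \<delta> by (simp add: add_pos_pos)

lemma \<zeta>_le: "100 * real r * \<zeta> \<le> \<gamma>" "100 * \<zeta> \<le> \<gamma>" "100 * \<zeta> \<le> 1"
proof -
  have "real r * 1 \<le> real r ^ 2" unfolding power2_eq_square using r_pos by (intro mult_left_mono) auto
  then have "real r * \<zeta> \<le> real r ^ 2 * \<zeta>" using \<zeta>(1) by (intro mult_right_mono) auto
  then show 1: "100 * real r * \<zeta> \<le> \<gamma>" using \<zeta>(2) by linarith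
  have "1 * \<zeta> \<le> real r * \<zeta>" using r_pos \<zeta>(1) by (intro mult_right_mono) auto
  then show "100 * \<zeta> \<le> \<gamma>" using 1 by linarith
  then show "100 * \<zeta> \<le> 1" using \<gamma>(2) by linarith
qed

lemma B_r: "i \<in> B \<Longrightarrow> i \<in> {1..r}"
  by (simp add: B_def)

lemma B_sub: "B \<subseteq> {1..r}"
  by (auto simp: B_def)

lemma finite_B: "finite B"
  by (simp add: B_def)

lemma n_B: "i \<in> B \<Longrightarrow> \<gamma> * N \<le> real (n i)"
  by (simp add: B_def)

lemma n_small: "i \<in> {1..r} - B \<Longrightarrow> real (n i) < \<gamma>' * N"
  using gap by (auto simp: B_def)

lemma B_R: "i \<in> B \<Longrightarrow> i \<in> R"
proof (rule ccontr)
  assume i: "i \<in> B" "i \<notin> R"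
  then have "n i = 0" using n_outside B_r by blast
  then show False using n_B[OF i(1)] \<gamma>(1) N_pos by (simp add: mult_le_0_iff)
qed

lemma s_B: "i \<in> {1..s} \<Longrightarrow> i \<in> B"
proof -
  assume i: "i \<in> {1..s}"
  have "\<gamma> * N \<le> 1 * N" using \<gamma>(2) N_pos by (intro mult_right_mono) auto
  also have "\<dots> \<le> real (n i)" using n_ge_ns[OF i] by simp
  finally show ?thesis using i s_le by (simp add: B_def)
qed

lemma h_le: "real h \<le> \<zeta> * N"
  unfolding h_def using \<zeta>(1) N_pos by simp

lemma le_add_h: "real a \<le> real c + \<zeta> * N \<Longrightarrow> a \<le> c + h"
proof -
  assume "real a \<le> real c + \<zeta> * N"
  then have "int a - int c \<le> \<lfloor>\<zeta> * N\<rfloor>" by (simp add: le_floor_iff)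
  then show ?thesis unfolding h_def by linarith
qed

lemma h_small: "i \<in> B \<Longrightarrow> 100 * r * h \<le> n i" "100 * h \<le> n s"
proof -
  have "real (100 * r * h) \<le> 100 * real r * (\<zeta> * N)"
    using h_le by (simp add: mult_left_mono)
  also have "\<dots> \<le> \<gamma> * N" using \<zeta>_le(1) N_pos by (simp add: mult.assoc[symmetric])
  finally have *: "real (100 * r * h) \<le> \<gamma> * N" .
  show ge: "100 * r * h \<le> n i" if "i \<in> B" for i
  proof -
    have "real (100 * r * h) \<le> real (n i)" using * n_B[OF that] by (rule order_trans)
    then show ?thesis by (simp only: of_nat_le_iff)
  qed
  have "1 * (100 * h) \<le> r * (100 * h)" using s_pos s_le by (intro mult_le_mono1) auto
  also have "\<dots> = 100 * r * h" by simp
  also have "\<dots> \<le> n s" using ge[OF s_B[of s]] s_pos by simp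
  finally show "100 * h \<le> n s" by simp
qed

lemma h_less: "h < n s"
  using h_small(2) n_s_pos by linarith

lemma balanced_kernel:
  assumes "balanced c" "c' ` B \<subseteq> {1..s}" "\<And>i k. i \<in> B \<Longrightarrow> k \<in> B \<Longrightarrow> c i = c k \<longleftrightarrow> c' i = c' k"
  shows "balanced c'"
proof -
  have "card (c' ` B) = card {1..s}"
    using card_image_eq_kernel[of B c' c] assms finite_B by (simp add: balanced_def)
  then have "c' ` B = {1..s}" using assms(2) by (intro card_subset_eq) auto
  moreover have "class_size B c' (c' i) = class_size B c (c i)" if "i \<in> B" for i
    using assms(3) that by (intro sum.cong) auto
  ultimately show ?thesis using assms(1,3) by (simp add: balanced_def)
qed

lemma class_size_pair:
  assumes "i \<in> A" "k \<in> A" "i \<noteq> k" "c i = c k" "finite A"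
  shows "n i + n k \<le> class_size A c (c i)"
proof -
  have "sum n {i, k} \<le> class_size A c (c i)"
    using assms by (intro sum_mono2) auto
  then show ?thesis using assms(3) by simp
qed

lemma sum_small: "real (sum n ({1..r} - B)) \<le> \<zeta> / 4 * N"
proof -
  have "real (sum n ({1..r} - B)) \<le> (\<Sum>i\<in>{1..r} - B. \<gamma>' * N)"
    unfolding of_nat_sum using n_small by (intro sum_mono less_imp_le) auto
  also have "\<dots> \<le> real r * (\<gamma>' * N)"
  proof -
    have "card ({1..r} - B) \<le> r" using card_mono[of "{1..r}" "{1..r} - B"] by simp
    then show ?thesis using \<gamma>'(1) N_pos by (simp add: mult_right_mono)
  qed
  also have "\<dots> \<le> \<zeta> / 4 * N" using \<gamma>'(2) N_pos by (simp add: mult.assoc[symmetric] mult_right_mono)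
  finally show ?thesis .
qed

text \<open>Some class has size at most \<open>r * n s\<close>. If \<open>k\<close> shared the class
  of \<open>i\<close>, moving \<open>k\<close> there would leave
  \<open>n i \<ge> 2 * r * n s\<close> behind and so improve the balance by more than
  \<open>h\<close>.\<close>

lemma balanced_large:
  assumes "balanced c" "i \<in> B - M" "k \<in> B" "k \<noteq> i"
  shows "c i \<noteq> c k"
proof
  assume eq: "c i = c k"
  have large: "2 * (r * n s) \<le> n i" using assms(2) by (auto simp: M_def)
  obtain j where j: "j \<in> {1..s}" "class_size B c j \<le> r * n s"
    using small_class[OF B_sub] by blast
  have "j \<in> c ` B" using j(1) assms(1) by (simp add: balanced_def)
  then obtain l where l: "l \<in> B" "c l = j" by blast
  have ik: "n i + n k \<le> class_size B c (c i)"
    using assms eq finite_B by (intro class_size_pair) auto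
  have rn: "1 * n s \<le> r * n s" using s_pos s_le by (intro mult_le_mono1) auto
  have "c k \<noteq> c l"
  proof
    assume "c k = c l"
    then have "n i + n k \<le> r * n s" using ik j(2) eq l(2) by simp
    then show False using large rn n_s_pos by linarith
  qed
  then have "class_size B c (c k) \<le> class_size B c (c l) + n k + h"
    using assms(1,3) l(1) by (simp add: balanced_def)
  then have "n i + n k \<le> r * n s + n k + h" using ik eq j(2) l(2) by simp
  then show False using large h_less rn by linarith
qed

lemma good_colouring:
  assumes "good x"
  obtains c where "balanced c" "represents x c"
proof -
  have x: "x \<in> transversals" "defect x \<le> \<theta> * N ^ 2" using assms by (simp_all add: good_def)
  obtain c where c: "c ` R \<subseteq> {1..s}" "0 \<le> defect x"
    "\<And>i k. i \<in> R \<Longrightarrow> k \<in> R \<Longrightarrow> i \<noteq> k \<Longrightarrow> (adj x i k \<longleftrightarrow> c i = c k) \<Longrightarrow> real (n i) * real (n k) \<le> defect x"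
    "\<And>i j. i \<in> R \<Longrightarrow> j \<in> {1..s} \<Longrightarrow> j \<noteq> c i \<Longrightarrow>
      2 * real (n i) * (real (class_size R c (c i)) - real (n i) - real (class_size R c j)) \<le> defect x"
    by (rule transversal_colouring[OF x(1)]) blast
  have rep: "represents x c"
    unfolding represents_def
  proof (intro ballI)
    fix i k assume ik: "i \<in> B" "k \<in> B"
    show "adj x i k \<longleftrightarrow> c i \<noteq> c k"
    proof (rule ccontr)
      assume neg: "\<not> (adj x i k \<longleftrightarrow> c i \<noteq> c k)"
      then have "i \<noteq> k" using adj_irrefl by auto
      then have "real (n i) * real (n k) \<le> defect x" using c(3) neg B_R ik by blast
      moreover have "(\<gamma> * N) * (\<gamma> * N) \<le> real (n i) * real (n k)"
        using n_B ik \<gamma>(1) N_pos by (intro mult_mono) auto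
      moreover have "\<theta> * N ^ 2 < \<gamma> ^ 2 * N ^ 2" using \<theta>(2) N_pos by (intro mult_strict_right_mono) auto
      ultimately show False using x(2) by (simp add: power2_eq_square mult_ac)
    qed
  qed
  have move: "class_size B c (c i) \<le> class_size B c j + n i + h"
    if ij: "i \<in> B" "j \<in> {1..s}" "j \<noteq> c i" for i j
  proof -
    define D where "D = real (class_size R c (c i)) - real (n i) - real (class_size R c j)"
    have "D \<le> \<zeta> / 4 * N"
    proof (cases "0 < D")
      case True
      have "2 * (\<gamma> * N) * D \<le> 2 * real (n i) * D"
        using n_B[OF ij(1)] True by (intro mult_right_mono) auto
      also have "\<dots> \<le> \<theta> * N ^ 2"
        using c(4)[OF B_R[OF ij(1)] ij(2,3)] x(2) unfolding D_def by linarith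
      also have "\<dots> \<le> (\<gamma> * \<zeta> / 2) * N ^ 2"
        using \<theta>(3) by (intro mult_right_mono) auto
      finally have "(2 * \<gamma> * N) * D \<le> (2 * \<gamma> * N) * (\<zeta> / 4 * N)"
        by (simp add: power2_eq_square mult_ac)
      then show ?thesis using \<gamma>(1) N_pos by (simp add: mult_le_cancel_left_pos)
    next
      case False
      moreover have "0 \<le> \<zeta> / 4 * N" using \<zeta>(1) N_pos by simp
      ultimately show ?thesis by linarith
    qed
    moreover have "real (class_size B c (c i)) \<le> real (class_size R c (c i))"
      using B_R finite_R by (intro of_nat_mono sum_mono2) auto
    moreover have "0 < \<zeta> * N" using \<zeta>(1) N_pos by simp
    moreover have "real (class_size R c j) \<le> real (class_size B c j) + \<zeta> / 4 * N"
    proof -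
      have "class_size R c j \<le> sum n ({k \<in> B. c k = j} \<union> ({1..r} - B))"
        using R_sub finite_B by (intro sum_mono2) auto
      also have "\<dots> = class_size B c j + sum n ({1..r} - B)"
        using finite_B by (intro sum.union_disjoint) auto
      finally have "real (class_size R c j) \<le> real (class_size B c j) + real (sum n ({1..r} - B))"
        by linarith
      also have "real (sum n ({1..r} - B)) \<le> \<zeta> / 4 * N"
        using sum_small .
      finally show ?thesis by simp
    qed
    ultimately have "real (class_size B c (c i)) \<le> real (class_size B c j + n i) + \<zeta> * N"
      unfolding D_def of_nat_add by argo
    then show ?thesis by (rule le_add_h)
  qed
  have "c ` B = {1..s}"
  proof (rule ccontr)
    assume "c ` B \<noteq> {1..s}"
    then obtain j where j: "j \<in> {1..s}" "j \<notin> c ` B" using c(1) B_R by blast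
    have "c ` {1..s} \<subseteq> {1..s} - {j}" using s_B j(2) c(1) B_R by blast
    then have "card (c ` {1..s}) \<le> card ({1..s} - {j})" by (intro card_mono) auto
    also have "\<dots> < card {1..s}" using j(1) by (intro card_Diff1_less) auto
    finally have "card (c ` {1..s}) < card {1..s}" .
    then have "\<not> inj_on c {1..s}" using card_image by fastforce
    then obtain i k where ik: "i \<in> {1..s}" "k \<in> {1..s}" "i \<noteq> k" "c i = c k"
      unfolding inj_on_def by blast
    have "n i + n k \<le> class_size B c (c i)" using ik s_B finite_B by (intro class_size_pair) auto
    moreover have "class_size B c (c i) \<le> class_size B c j + n i + h"
      using move s_B ik j by blast
    moreover have empty: "{k \<in> B. c k = j} = {}" using j(2) by blast
    have "class_size B c j = 0" unfolding empty by simp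
    ultimately show False using n_ge_ns[OF ik(2)] h_less by simp
  qed
  moreover have "class_size B c (c i) \<le> class_size B c (c k) + n i + h"
    if "i \<in> B" "k \<in> B" "c i \<noteq> c k" for i k
  proof -
    have "c k \<in> {1..s}" using c(1) B_R[OF that(2)] by blast
    then show ?thesis using move[OF that(1)] that(3) by simp
  qed
  ultimately have "balanced c" unfolding balanced_def by blast
  then show ?thesis using rep by (rule that)
qed

lemma F_edges: "F - 2 * real (card E) \<le> 2 * \<delta> * N ^ 2"
  using dense by (simp add: F_def)

lemma missing_edges:
  assumes "i \<in> B - M" "k \<in> B" "k \<noteq> i"
  shows "real (card {(v, w) \<in> V i \<times> V k. {v, w} \<notin> E}) \<le> 2 * \<delta> * N ^ 2"
proof -
  have "i \<in> R" "k \<in> R" "i \<noteq> k" "2 * r * n s \<le> n i"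
    using assms B_R by (auto simp: M_def)
  from large_missing_edges[OF this] show ?thesis using F_edges by linarith
qed

lemma defect_nonneg: "x \<in> transversals \<Longrightarrow> 0 \<le> defect x"
  by (rule transversal_colouring) blast

text \<open>Markov's inequality: the mean defect is at most \<open>2 * \<delta> * N ^ 2\<close>, a
  bad transversal exceeds \<open>\<theta> * N ^ 2\<close>, and
  \<open>2 * \<delta> \<le> b * \<theta>\<close>.\<close>

lemma card_bad:
  "real (card {x \<in> transversals. \<not> good x}) \<le> b * real (card transversals)"
proof -
  let ?bad = "{x \<in> transversals. \<not> good x}"
  have "real (card ?bad) * (\<theta> * N ^ 2) = (\<Sum>x\<in>?bad. \<theta> * N ^ 2)" by simp
  also have "\<dots> \<le> (\<Sum>x\<in>?bad. defect x)"
    by (intro sum_mono) (auto simp: good_def)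
  also have "\<dots> \<le> (\<Sum>x\<in>transversals. defect x)"
    using finite_transversals defect_nonneg by (intro sum_mono2) auto
  also have "\<dots> \<le> real (card transversals) * (2 * \<delta> * N ^ 2)"
    unfolding sum_defect using F_edges by (intro mult_left_mono) auto
  also have "\<dots> \<le> real (card transversals) * (b * \<theta> * N ^ 2)"
    using b by (intro mult_left_mono mult_right_mono) auto
  finally have "real (card ?bad) * (\<theta> * N ^ 2) \<le> (b * real (card transversals)) * (\<theta> * N ^ 2)"
    by (simp add: mult_ac)
  then show ?thesis using \<theta>(1) N_pos by (simp add: mult_le_cancel_right)
qed

lemma sum_bad: "(\<Sum>x\<in>transversals. of_bool (\<not> good x)) \<le> b * real (card transversals)"
proof -
  have "(\<Sum>x\<in>transversals. of_bool (\<not> good x) :: real) = real (card {x \<in> transversals. \<not> good x})"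
    using finite_transversals by (subst sum_of_bool_eq) (auto intro!: arg_cong[where f = card])
  then show ?thesis using card_bad by simp
qed

lemma M_B: "i \<in> M \<Longrightarrow> i \<in> B"
  by (simp add: M_def)

lemma card_filter_V:
  assumes "i \<in> R"
  shows "(\<Sum>v\<in>V i. of_bool (Q v) :: real) = real (card {v \<in> V i. Q v})"
  using V_R(1)[OF assms] by (subst sum_of_bool_eq) (auto intro!: arg_cong[where f = card])

text \<open>First moment method. \<open>Z\<close> adds the indicator of being bad and the
  proportions of bad resamplings in one and in two coordinates. Each of its at most
  \<open>(1 + r) ^ 2\<close> terms has mean at most \<open>b\<close>, so
  \<open>Z x \<le> \<psi>\<close> for some \<open>x\<close>; since \<open>\<psi> < 1\<close>, the
  indicator vanishes there.\<close>

lemma reference: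
  obtains x where "good x"
    "\<And>i. i \<in> M \<Longrightarrow> real (card {v \<in> V i. \<not> good (x(i := v))}) \<le> \<psi> * real (n i)"
    "\<And>i k. i \<in> M \<Longrightarrow> k \<in> M \<Longrightarrow> i \<noteq> k \<Longrightarrow>
      real (card {(v, w) \<in> V i \<times> V k. \<not> good (x(i := v, k := w))}) \<le> \<psi> * (real (n i) * real (n k))"
proof -
  define one where "one i x = real (card {v \<in> V i. \<not> good (x(i := v))}) / real (n i)" for i x
  define two where "two i k x = real (card {(v, w) \<in> V i \<times> V k. \<not> good (x(i := v, k := w))}) /
      (real (n i) * real (n k))" for i k x
  define Z where "Z x = of_bool (\<not> good x) + (\<Sum>i\<in>M. one i x) + (\<Sum>i\<in>M. \<Sum>k\<in>M - {i}. two i k x)" for x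
  let ?T = "real (card transversals)"
  have M: "finite M" "card M \<le> r"
    using finite_B card_mono[of "{1..r}" M] B_sub by (auto simp: M_def)
  have one: "(\<Sum>x\<in>transversals. one i x) \<le> b * ?T" if "i \<in> M" for i
  proof -
    have i: "i \<in> R" using that M_B B_R by blast
    have "(\<Sum>x\<in>transversals. one i x) =
        (\<Sum>x\<in>transversals. \<Sum>v\<in>V i. of_bool (\<not> good (x(i := v)))) / real (n i)"
      unfolding one_def card_filter_V[OF i, symmetric] by (rule sum_divide_distrib[symmetric])
    also have "\<dots> = (\<Sum>x\<in>transversals. of_bool (\<not> good x))"
      using sum_resample[of i R "\<lambda>x. of_bool (\<not> good x)" V, OF i] V_R(2)[OF i] n_pos[OF i]
      unfolding transversals_def by simp
    finally show ?thesis using sum_bad by simp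
  qed
  have two: "(\<Sum>x\<in>transversals. two i k x) \<le> b * ?T" if "i \<in> M" "k \<in> M" for i k
  proof -
    have i: "i \<in> R" and k: "k \<in> R" using that M_B B_R by blast+
    have "(\<Sum>x\<in>transversals. two i k x) =
        (\<Sum>x\<in>transversals. \<Sum>v\<in>V i. \<Sum>w\<in>V k. of_bool (\<not> good (x(i := v, k := w)))) / (real (n i) * real (n k))"
      unfolding two_def card_filter_prod[OF V_R(1)[OF i] V_R(1)[OF k]] by (rule sum_divide_distrib[symmetric])
    also have "\<dots> = (\<Sum>x\<in>transversals. of_bool (\<not> good x))"
      using sum_resample2[of i R k "\<lambda>x. of_bool (\<not> good x)" V, OF i k] V_R(2) i k n_pos[OF i] n_pos[OF k]
      unfolding transversals_def by simp
    finally show ?thesis using sum_bad by simp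
  qed
  have "(\<Sum>x\<in>transversals. Z x) = (\<Sum>x\<in>transversals. of_bool (\<not> good x)) +
      (\<Sum>i\<in>M. \<Sum>x\<in>transversals. one i x) + (\<Sum>i\<in>M. \<Sum>k\<in>M - {i}. \<Sum>x\<in>transversals. two i k x)"
  proof -
    have "(\<Sum>x\<in>transversals. \<Sum>i\<in>M. \<Sum>k\<in>M - {i}. two i k x) =
        (\<Sum>i\<in>M. \<Sum>x\<in>transversals. \<Sum>k\<in>M - {i}. two i k x)"
      by (rule sum.swap)
    also have "\<dots> = (\<Sum>i\<in>M. \<Sum>k\<in>M - {i}. \<Sum>x\<in>transversals. two i k x)"
      by (intro sum.cong refl sum.swap)
    finally show ?thesis
      unfolding Z_def sum.distrib by (simp add: sum.swap[of "\<lambda>x i. one i x"])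
  qed
  also have "\<dots> \<le> b * ?T + (\<Sum>i\<in>M. b * ?T) + (\<Sum>i\<in>M. \<Sum>k\<in>M - {i}. b * ?T)"
    using sum_bad one two by (intro add_mono sum_mono) auto
  also have "\<dots> \<le> b * ?T + (\<Sum>i\<in>M. b * ?T) + (\<Sum>i\<in>M. \<Sum>k\<in>M. b * ?T)"
    using M b_pos by (intro add_mono sum_mono order_refl sum_mono2) auto
  also have "\<dots> = (1 + real (card M) + real (card M) ^ 2) * (b * ?T)"
    by (simp add: algebra_simps power2_eq_square)
  also have "\<dots> \<le> (1 + real r) ^ 2 * (b * ?T)"
  proof (intro mult_right_mono)
    have "real (card M) ^ 2 \<le> real r ^ 2" using M(2) by (intro power_mono) auto
    moreover have "real (card M) \<le> real r" using M(2) by simp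
    moreover have "(1 + real r) ^ 2 = 1 + 2 * real r + real r ^ 2"
      by (simp add: power2_eq_square algebra_simps)
    ultimately show "1 + real (card M) + real (card M) ^ 2 \<le> (1 + real r) ^ 2" by linarith
  qed (use b_pos in simp)
  finally have "(\<Sum>x\<in>transversals. Z x) \<le> (\<Sum>x\<in>transversals. \<psi>)"
    using \<psi>(1) by (simp add: mult_ac)
  then have "\<not> (\<forall>x\<in>transversals. \<psi> < Z x)"
    using sum_strict_mono[of transversals "\<lambda>_. \<psi>" Z] finite_transversals card_transversals
    by fastforce
  then obtain x where x: "x \<in> transversals" "Z x \<le> \<psi>" by (auto simp: not_less)
  have one0: "0 \<le> one i x" for i by (simp add: one_def)
  have two0: "0 \<le> two i k x" for i k by (simp add: two_def)
  have sum0: "0 \<le> (\<Sum>i\<in>M. one i x)" "0 \<le> (\<Sum>i\<in>M. \<Sum>k\<in>M - {i}. two i k x)"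
    by (intro sum_nonneg one0 two0)+
  show ?thesis
  proof (rule that)
    have "8 * 1 * \<psi> \<le> 8 * real r ^ 2 * \<psi>"
      using r_pos \<psi>_pos by (intro mult_right_mono mult_left_mono one_le_power) auto
    then have "\<psi> < 1" using \<psi>(2) \<zeta>_le(3) \<psi>_pos by linarith
    then show "good x" using x(2) sum0 unfolding Z_def by (cases "good x") auto
  next
    fix i assume i: "i \<in> M"
    have "one i x \<le> (\<Sum>i\<in>M. one i x)" using i M(1) one0 by (intro member_le_sum) auto
    moreover have "0 \<le> (of_bool (\<not> good x) :: real)" by simp
    ultimately have "one i x \<le> \<psi>" using x(2) sum0(2) unfolding Z_def by linarith
    then show "real (card {v \<in> V i. \<not> good (x(i := v))}) \<le> \<psi> * real (n i)"
      unfolding one_def using n_pos i M_B B_R by (simp add: divide_le_eq)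
  next
    fix i k assume ik: "i \<in> M" "k \<in> M" "i \<noteq> k"
    have "two i k x \<le> (\<Sum>k\<in>M - {i}. two i k x)" using ik M(1) two0 by (intro member_le_sum) auto
    also have "\<dots> \<le> (\<Sum>i\<in>M. \<Sum>k\<in>M - {i}. two i k x)"
      using ik M(1) two0 by (intro member_le_sum[of i M "\<lambda>i. \<Sum>k\<in>M - {i}. two i k x"] sum_nonneg) auto
    also have "\<dots> \<le> \<psi>"
    proof -
      have "0 \<le> (of_bool (\<not> good x) :: real)" by simp
      then show ?thesis using x(2) sum0(1) unfolding Z_def by linarith
    qed
    finally have "two i k x \<le> \<psi>" .
    then show "real (card {(v, w) \<in> V i \<times> V k. \<not> good (x(i := v, k := w))}) \<le> \<psi> * (real (n i) * real (n k))"
      unfolding two_def using n_pos ik M_B B_R by (simp add: divide_le_eq)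
  qed
qed

end

section \<open>Colouring the vertices from a reference transversal\<close>

lemma real_card_UN_le:
  assumes "finite I" "\<And>i. i \<in> I \<Longrightarrow> real (card (A i)) \<le> u" "card I \<le> m" "0 \<le> u"
  shows "real (card (\<Union>i\<in>I. A i)) \<le> real m * u"
proof -
  have "real (card (\<Union>i\<in>I. A i)) \<le> real (\<Sum>i\<in>I. card (A i))"
    using assms(1) by (intro of_nat_mono card_UN_le)
  also have "\<dots> \<le> (\<Sum>i\<in>I. u)"
    unfolding of_nat_sum using assms(2) by (intro sum_mono) auto
  also have "\<dots> \<le> real m * u"
    using assms(3,4) by (simp add: mult_right_mono)
  finally show ?thesis .
qed

locale reference_colouring = near_extremal +
  fixes x c
  assumes x_good: "good x" and c_balanced: "balanced c" and c_represents: "represents x c"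
    and atypical_count: "\<And>i. i \<in> M \<Longrightarrow> real (card {v \<in> V i. \<not> good (x(i := v))}) \<le> \<psi> * real (n i)"
    and atypical_pair_count: "\<And>i k. i \<in> M \<Longrightarrow> k \<in> M \<Longrightarrow> i \<noteq> k \<Longrightarrow>
      real (card {(v, w) \<in> V i \<times> V k. \<not> good (x(i := v, k := w))}) \<le> \<psi> * (real (n i) * real (n k))"
begin

definition typical :: "nat \<Rightarrow> 'a set" where
  "typical i = {v \<in> V i. i \<in> M \<longrightarrow> good (x(i := v))}"

definition fits :: "nat \<Rightarrow> 'a \<Rightarrow> nat \<Rightarrow> bool" where
  "fits i v j \<longleftrightarrow> j \<in> {1..s} \<and> balanced (c(i := j)) \<and> represents (x(i := v)) (c(i := j))"

text \<open>For atypical vertices and for parts outside \<open>B\<close> the value is a mere default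
  in \<open>{1..s}\<close>: these vertices all belong to \<open>exceptional\<close>, and a colour is
  needed only so that the classes cover all vertices.\<close>

definition col :: "nat \<Rightarrow> 'a \<Rightarrow> nat" where
  "col i v = (if i \<in> M \<and> v \<in> typical i then SOME j. fits i v j else if i \<in> B then c i else 1)"

definition wrong :: "nat \<Rightarrow> nat \<Rightarrow> 'a \<Rightarrow> 'a \<Rightarrow> bool" where
  "wrong i k v w \<longleftrightarrow> ({v, w} \<in> E \<longleftrightarrow> col i v = col k w)"

definition piece :: "nat \<Rightarrow> nat \<Rightarrow> 'a set" where
  "piece i j = {v \<in> typical i. col i v = j}"

definition supp :: "nat \<Rightarrow> nat set" where
  "supp i = {j \<in> {1..s}. \<mu> * N \<le> real (card (piece i j))}"

lemma typical_V: "typical i \<subseteq> V i"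
  by (auto simp: typical_def)

lemma finite_typical: "i \<in> B \<Longrightarrow> finite (typical i)"
  using typical_V V_finite B_r finite_subset by metis

text \<open>The colouring \<open>c'\<close> of the good transversal \<open>x(i := v)\<close> has the
  same kernel as \<open>c\<close> on \<open>B - {i}\<close>, because adjacencies away from
  \<open>i\<close> are unchanged. \<open>surj_recolour\<close> then expresses \<open>c'\<close> in
  the colour names of \<open>c\<close>.\<close>

lemma col_fits:
  assumes i: "i \<in> M" and v: "v \<in> typical i"
  shows "fits i v (col i v)"
proof -
  have iB: "i \<in> B" using i M_B by blast
  have "good (x(i := v))" using assms by (simp add: typical_def)
  then obtain c' where c': "balanced c'" "represents (x(i := v)) c'"
    by (rule good_colouring)
  have "c k = c l \<longleftrightarrow> c' k = c' l" if "k \<in> B - {i}" "l \<in> B - {i}" for k l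
  proof -
    have "adj x k l \<longleftrightarrow> c k \<noteq> c l" "adj (x(i := v)) k l \<longleftrightarrow> c' k \<noteq> c' l"
      using that c'(2) c_represents unfolding represents_def by blast+
    moreover have "adj (x(i := v)) k l \<longleftrightarrow> adj x k l" using that by (simp add: adj_def)
    ultimately show ?thesis by blast
  qed
  then obtain j where j: "j \<in> {1..s}" "(c(i := j)) ` B = {1..s}"
    "\<forall>k\<in>B. \<forall>l\<in>B. (c(i := j)) k = (c(i := j)) l \<longleftrightarrow> c' k = c' l"
    using surj_recolour[OF finite_B iB, of c "{1..s}" c'] c_balanced c'(1) unfolding balanced_def by blast
  have "balanced (c(i := j))"
    using j by (intro balanced_kernel[OF c'(1)]) auto
  moreover have "represents (x(i := v)) (c(i := j))"
    using c'(2) j(3) unfolding represents_def by blast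
  ultimately have "fits i v j" using j(1) by (simp add: fits_def)
  then show ?thesis using assms by (simp add: col_def someI)
qed

lemma c_range: "i \<in> B \<Longrightarrow> c i \<in> {1..s}"
  using c_balanced by (auto simp: balanced_def)

lemma col_range: "col i v \<in> {1..s}"
  using col_fits[of i v] c_range[of i] s_pos unfolding fits_def col_def by (auto split: if_splits)

lemma col_large: "i \<in> B - M \<Longrightarrow> col i v = c i"
  by (simp add: col_def)

text \<open>Off \<open>k\<close>, the colouring \<open>z\<close> of the doubly resampled transversal
  has the kernel of the recolouring dictated by \<open>v\<close>, and off \<open>i\<close> that of
  the one dictated by \<open>w\<close>. \<open>surj_recolour2\<close> concludes that the colours of
  \<open>v\<close> and \<open>w\<close> agree exactly when \<open>z i = z k\<close>, which decides
  their adjacency.\<close>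

lemma good_pair_not_wrong:
  assumes i: "i \<in> M" "v \<in> typical i" and k: "k \<in> M" "w \<in> typical k" and "i \<noteq> k"
    and good: "good (x(i := v, k := w))"
  shows "\<not> wrong i k v w"
proof -
  obtain z where z: "balanced z" "represents (x(i := v, k := w)) z"
    using good by (rule good_colouring)
  note fi = col_fits[OF i] and fk = col_fits[OF k]
  have iB: "i \<in> B" and kB: "k \<in> B" using i k M_B by auto
  have "col i v = col k w \<longleftrightarrow> z i = z k"
  proof (rule surj_recolour2[OF finite_B iB kB \<open>i \<noteq> k\<close>])
    show "c ` B = {1..s}" "(c(i := col i v)) ` B = {1..s}" "(c(k := col k w)) ` B = {1..s}" "z ` B = {1..s}"
      using c_balanced fi fk z(1) by (simp_all only: balanced_def fits_def)
    fix l m assume lm: "l \<in> B - {k}" "m \<in> B - {k}"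
    then have "adj (x(i := v)) l m \<longleftrightarrow> adj (x(i := v, k := w)) l m" by (simp add: adj_def)
    moreover have "adj (x(i := v)) l m \<longleftrightarrow> (c(i := col i v)) l \<noteq> (c(i := col i v)) m"
      using fi lm unfolding fits_def represents_def by blast
    moreover have "adj (x(i := v, k := w)) l m \<longleftrightarrow> z l \<noteq> z m"
      using z(2) lm unfolding represents_def by blast
    ultimately show "(c(i := col i v)) l = (c(i := col i v)) m \<longleftrightarrow> z l = z m" by blast
  next
    fix l m assume lm: "l \<in> B - {i}" "m \<in> B - {i}"
    then have "adj (x(k := w)) l m \<longleftrightarrow> adj (x(i := v, k := w)) l m" by (simp add: adj_def)
    moreover have "adj (x(k := w)) l m \<longleftrightarrow> (c(k := col k w)) l \<noteq> (c(k := col k w)) m"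
      using fk lm unfolding fits_def represents_def by blast
    moreover have "adj (x(i := v, k := w)) l m \<longleftrightarrow> z l \<noteq> z m"
      using z(2) lm unfolding represents_def by blast
    ultimately show "(c(k := col k w)) l = (c(k := col k w)) m \<longleftrightarrow> z l = z m" by blast
  qed
  moreover have "{v, w} \<in> E \<longleftrightarrow> z i \<noteq> z k"
  proof -
    have "adj (x(i := v, k := w)) i k \<longleftrightarrow> z i \<noteq> z k"
      using z(2) iB kB unfolding represents_def by blast
    then show ?thesis using \<open>i \<noteq> k\<close> by (simp add: adj_def)
  qed
  ultimately show ?thesis by (simp add: wrong_def)
qed

text \<open>A large part is alone in its class even after \<open>k\<close> takes the colour of
  \<open>w\<close>. The colours of \<open>v\<close> and \<open>w\<close> therefore differ, and being
  wrong can only mean being non-adjacent.\<close>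

lemma wrong_large:
  assumes i: "i \<in> B - M" and k: "k \<in> B" "k \<noteq> i" "w \<in> typical k" and "wrong i k v w"
  shows "{v, w} \<notin> E"
proof -
  have "c i \<noteq> col k w"
  proof (cases "k \<in> M")
    case True
    then have "balanced (c(k := col k w))" using col_fits k(3) by (simp add: fits_def)
    from balanced_large[OF this i k(1,2)] show ?thesis using k(2) by auto
  next
    case False
    then show ?thesis using balanced_large[OF c_balanced i k(1,2)] col_large[of k w] k(1) by simp
  qed
  then show ?thesis using assms(5) col_large[OF i] by (simp add: wrong_def)
qed

lemma wrong_sym: "wrong i k v w \<longleftrightarrow> wrong k i w v"
  by (auto simp: wrong_def insert_commute)

text \<open>The two summands of \<open>\<sigma>\<close> come from two regimes. If one part is large,
  wrong pairs are missing edges, at most \<open>2 * \<delta> * N ^ 2\<close> in number; if both lie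
  in \<open>M\<close>, their sizes below \<open>2 * r * n s\<close> turn the proportion
  \<open>\<psi>\<close> into \<open>4 * r ^ 2 * \<psi> * N ^ 2\<close> pairs.\<close>

lemma wrong_count:
  assumes "i \<in> B" "k \<in> B" "i \<noteq> k"
  shows "real (card {(v, w) \<in> typical i \<times> typical k. wrong i k v w}) \<le> \<sigma> * N ^ 2"
proof -
  have fin: "finite (V i)" "finite (V k)" using assms B_r V_finite by blast+
  have large: "2 * \<delta> * N ^ 2 \<le> \<sigma> * N ^ 2"
    unfolding \<sigma>(1) using \<psi>_pos by (intro mult_right_mono) auto
  have large_case: "real (card {(v, w) \<in> typical i \<times> typical k. wrong i k v w}) \<le> \<sigma> * N ^ 2"
    if ik: "i \<in> B - M" "k \<in> B" "k \<noteq> i" for i k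
  proof -
    have fin: "finite (V i \<times> V k)" using ik B_r V_finite by blast
    have "card {(v, w) \<in> typical i \<times> typical k. wrong i k v w} \<le> card {(v, w) \<in> V i \<times> V k. {v, w} \<notin> E}"
      using wrong_large[OF ik] typical_V by (intro card_mono finite_subset[OF _ fin]) blast+
    then show ?thesis using missing_edges[OF ik] large by linarith
  qed
  consider "i \<in> B - M" | "k \<in> B - M" | "i \<in> M" "k \<in> M" using assms by blast
  then show ?thesis
  proof cases
    case 1
    then show ?thesis using large_case assms by blast
  next
    case 2
    have "{(v, w) \<in> typical i \<times> typical k. wrong i k v w} =
        prod.swap ` {(w, v) \<in> typical k \<times> typical i. wrong k i w v}"
      using wrong_sym by (auto simp: image_iff)
    then have "card {(v, w) \<in> typical i \<times> typical k. wrong i k v w} =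
        card {(w, v) \<in> typical k \<times> typical i. wrong k i w v}"
      by (simp add: card_image)
    then show ?thesis using large_case[OF 2 assms(1,3)] by simp
  next
    case 3
    have "{(v, w) \<in> typical i \<times> typical k. wrong i k v w} \<subseteq> {(v, w) \<in> V i \<times> V k. \<not> good (x(i := v, k := w))}"
    proof clarify
      fix v w assume vw: "v \<in> typical i" "w \<in> typical k" "wrong i k v w"
      have "\<not> good (x(i := v, k := w))"
        using good_pair_not_wrong[OF 3(1) vw(1) 3(2) vw(2) assms(3)] vw(3) by blast
      then show "(v, w) \<in> V i \<times> V k \<and> \<not> good (x(i := v, k := w))"
        using subsetD[OF typical_V vw(1)] subsetD[OF typical_V vw(2)] by simp
    qed
    moreover have "finite {(v, w) \<in> V i \<times> V k. \<not> good (x(i := v, k := w))}"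
      by (rule finite_subset[of _ "V i \<times> V k"]) (use fin in auto)
    ultimately have "card {(v, w) \<in> typical i \<times> typical k. wrong i k v w} \<le>
        card {(v, w) \<in> V i \<times> V k. \<not> good (x(i := v, k := w))}"
      by (intro card_mono)
    then have "real (card {(v, w) \<in> typical i \<times> typical k. wrong i k v w}) \<le> \<psi> * (real (n i) * real (n k))"
      using atypical_pair_count[OF 3 assms(3)] by linarith
    also have "\<dots> \<le> \<psi> * ((2 * real r * N) * (2 * real r * N))"
    proof (intro mult_left_mono mult_mono)
      have "real (n i) \<le> real (2 * r * n s)" if "i \<in> M" for i
        using that unfolding of_nat_le_iff by (simp add: M_def)
      then show "real (n i) \<le> 2 * real r * N" "real (n k) \<le> 2 * real r * N" using 3 by auto
    qed (use \<psi>_pos in auto)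
    also have "\<dots> = 4 * real r ^ 2 * \<psi> * N ^ 2" by (simp add: power2_eq_square)
    also have "\<dots> \<le> \<sigma> * N ^ 2" unfolding \<sigma>(1) using \<delta> by (intro mult_right_mono) auto
    finally show ?thesis .
  qed
qed

text \<open>The set \<open>exceptional\<close> below becomes part of \<open>X\<close>; each of its four parts has at most
  \<open>\<zeta>N / 4\<close> vertices.\<close>

definition high :: "nat \<Rightarrow> nat \<Rightarrow> 'a set" where
  "high i k = {v \<in> typical i. \<zeta> * N < real (card {w \<in> typical k. wrong i k v w})}"

text \<open>Double counting of wrong pairs: each vertex of \<open>high i k\<close> lies in more than
  \<open>\<zeta> * N\<close> of them.\<close>

lemma card_high:
  assumes "i \<in> B" "k \<in> B" "i \<noteq> k"
  shows "real (card (high i k)) \<le> \<sigma> / \<zeta> * N"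
proof -
  have fin: "finite (typical i)" "finite (typical k)" "finite (high i k)"
    using finite_typical assms by (auto simp: high_def)
  have "real (card (high i k)) * (\<zeta> * N) = (\<Sum>v\<in>high i k. \<zeta> * N)" by simp
  also have "\<dots> \<le> (\<Sum>v\<in>high i k. real (card {w \<in> typical k. wrong i k v w}))"
    by (intro sum_mono) (simp add: high_def)
  also have "\<dots> = real (card (SIGMA v:high i k. {w \<in> typical k. wrong i k v w}))"
    using fin by (subst card_SigmaI) auto
  also have "\<dots> \<le> real (card {(v, w) \<in> typical i \<times> typical k. wrong i k v w})"
    using fin by (intro of_nat_mono card_mono finite_subset[OF _ finite_cartesian_product[OF fin(1,2)]])
      (auto simp: high_def)
  also have "\<dots> \<le> \<sigma> * N ^ 2" by (rule wrong_count[OF assms])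
  also have "\<dots> = (\<sigma> / \<zeta> * N) * (\<zeta> * N)" using \<zeta>(1) by (simp add: power2_eq_square)
  finally show ?thesis by (rule mult_right_le_imp_le) (use \<zeta>(1) N_pos in simp)
qed

definition exceptional :: "'a set" where
  "exceptional = (\<Union>i\<in>{1..r} - B. V i) \<union> (\<Union>i\<in>B. V i - typical i) \<union>
     (\<Union>i\<in>B. \<Union>k\<in>B - {i}. high i k) \<union> (\<Union>i\<in>B. \<Union>j\<in>{1..s} - supp i. piece i j)"

lemma card_B: "card B \<le> r"
  using card_mono[OF _ B_sub] by simp

text \<open>The four quarters are paid for by the upper bounds on \<open>\<gamma>'\<close>,
  \<open>\<psi>\<close>, \<open>\<sigma>\<close> and \<open>\<mu>\<close>, in this order.\<close>

lemma card_exceptional: "card exceptional \<le> h"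
proof -
  have 1: "real (card (\<Union>i\<in>{1..r} - B. V i)) \<le> \<zeta> / 4 * N"
  proof -
    have "card (\<Union>i\<in>{1..r} - B. V i) \<le> (\<Sum>i\<in>{1..r} - B. card (V i))"
      by (intro card_UN_le) auto
    also have "\<dots> = sum n ({1..r} - B)" using card_V by (intro sum.cong) auto
    finally show ?thesis using sum_small by linarith
  qed
  have "real (card (\<Union>i\<in>B. V i - typical i)) \<le> real r * (\<psi> * (2 * real r * N))"
  proof (rule real_card_UN_le[OF finite_B _ card_B])
    fix i assume i: "i \<in> B"
    show "real (card (V i - typical i)) \<le> \<psi> * (2 * real r * N)"
    proof (cases "i \<in> M")
      case True
      then have "V i - typical i = {v \<in> V i. \<not> good (x(i := v))}" by (auto simp: typical_def)
      then have "real (card (V i - typical i)) \<le> \<psi> * real (n i)" using atypical_count[OF True] by simp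
      also have "\<dots> \<le> \<psi> * real (2 * r * n s)"
        using True \<psi>_pos by (intro mult_left_mono of_nat_mono) (auto simp: M_def)
      finally show ?thesis by simp
    next
      case False
      then have "V i - typical i = {}" by (auto simp: typical_def)
      then have "card (V i - typical i) = 0" by (simp only: card.empty)
      then show ?thesis using \<psi>_pos r_pos by simp
    qed
  qed (use \<psi>_pos r_pos in simp)
  also have "\<dots> = 2 * real r ^ 2 * \<psi> * N" by (simp add: power2_eq_square)
  also have "\<dots> \<le> \<zeta> / 4 * N" using \<psi>(2) by (intro mult_right_mono) auto
  finally have 2: "real (card (\<Union>i\<in>B. V i - typical i)) \<le> \<zeta> / 4 * N" .
  have "real (card (\<Union>i\<in>B. \<Union>k\<in>B - {i}. high i k)) \<le> real r * (real r * (\<sigma> / \<zeta> * N))"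
  proof (intro real_card_UN_le[OF finite_B _ card_B] real_card_UN_le)
    show "card (B - {i}) \<le> r" for i using card_B card_mono[of B "B - {i}"] finite_B by auto
  qed (use finite_B card_high \<sigma>_pos \<zeta>(1) in auto)
  also have "\<dots> = real r ^ 2 * \<sigma> / \<zeta> * N" by (simp add: power2_eq_square)
  also have "\<dots> \<le> \<zeta> / 4 * N"
    using \<sigma>(2) \<zeta>(1) by (intro mult_right_mono) (simp_all add: divide_le_eq power2_eq_square)
  finally have 3: "real (card (\<Union>i\<in>B. \<Union>k\<in>B - {i}. high i k)) \<le> \<zeta> / 4 * N" .
  have "real (card (\<Union>i\<in>B. \<Union>j\<in>{1..s} - supp i. piece i j)) \<le> real r * (real r * (\<mu> * N))"
  proof (intro real_card_UN_le[OF finite_B _ card_B] real_card_UN_le)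
    show "card ({1..s} - supp i) \<le> r" for i
      using card_mono[of "{1..s}" "{1..s} - supp i"] s_le by simp
  qed (use \<mu>(1) in \<open>auto simp: supp_def\<close>)
  also have "\<dots> = real r ^ 2 * \<mu> * N" by (simp add: power2_eq_square)
  also have "\<dots> \<le> \<zeta> / 4 * N" using \<mu>(2) by (intro mult_right_mono) auto
  finally have 4: "real (card (\<Union>i\<in>B. \<Union>j\<in>{1..s} - supp i. piece i j)) \<le> \<zeta> / 4 * N" .
  have "card exceptional \<le> card (\<Union>i\<in>{1..r} - B. V i) + card (\<Union>i\<in>B. V i - typical i) +
      card (\<Union>i\<in>B. \<Union>k\<in>B - {i}. high i k) + card (\<Union>i\<in>B. \<Union>j\<in>{1..s} - supp i. piece i j)"
    unfolding exceptional_def by (intro order_trans[OF card_Un_le] add_mono order_refl)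
  then have "real (card exceptional) \<le> real 0 + \<zeta> * N" using 1 2 3 4 by linarith
  then have "card exceptional \<le> 0 + h" by (rule le_add_h)
  then show ?thesis by simp
qed

text \<open>The transversals through the chosen pieces form a box holding a fraction of at least
  \<open>(\<mu> / (2 * r)) ^ r\<close> of all transversals. By \<open>count\<close> this exceeds the
  fraction of transversals that are bad or contain a wrong pair, so the box contains a good
  \<open>y\<close> without wrong pairs. The balanced colouring of \<open>y\<close> then has the same
  kernel as \<open>c'\<close> on \<open>B\<close>.\<close>

lemma selection_balanced:
  assumes sel: "\<And>i. i \<in> B \<Longrightarrow> c' i \<in> supp i"
  shows "balanced c'"
proof -
  define W where "W i = (if i \<in> B then piece i (c' i) else V i)" for i
  \<comment> \<open>A chosen piece has at least \<open>\<mu> * N\<close> vertices and a part of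
    \<open>M\<close> fewer than \<open>2 * r * N\<close>, so \<open>q\<close> bounds the proportion
    kept from below. All other parts are kept whole, those of \<open>B - M\<close> because they
    consist of one piece.\<close>
  define q where "q = \<mu> / (2 * real r)"
  let ?T = "real (card transversals)"
  have WV: "W i \<subseteq> V i" for i using typical_V by (auto simp: W_def piece_def)
  have q: "0 \<le> q" "q \<le> 1"
  proof -
    show "0 \<le> q" using \<mu>(1) by (simp add: q_def)
    have "4 * 1 * \<mu> \<le> 4 * real r ^ 2 * \<mu>"
      using \<mu>(1) r_pos by (intro mult_right_mono mult_left_mono one_le_power) auto
    then have "\<mu> \<le> 1" using \<mu>(2) \<zeta>_le(3) \<mu>(1) by linarith
    then show "q \<le> 1" using r_pos by (simp add: q_def divide_le_eq)
  qed
  have Wq: "q * real (n i) \<le> real (card (W i))" if i: "i \<in> R" for i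
  proof (cases "i \<in> M")
    case True
    then have "real (n i) \<le> real (2 * r * n s)" unfolding of_nat_le_iff by (simp add: M_def)
    then have "q * real (n i) \<le> q * (2 * real r * N)" using q by (intro mult_left_mono) auto
    also have "\<dots> = \<mu> * N" using r_pos by (simp add: q_def)
    also have "\<dots> \<le> real (card (W i))" using sel[of i] True M_B by (simp add: W_def supp_def)
    finally show ?thesis .
  next
    case False
    have "W i = V i"
    proof (cases "i \<in> B")
      case True
      have "0 < \<mu> * N" using \<mu>(1) N_pos by simp
      then have "card (piece i (c' i)) \<noteq> 0" using sel[OF True] unfolding supp_def by auto
      then obtain v where "v \<in> piece i (c' i)" by (metis card.empty ex_in_conv)
      then have "c' i = c i" using col_large[of i v] True False by (simp add: piece_def)
      then show ?thesis using True False col_large[of i] by (auto simp: W_def piece_def typical_def)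
    qed (simp add: W_def)
    then show ?thesis using q i V_R(2) by (simp add: mult_left_le_one_le)
  qed
  have prod: "q ^ r * ?T \<le> real (card (PiE R W))"
  proof -
    have "q ^ r * ?T = q ^ r * (\<Prod>i\<in>R. real (n i))"
      unfolding transversals_def using finite_R V_R by (simp add: card_PiE of_nat_prod)
    also have "\<dots> \<le> q ^ card R * (\<Prod>i\<in>R. real (n i))"
      using q card_mono[OF _ R_sub] by (intro mult_right_mono power_decreasing prod_nonneg) auto
    also have "\<dots> = (\<Prod>i\<in>R. q * real (n i))" by (simp add: prod.distrib)
    also have "\<dots> \<le> (\<Prod>i\<in>R. real (card (W i)))" using Wq q by (intro prod_mono) auto
    also have "\<dots> = real (card (PiE R W))" using finite_R by (simp add: card_PiE of_nat_prod)
    finally show ?thesis .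
  qed
  define bad where "bad i k = {y \<in> transversals. y i \<in> typical i \<and> y k \<in> typical k \<and> wrong i k (y i) (y k)}" for i k
  have card_bad_pair: "real (card (bad i k)) \<le> \<sigma> / \<gamma> ^ 2 * ?T" if ik: "i \<in> B" "k \<in> B" "i \<noteq> k" for i k
  proof -
    let ?Q = "\<lambda>v w. v \<in> typical i \<and> w \<in> typical k \<and> wrong i k v w"
    have R: "i \<in> R" "k \<in> R" using ik B_R by auto
    have "real (card (bad i k)) = (\<Sum>y\<in>transversals. of_bool (?Q (y i) (y k)))"
      unfolding bad_def using finite_transversals
      by (subst sum_of_bool_eq) (auto intro!: arg_cong[where f = card])
    then have "real (n i) * real (n k) * real (card (bad i k)) =
        ?T * real (card {(v, w) \<in> V i \<times> V k. ?Q v w})"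
      using sum_transversals_pair[of i R k V ?Q, OF R ik(3)] V_R R unfolding transversals_def by simp
    also have "{(v, w) \<in> V i \<times> V k. ?Q v w} = {(v, w) \<in> typical i \<times> typical k. wrong i k v w}"
      using typical_V by blast
    also have "?T * real (card \<dots>) \<le> ?T * (\<sigma> * N ^ 2)"
      using wrong_count[OF ik] by (intro mult_left_mono) auto
    finally have "real (n i) * real (n k) * real (card (bad i k)) \<le> ?T * (\<sigma> * N ^ 2)" .
    moreover have "(\<gamma> * N) * (\<gamma> * N) * real (card (bad i k)) \<le> real (n i) * real (n k) * real (card (bad i k))"
      using n_B ik \<gamma>(1) by (intro mult_right_mono mult_mono) auto
    ultimately have "(\<gamma> * N) ^ 2 * real (card (bad i k)) \<le> (\<gamma> * N) ^ 2 * (\<sigma> / \<gamma> ^ 2 * ?T)"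
      using \<gamma>(1) by (simp add: power2_eq_square mult_ac)
    then show ?thesis by (rule mult_left_le_imp_le) (use \<gamma>(1) N_pos in simp)
  qed
  have "\<not> PiE R W \<subseteq> {y \<in> transversals. \<not> good y} \<union> (\<Union>i\<in>B. \<Union>k\<in>B - {i}. bad i k)"
  proof
    assume sub: "PiE R W \<subseteq> {y \<in> transversals. \<not> good y} \<union> (\<Union>i\<in>B. \<Union>k\<in>B - {i}. bad i k)"
    have "finite (bad i k)" for i k using finite_transversals by (simp add: bad_def)
    then have "card (PiE R W) \<le> card ({y \<in> transversals. \<not> good y} \<union> (\<Union>i\<in>B. \<Union>k\<in>B - {i}. bad i k))"
      using finite_transversals finite_B by (intro card_mono sub) auto
    also have "\<dots> \<le> card {y \<in> transversals. \<not> good y} + card (\<Union>i\<in>B. \<Union>k\<in>B - {i}. bad i k)"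
      by (rule card_Un_le)
    finally have "real (card (PiE R W)) \<le> b * ?T + real (card (\<Union>i\<in>B. \<Union>k\<in>B - {i}. bad i k))"
      using card_bad by linarith
    also have "real (card (\<Union>i\<in>B. \<Union>k\<in>B - {i}. bad i k)) \<le> real r * (real r * (\<sigma> / \<gamma> ^ 2 * ?T))"
    proof (intro real_card_UN_le[OF finite_B _ card_B] real_card_UN_le)
      show "card (B - {i}) \<le> r" for i using card_B card_mono[of B "B - {i}"] finite_B by auto
    qed (use finite_B card_bad_pair \<sigma>_pos in auto)
    finally have "q ^ r * ?T \<le> (b + real r ^ 2 * (\<sigma> / \<gamma> ^ 2)) * ?T"
      using prod by (simp add: algebra_simps power2_eq_square)
    moreover have "(b + real r ^ 2 * (\<sigma> / \<gamma> ^ 2)) * ?T < q ^ r * ?T"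
      using count card_transversals by (intro mult_strict_right_mono) (auto simp: q_def)
    ultimately show False by linarith
  qed
  then obtain y where y: "y \<in> PiE R W" "y \<notin> {y \<in> transversals. \<not> good y}"
    "y \<notin> (\<Union>i\<in>B. \<Union>k\<in>B - {i}. bad i k)" by blast
  have yT: "y \<in> transversals"
    using y(1) WV unfolding transversals_def by (auto simp: PiE_iff)
  then have "good y" using y(2) by blast
  then obtain z where z: "balanced z" "represents y z" by (rule good_colouring)
  have yp: "y i \<in> piece i (c' i)" if "i \<in> B" for i
    using PiE_mem[OF y(1) B_R[OF that]] that by (simp add: W_def)
  have "z i = z k \<longleftrightarrow> c' i = c' k" if ik: "i \<in> B" "k \<in> B" for i k
  proof (cases "i = k")
    case False
    then have "y \<notin> bad i k" using y(3) ik by blast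
    then have "\<not> wrong i k (y i) (y k)" using yT yp ik by (auto simp: bad_def piece_def)
    moreover have "adj y i k \<longleftrightarrow> z i \<noteq> z k" using z(2) ik by (simp add: represents_def)
    ultimately show ?thesis using yp ik by (simp add: wrong_def adj_def piece_def)
  qed simp
  moreover have "c' ` B \<subseteq> {1..s}" using sel by (auto simp: supp_def)
  ultimately show ?thesis by (intro balanced_kernel[OF z(1)]) auto
qed

end

section \<open>Trimming\<close>

text \<open>\<open>\<tau>\<close> is the smallest size of an integral part. A marked class (one that meets a split part) is cut
  down to exactly \<open>\<tau>\<close> inside a single part. In an unmarked class that is much larger than \<open>\<tau>\<close> every part
  loses \<open>3g\<close> elements; the other unmarked classes already satisfy the last condition of stability,
  since removing one part takes away more than their excess over \<open>\<tau>\<close>.\<close>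

lemma trim_sizes:
  fixes w :: "'i \<Rightarrow> nat" and \<kappa> :: "'i \<Rightarrow> nat" and g r :: nat and C :: "'i set"
  defines "T \<equiv> \<lambda>j. sum w {i \<in> C. \<kappa> i = j}"
  assumes C: "finite C" "card C \<le> r" and J: "finite J" "J \<noteq> {}" "D \<subseteq> J"
    and nonempty: "\<And>j. j \<in> J \<Longrightarrow> \<exists>i\<in>C. \<kappa> i = j"
    and marked: "\<And>j k. j \<in> D \<Longrightarrow> k \<in> J \<Longrightarrow> T j \<le> T k + g"
    and move: "\<And>l k. l \<in> C \<Longrightarrow> k \<in> J \<Longrightarrow> k \<noteq> \<kappa> l \<Longrightarrow> T (\<kappa> l) \<le> T k + w l + g"
    and big: "\<And>i. i \<in> C \<Longrightarrow> 3 * r * g \<le> w i" and r: "1 \<le> r"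
  obtains m \<tau> where "\<And>i. m i \<le> w i" "\<And>i. w i \<le> m i + 3 * g" "\<And>i. i \<notin> C \<Longrightarrow> m i = w i - 3 * g"
    "\<And>j. j \<in> J \<Longrightarrow> \<tau> \<le> sum m {i \<in> C. \<kappa> i = j}" "\<And>j. j \<in> D \<Longrightarrow> sum m {i \<in> C. \<kappa> i = j} = \<tau>"
    "\<And>l. l \<in> C \<Longrightarrow> \<kappa> l \<in> J \<Longrightarrow> sum m {i \<in> C. \<kappa> i = \<kappa> l} \<le> \<tau> + m l"
    "\<And>l. l \<in> C \<Longrightarrow> \<kappa> l \<in> D \<Longrightarrow> w l \<le> m l + g" "\<exists>k\<in>J. \<tau> = T k"
proof -
  define \<tau> where "\<tau> = Min (T ` J)"
  have \<tau>_le: "\<tau> \<le> T j" if "j \<in> J" for j using that J by (simp add: \<tau>_def)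
  have "\<tau> \<in> T ` J" unfolding \<tau>_def using J by (intro Min_in) auto
  then obtain k0 where k0: "k0 \<in> J" "\<tau> = T k0" by blast
  have excess: "T j - \<tau> \<le> g" if "j \<in> D" for j using marked[OF that k0(1)] k0(2) by simp
  define q where "q j = (SOME i. i \<in> C \<and> \<kappa> i = j)" for j
  have q: "q j \<in> C" "\<kappa> (q j) = j" if "j \<in> J" for j
    using someI_ex[of "\<lambda>i. i \<in> C \<and> \<kappa> i = j"] nonempty[OF that] unfolding q_def by blast+
  \<comment> \<open>A class has at most \<open>r\<close> parts, so \<open>3 * r * g\<close> bounds
    its total loss and a class above the threshold stays at least \<tau>. The loss
    \<open>3 * g\<close> outside \<open>C\<close> exceeds the loss in a marked class by
    \<open>2 * g\<close>; this margin later pushes every split part below the integral parts of the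
    classes that it meets.\<close>
  define m where "m i = (if i \<notin> C then w i - 3 * g
      else if \<kappa> i \<in> D then (if i = q (\<kappa> i) then w i - (T (\<kappa> i) - \<tau>) else w i)
      else if \<tau> + 3 * r * g \<le> T (\<kappa> i) then w i - 3 * g else w i)" for i
  have "3 * g \<le> r * (3 * g)" using mult_le_mono1[OF r, of "3 * g"] by (simp only: mult_1)
  also have "\<dots> = 3 * r * g" by simp
  finally have big': "3 * g \<le> w i" if "i \<in> C" for i using big[OF that] by (rule order_trans)
  have fin: "finite {i \<in> C. \<kappa> i = j}" for j using C by simp
  have mD: "w l \<le> m l + g" if "l \<in> C" "\<kappa> l \<in> D" for l
    using that excess[OF that(2)] by (auto simp: m_def)
  have sumD: "sum m {i \<in> C. \<kappa> i = j} = \<tau>" if j: "j \<in> D" for j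
  proof -
    have jJ: "j \<in> J" using j J by blast
    have q': "q j \<in> {i \<in> C. \<kappa> i = j}" using q[OF jJ] by simp
    have "sum m ({i \<in> C. \<kappa> i = j} - {q j}) = sum w ({i \<in> C. \<kappa> i = j} - {q j})"
      using j by (intro sum.cong) (auto simp: m_def)
    moreover have "m (q j) = w (q j) - (T j - \<tau>)" using j q[OF jJ] by (simp add: m_def)
    moreover have "T j - \<tau> \<le> w (q j)" using excess[OF j] big'[OF q(1)[OF jJ]] by simp
    moreover have "T j = w (q j) + sum w ({i \<in> C. \<kappa> i = j} - {q j})"
      unfolding T_def using sum.remove[OF fin q'] .
    ultimately show ?thesis
      using sum.remove[OF fin q', of m] \<tau>_le[OF jJ] by simp
  qed
  have cardI: "card {i \<in> C. \<kappa> i = j} \<le> r" for j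
    using C card_mono[of C "{i \<in> C. \<kappa> i = j}"] by auto
  have ge: "\<tau> \<le> sum m {i \<in> C. \<kappa> i = j}" if j: "j \<in> J" for j
  proof (cases "j \<in> D")
    case False
    show ?thesis
    proof (cases "\<tau> + 3 * r * g \<le> T j")
      case True
      have "T j \<le> (\<Sum>i | i \<in> C \<and> \<kappa> i = j. m i + 3 * g)"
        unfolding T_def using False by (intro sum_mono) (auto simp: m_def)
      also have "\<dots> = sum m {i \<in> C. \<kappa> i = j} + card {i \<in> C. \<kappa> i = j} * (3 * g)"
        by (simp add: sum.distrib)
      also have "card {i \<in> C. \<kappa> i = j} * (3 * g) \<le> r * (3 * g)"
        using cardI by (rule mult_le_mono1)
      finally show ?thesis using True by (simp add: mult_ac)
    next
      case unc: False
      then have "sum m {i \<in> C. \<kappa> i = j} = T j"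
        unfolding T_def using False by (intro sum.cong) (auto simp: m_def T_def)
      then show ?thesis using \<tau>_le[OF j] by simp
    qed
  qed (simp add: sumD)
  have le: "sum m {i \<in> C. \<kappa> i = \<kappa> l} \<le> \<tau> + m l" if l: "l \<in> C" "\<kappa> l \<in> J" for l
  proof (cases "\<kappa> l \<in> D")
    case False
    let ?I = "{i \<in> C. \<kappa> i = \<kappa> l}"
    have lI: "l \<in> ?I" using l by simp
    have Tl: "T (\<kappa> l) = w l + sum w (?I - {l})" unfolding T_def by (rule sum.remove[OF fin lI])
    have ml: "sum m ?I = m l + sum m (?I - {l})" by (rule sum.remove[OF fin lI])
    show ?thesis
    proof (cases "\<tau> + 3 * r * g \<le> T (\<kappa> l)")
      case True
      show ?thesis
      proof (cases "?I - {l} = {}")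
        case False
        then obtain l2 where l2: "l2 \<in> ?I - {l}" by blast
        have "m l2 = w l2 - 3 * g" using l2 \<open>\<kappa> l \<notin> D\<close> True by (auto simp: m_def)
        moreover have "3 * g \<le> w l2" using big' l2 by blast
        moreover have "sum m (?I - {l} - {l2}) \<le> sum w (?I - {l} - {l2})"
          by (intro sum_mono) (auto simp: m_def)
        moreover have "sum m (?I - {l}) = m l2 + sum m (?I - {l} - {l2})"
          "sum w (?I - {l}) = w l2 + sum w (?I - {l} - {l2})"
          using l2 fin by (auto intro!: sum.remove)
        moreover have "T (\<kappa> l) \<le> \<tau> + w l + g"
          using move[OF l(1) k0(1)] k0(2) by (cases "k0 = \<kappa> l") auto
        ultimately show ?thesis using ml Tl by linarith
      next
        case single: True
        have "sum m (?I - {l}) = 0" unfolding single by simp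
        then show ?thesis using ml by linarith
      qed
    next
      case unc: False
      then have "sum m ?I = T (\<kappa> l)" "m l = w l"
        unfolding T_def using False l by (auto simp: m_def T_def intro!: sum.cong)
      then show ?thesis using unc big[OF l(1)] by linarith
    qed
  qed (simp add: sumD)
  show ?thesis
  proof (rule that)
    show "m i \<le> w i" for i by (simp add: m_def)
    show "w i \<le> m i + 3 * g" for i using mD[of i] excess[of "\<kappa> i"] by (auto simp: m_def)
    show "m i = w i - 3 * g" if "i \<notin> C" for i using that by (simp add: m_def)
    show "\<exists>k\<in>J. \<tau> = T k" using k0 by blast
  qed (use ge sumD le mD in auto)
qed

section \<open>Approximate stability of the supports\<close>

context reference_colouring
begin

lemma balancedD:
  assumes "balanced a" "i \<in> B" "j \<in> {1..s}" "j \<noteq> a i"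
  shows "class_size B a (a i) \<le> class_size B a j + n i + h"
proof -
  have "j \<in> a ` B" using assms(1,3) by (simp add: balanced_def)
  then obtain k where k: "k \<in> B" "a k = j" by blast
  then have "a i \<noteq> a k" using assms(4) by simp
  then have "class_size B a (a i) \<le> class_size B a (a k) + n i + h"
    using assms(1,2) k(1) unfolding balanced_def by blast
  then show ?thesis using k(2) by simp
qed

lemma finite_exceptional: "finite exceptional"
proof -
  have "high i k \<subseteq> V i" "piece i k \<subseteq> V i" for i k
    using typical_V[of i] unfolding high_def piece_def by blast+
  moreover have "finite (V i)" if "i \<in> B" for i using V_finite B_r that by blast
  ultimately have "finite (high i k)" "finite (piece i k)" if "i \<in> B" for i k
    using that by (meson finite_subset)+
  then show ?thesis unfolding exceptional_def using finite_B V_finite B_r by simp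
qed

lemma h_less_n: "i \<in> B \<Longrightarrow> 10 * h < n i"
proof -
  assume i: "i \<in> B"
  have "1 \<le> r" using s_pos s_le by simp
  then have "100 * h \<le> r * (100 * h)" using mult_le_mono1[of 1 r "100 * h"] by (simp only: mult_1)
  also have "\<dots> = 100 * r * h" by simp
  also have "\<dots> \<le> n i" by (rule h_small(1)[OF i])
  finally show ?thesis using n_pos[OF B_R[OF i]] by linarith
qed

text \<open>Otherwise every vertex of \<open>V i\<close> would be atypical or in a negligible piece,
  so that \<open>V i\<close> would lie in \<open>exceptional\<close>, which has at most
  \<open>h < n i\<close> vertices.\<close>

lemma supp_nonempty: "i \<in> B \<Longrightarrow> supp i \<noteq> {}"
proof
  assume i: "i \<in> B" "supp i = {}"
  have "V i \<subseteq> exceptional"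
  proof
    fix v assume v: "v \<in> V i"
    show "v \<in> exceptional"
    proof (cases "v \<in> typical i")
      case True
      then have "v \<in> piece i (col i v)" by (simp add: piece_def)
      moreover have "col i v \<in> {1..s} - supp i" using col_range i(2) by simp
      ultimately show ?thesis unfolding exceptional_def using i(1) by blast
    next
      case False
      then show ?thesis unfolding exceptional_def using i(1) v by blast
    qed
  qed
  then have "card (V i) \<le> h" using card_mono[OF finite_exceptional] card_exceptional le_trans by blast
  then show False using h_less_n[OF i(1)] card_V[OF B_r[OF i(1)]] by simp
qed

lemma supp_sub: "supp i \<subseteq> {1..s}"
  by (auto simp: supp_def)

lemma class_size_upd2:
  assumes "i \<in> B" "k \<in> B" "i \<noteq> k"
  shows "class_size B (a(i := u, k := v)) y =
    class_size (B - {i, k}) a y + (if u = y then n i else 0) + (if v = y then n k else 0)"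
proof -
  let ?a = "a(i := u, k := v)"
  have conv: "class_size A c' y = (\<Sum>l\<in>A. if c' l = y then n l else 0)" if "finite A" for A and c' :: "nat \<Rightarrow> nat"
    using that by (simp add: sum.inter_filter)
  have B: "B = insert i (insert k (B - {i, k}))" using assms by blast
  have "(\<Sum>l\<in>B. if ?a l = y then n l else 0) = (if u = y then n i else 0) + ((if v = y then n k else 0) +
      (\<Sum>l\<in>B - {i, k}. if ?a l = y then n l else 0))"
    using finite_B assms by (subst B) simp
  moreover have "(\<Sum>l\<in>B - {i, k}. if ?a l = y then n l else 0) = (\<Sum>l\<in>B - {i, k}. if a l = y then n l else 0)"
    by (intro sum.cong) auto
  ultimately show ?thesis
    unfolding conv[OF finite_B] conv[OF finite_Diff[OF finite_B]] by linarith
qed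

text \<open>If two split parts met the same class \<open>j\<close>, moving both of them away from \<open>j\<close> would change the
  balance by \<open>n k\<close> while all selections are balanced up to \<open>h\<close>.\<close>

lemma floaters_disjoint:
  assumes "i \<in> B" "k \<in> B" "j \<in> supp i" "j \<in> supp k" "supp i \<noteq> {j}" "supp k \<noteq> {j}"
  shows "i = k"
proof (rule ccontr)
  assume ne: "i \<noteq> k"
  obtain j1 where j1: "j1 \<in> supp i" "j1 \<noteq> j" using assms(3,5) by blast
  obtain j2 where j2: "j2 \<in> supp k" "j2 \<noteq> j" using assms(4,6) by blast
  define d where "d l = (SOME y. y \<in> supp l)" for l
  have d: "d l \<in> supp l" if "l \<in> B" for l
    using supp_nonempty[OF that] unfolding d_def by (simp add: some_in_eq)
  have "balanced (d(i := j, k := j))"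
    by (rule selection_balanced) (use d assms in auto)
  from balancedD[OF this assms(1), of j1]
  have 1: "class_size (B - {i, k}) d j + n i + n k \<le> class_size (B - {i, k}) d j1 + n i + h"
    using j1 subsetD[OF supp_sub j1(1)] ne unfolding class_size_upd2[OF assms(1,2) ne] by auto
  have "balanced (d(i := j1, k := j2))"
    by (rule selection_balanced) (use d j1 j2 in auto)
  from balancedD[OF this assms(1), of j]
  have "class_size (B - {i, k}) d j1 + n i \<le> class_size (B - {i, k}) d j + n i + h"
    using j1 j2 subsetD[OF supp_sub assms(3)] ne unfolding class_size_upd2[OF assms(1,2) ne] by auto
  with 1 show False using h_less_n[OF assms(2)] by linarith
qed

text \<open>Parts that lie in class \<open>j\<close> up to exceptional vertices; after trimming they
  are integral there. The remaining indices of \<open>B\<close> are the split parts, called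
  floaters.\<close>

definition core :: "nat \<Rightarrow> nat set" where "core j = {i \<in> B. supp i = {j}}"

lemma finite_core: "finite (core j)"
  using finite_B by (simp add: core_def)

text \<open>A split part always has a second class to go to. Such a selection reduces class
  \<open>k\<close> to its core, while other classes contain at least theirs, which is the extremal
  situation for comparing cores.\<close>

lemma avoiding_selection:
  obtains a where "\<And>l. l \<in> B \<Longrightarrow> a l \<in> supp l" "\<And>l. l \<in> B \<Longrightarrow> a l = k \<Longrightarrow> l \<in> core k"
proof -
  have "\<exists>y. y \<in> supp l \<and> (y = k \<longrightarrow> supp l = {k})" if "l \<in> B" for l
    using supp_nonempty[OF that] by blast
  then obtain a where "\<And>l. l \<in> B \<Longrightarrow> a l \<in> supp l \<and> (a l = k \<longrightarrow> supp l = {k})" by metis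
  then show ?thesis by (intro that[of a]) (auto simp: core_def)
qed

lemma class_size_core:
  assumes "\<And>l. l \<in> B \<Longrightarrow> a l \<in> supp l"
  shows "sum n (core j) \<le> class_size B a j"
  using assms finite_B by (intro sum_mono2) (auto simp: core_def)

lemma class_size_core_floater:
  assumes "\<And>l. l \<in> B \<Longrightarrow> a l \<in> supp l" "i \<in> B" "a i = j" "supp i \<noteq> {j}"
  shows "sum n (core j) + n i \<le> class_size B a j"
proof -
  have "sum n (insert i (core j)) \<le> class_size B a j"
    using assms finite_B by (intro sum_mono2) (auto simp: core_def)
  then show ?thesis using assms(4) finite_core by (simp add: core_def)
qed

lemma class_size_avoided:
  assumes "\<And>l. l \<in> B \<Longrightarrow> a l = k \<Longrightarrow> l \<in> core k"
  shows "class_size B a k \<le> sum n (core k)"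
  using assms finite_core by (intro sum_mono2) auto

text \<open>Select \<open>j\<close> for \<open>i\<close> and keep all other split parts out of class
  \<open>k\<close>. Class \<open>j\<close> then has at least its core plus \<open>n i\<close>, class
  \<open>k\<close> at most its core, and in the balance inequality for moving \<open>i\<close> to
  \<open>k\<close> the term \<open>n i\<close> cancels.\<close>

lemma core_marked:
  assumes i: "i \<in> B" "j \<in> supp i" "supp i \<noteq> {j}" and k: "k \<in> {1..s}"
  shows "sum n (core j) \<le> sum n (core k) + h"
proof (cases "k = j")
  case False
  obtain a where a: "\<And>l. l \<in> B \<Longrightarrow> a l \<in> supp l" "\<And>l. l \<in> B \<Longrightarrow> a l = k \<Longrightarrow> l \<in> core k"
    by (rule avoiding_selection) blast
  let ?a = "a(i := j)"
  have sel: "?a l \<in> supp l" if "l \<in> B" for l using a(1) that i(2) by simp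
  have "class_size B ?a (?a i) \<le> class_size B ?a k + n i + h"
    using False k i by (intro balancedD selection_balanced sel) auto
  moreover have "sum n (core j) + n i \<le> class_size B ?a j"
    using i by (intro class_size_core_floater sel) auto
  moreover have "class_size B ?a k \<le> sum n (core k)"
    by (rule class_size_avoided) (use False a(2) in \<open>auto split: if_splits\<close>)
  ultimately show ?thesis by simp
qed simp

text \<open>The selection is as in \<open>core_marked\<close>, with \<open>k\<close> a second class
  of \<open>i\<close>, but the part tested for a move is \<open>l\<close>. This bounds
  \<open>core j\<close> plus \<open>n i\<close> by \<open>core k\<close> plus
  \<open>n l + h\<close>; since \<open>i\<close> also meets class \<open>k\<close>,
  \<open>core_marked\<close> with the classes exchanged removes the cores at the cost of another
  \<open>h\<close>.\<close>

lemma floater_size: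
  assumes i: "i \<in> B" "j \<in> supp i" "supp i \<noteq> {j}" and l: "l \<in> core j"
  shows "n i \<le> n l + 2 * h"
proof -
  obtain k where k: "k \<in> supp i" "k \<noteq> j" using i by blast
  have lB: "l \<in> B" "supp l = {j}" "l \<noteq> i" using l i by (auto simp: core_def)
  obtain a where a: "\<And>l. l \<in> B \<Longrightarrow> a l \<in> supp l" "\<And>l. l \<in> B \<Longrightarrow> a l = k \<Longrightarrow> l \<in> core k"
    by (rule avoiding_selection) blast
  let ?a = "a(i := j)"
  have sel: "?a l \<in> supp l" if "l \<in> B" for l using a(1) that i(2) by simp
  have al: "?a l = j" using sel[OF lB(1)] lB by simp
  have "class_size B ?a (?a l) \<le> class_size B ?a k + n l + h"
    using k(2) subsetD[OF supp_sub k(1)] lB(1) al by (intro balancedD selection_balanced sel) auto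
  moreover have "sum n (core j) + n i \<le> class_size B ?a j"
    using i by (intro class_size_core_floater sel) auto
  moreover have "class_size B ?a k \<le> sum n (core k)"
    by (rule class_size_avoided) (use k a(2) in \<open>auto split: if_splits\<close>)
  moreover have "sum n (core k) \<le> sum n (core j) + h"
    by (rule core_marked[OF i(1) k(1)]) (use i(2) k(2) subsetD[OF supp_sub i(2)] in auto)
  ultimately show ?thesis unfolding al by linarith
qed

lemma core_move:
  assumes "l \<in> core j" "k \<in> {1..s}" "k \<noteq> j"
  shows "sum n (core j) \<le> sum n (core k) + n l + h"
proof -
  obtain a where a: "\<And>l. l \<in> B \<Longrightarrow> a l \<in> supp l" "\<And>l. l \<in> B \<Longrightarrow> a l = k \<Longrightarrow> l \<in> core k"
    by (rule avoiding_selection) blast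
  have l: "l \<in> B" "a l = j" using assms(1) a(1)[of l] by (auto simp: core_def)
  have "class_size B a (a l) \<le> class_size B a k + n l + h"
    using assms l by (intro balancedD selection_balanced a(1)) auto
  then show ?thesis using class_size_core[of a j, OF a(1)] class_size_avoided[of a k, OF a(2)] l(2) by simp
qed

text \<open>If one of the first \<open>s\<close> parts belongs to the core, its size suffices.
  Otherwise a selection avoiding \<open>j\<close> sends the first \<open>s\<close> parts to at most
  \<open>s - 1\<close> classes, two of them share one, and balance against class \<open>j\<close>
  forces its core to have almost \<open>n s\<close> vertices.\<close>

lemma core_size:
  assumes j: "j \<in> {1..s}"
  shows "n s \<le> sum n (core j) + h"
proof (cases "\<exists>i\<in>{1..s}. i \<in> core j")
  case True
  then obtain i where i: "i \<in> {1..s}" "i \<in> core j" by blast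
  then have "n i \<le> sum n (core j)" using finite_core by (intro member_le_sum) auto
  then show ?thesis using n_ge_ns[OF i(1)] by simp
next
  case False
  obtain a where a: "\<And>l. l \<in> B \<Longrightarrow> a l \<in> supp l" "\<And>l. l \<in> B \<Longrightarrow> a l = j \<Longrightarrow> l \<in> core j"
    by (rule avoiding_selection) blast
  have range: "a l \<in> {1..s} - {j}" if "l \<in> {1..s}" for l
    using False a[OF s_B[OF that]] that supp_sub by blast
  then have "card (a ` {1..s}) \<le> card ({1..s} - {j})" by (intro card_mono image_subsetI range) auto
  also have "\<dots> < card {1..s}" using j by (intro card_Diff1_less) auto
  finally have "\<not> inj_on a {1..s}" using card_image by fastforce
  then obtain i k where ik: "i \<in> {1..s}" "k \<in> {1..s}" "i \<noteq> k" "a i = a k"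
    unfolding inj_on_def by blast
  have "n i + n k \<le> class_size B a (a i)" using ik s_B finite_B by (intro class_size_pair) auto
  also have "\<dots> \<le> class_size B a j + n i + h"
    using j range[OF ik(1)] s_B[OF ik(1)] by (intro balancedD selection_balanced a(1)) auto
  also have "class_size B a j \<le> sum n (core j)" by (rule class_size_avoided) (rule a(2))
  finally show ?thesis using n_ge_ns[OF ik(2)] by simp
qed

lemma core_nonempty: "j \<in> {1..s} \<Longrightarrow> core j \<noteq> {}"
  using core_size[of j] h_less by auto

end

section \<open>From trimmed sizes to exact stability\<close>

text \<open>Isolates the exact combinatorial part from graphs and error terms. \<open>supp i\<close>
  only bounds the colours on \<open>S i\<close> from above: trimming may delete all vertices of some
  colour, so a split part may become integral, and the lemmas below have to allow for this.\<close>

locale trimmed_partition =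
  fixes r s \<tau> :: nat and B :: "nat set" and S :: "nat \<Rightarrow> 'a set" and col :: "nat \<Rightarrow> 'a \<Rightarrow> nat"
    and supp :: "nat \<Rightarrow> nat set" and core :: "nat \<Rightarrow> nat set" and V' P' :: "nat \<Rightarrow> 'a set"
  assumes core_eq: "\<And>j. core j = {i \<in> B. supp i = {j}}"
    and V'_eq: "\<And>i. i \<in> {1..r} \<Longrightarrow> V' i = (if i \<in> B then S i else {})"
    and P'_eq: "\<And>j. P' j = (\<Union>i\<in>B. {v \<in> S i. col i v = j})"
    and B: "B \<subseteq> {1..r}"
    and S_finite: "\<And>i. i \<in> B \<Longrightarrow> finite (S i)"
    and S_disjoint: "\<And>i k v. i \<in> B \<Longrightarrow> k \<in> B \<Longrightarrow> v \<in> S i \<Longrightarrow> v \<in> S k \<Longrightarrow> i = k"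
    and col_supp: "\<And>i v. i \<in> B \<Longrightarrow> v \<in> S i \<Longrightarrow> col i v \<in> supp i"
    and floaters_unique: "\<And>i k j. i \<in> B \<Longrightarrow> k \<in> B \<Longrightarrow> j \<in> supp i \<Longrightarrow> j \<in> supp k \<Longrightarrow>
      supp i \<noteq> {j} \<Longrightarrow> supp k \<noteq> {j} \<Longrightarrow> i = k"
    and core_S: "\<And>i j. i \<in> core j \<Longrightarrow> S i \<noteq> {}"
    and core_nonempty: "\<And>j. j \<in> {1..s} \<Longrightarrow> core j \<noteq> {}"
    and core_ge: "\<And>j. j \<in> {1..s} \<Longrightarrow> \<tau> \<le> (\<Sum>i\<in>core j. card (S i))"
    and core_marked: "\<And>i j. j \<in> {1..s} \<Longrightarrow> i \<in> B \<Longrightarrow> j \<in> supp i \<Longrightarrow> supp i \<noteq> {j} \<Longrightarrow>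
      (\<Sum>i\<in>core j. card (S i)) = \<tau>"
    and core_move: "\<And>j l. j \<in> {1..s} \<Longrightarrow> l \<in> core j \<Longrightarrow> (\<Sum>i\<in>core j. card (S i)) \<le> \<tau> + card (S l)"
    and floater_le: "\<And>i j l. j \<in> {1..s} \<Longrightarrow> i \<in> B \<Longrightarrow> j \<in> supp i \<Longrightarrow> supp i \<noteq> {j} \<Longrightarrow>
      l \<in> core j \<Longrightarrow> card (S i) \<le> card (S l)"
begin

lemma finite_B: "finite B"
  using B finite_subset by blast

lemma finite_core: "finite (core j)"
  using finite_B by (simp add: core_eq)

lemma core_B: "i \<in> core j \<Longrightarrow> i \<in> B" "i \<in> core j \<Longrightarrow> supp i = {j}"
  by (auto simp: core_eq)

lemma card_core:
  assumes "A \<subseteq> core j"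
  shows "card (\<Union>i\<in>A. S i) = (\<Sum>i\<in>A. card (S i))"
proof (rule card_UN_disjoint)
  show "finite A" using assms finite_core finite_subset by blast
  show "\<forall>i\<in>A. finite (S i)" using assms S_finite core_B by blast
  show "\<forall>i\<in>A. \<forall>k\<in>A. i \<noteq> k \<longrightarrow> S i \<inter> S k = {}"
    using assms S_disjoint core_B by blast
qed

lemma finite_P': "finite (P' j)"
  unfolding P'_eq using finite_B S_finite by auto

lemma mem_P': "i \<in> B \<Longrightarrow> v \<in> S i \<Longrightarrow> v \<in> P' j \<longleftrightarrow> col i v = j"
  unfolding P'_eq using S_disjoint by blast

lemma core_sub_P':
  assumes "i \<in> core j"
  shows "S i \<subseteq> P' j"
proof
  fix v assume "v \<in> S i"
  then show "v \<in> P' j" using mem_P'[of i v j] col_supp[of i v] core_B[OF assms] by auto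
qed

lemma partial_cases:
  assumes "i \<in> {1..r}" "partial_in (V' i) (P' j)"
  shows "i \<in> B" "j \<in> supp i" "supp i \<noteq> {j}"
proof -
  show i: "i \<in> B" using assms by (auto simp: partial_in_def V'_eq[OF assms(1)] split: if_splits)
  have p: "S i \<inter> P' j \<noteq> {}" "\<not> S i \<subseteq> P' j" using assms i by (auto simp: partial_in_def V'_eq[OF assms(1)])
  then obtain v where v: "v \<in> S i" "v \<in> P' j" by blast
  then show "j \<in> supp i" using mem_P'[OF i] col_supp[OF i] by auto
  show "supp i \<noteq> {j}" using p(2) core_sub_P' i by (auto simp: core_eq)
qed

lemma integral_cases:
  assumes "i \<in> {1..r}" "integral_in (V' i) (P' j)"
  shows "i \<in> B" "j \<in> supp i" "S i \<subseteq> P' j"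
proof -
  show i: "i \<in> B" using assms by (auto simp: integral_in_def V'_eq[OF assms(1)] split: if_splits)
  then show S: "S i \<subseteq> P' j" using assms by (simp add: integral_in_def V'_eq[OF assms(1)])
  obtain v where v: "v \<in> S i" using assms i by (auto simp: integral_in_def V'_eq[OF assms(1)])
  then have "col i v = j" using S mem_P'[OF i v] by blast
  then show "j \<in> supp i" using col_supp[OF i v] by simp
qed

lemma core_sub_integral_part: "(\<Union>i\<in>core j. S i) \<subseteq> integral_part {1..r} V' (P' j)"
proof
  fix v assume "v \<in> (\<Union>i\<in>core j. S i)"
  then obtain i where i: "i \<in> core j" "v \<in> S i" by blast
  have "V' i = S i" using core_B(1)[OF i(1)] B V'_eq by auto
  then have "integral_in (V' i) (P' j)" "v \<in> V' i"
    using core_sub_P' core_S i by (auto simp: integral_in_def)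
  then show "v \<in> integral_part {1..r} V' (P' j)"
    using core_B(1)[OF i(1)] B unfolding integral_part_def by blast
qed

lemma integral_part_sub: "integral_part {1..r} V' (P' j) \<subseteq> P' j"
  by (auto simp: integral_part_def integral_in_def)

lemma integral_part_ge:
  assumes "j \<in> {1..s}"
  shows "\<tau> \<le> card (integral_part {1..r} V' (P' j))"
proof -
  have "\<tau> \<le> card (\<Union>i\<in>core j. S i)" using core_ge[OF assms] card_core[OF order_refl] by simp
  also have "\<dots> \<le> card (integral_part {1..r} V' (P' j))"
    using core_sub_integral_part finite_subset[OF integral_part_sub finite_P'] by (rule card_mono[rotated])
  finally show ?thesis .
qed

lemma partial_classE:
  assumes "partial_class {1..r} V' (P' j)"
  obtains p where "p \<in> {1..r}" "partial_in (V' p) (P' j)"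
  using assms unfolding partial_class_def partial_part_def by blast

text \<open>In a partial class the unique split part of that class is the partial one. Every
  integral part there must then belong to the core, so the integral part is exactly the core, of
  size \<tau>.\<close>

lemma integral_part_partial:
  assumes j: "j \<in> {1..s}" and "partial_class {1..r} V' (P' j)"
  shows "card (integral_part {1..r} V' (P' j)) = \<tau>"
proof -
  obtain p where p: "p \<in> {1..r}" "partial_in (V' p) (P' j)"
    using assms(2) by (rule partial_classE)
  note pc = partial_cases[OF p]
  have "integral_part {1..r} V' (P' j) \<subseteq> (\<Union>i\<in>core j. S i)"
  proof
    fix v assume "v \<in> integral_part {1..r} V' (P' j)"
    then obtain i where i: "i \<in> {1..r}" "integral_in (V' i) (P' j)" "v \<in> V' i"
      unfolding integral_part_def by blast
    note ic = integral_cases[OF i(1,2)]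
    have "i \<noteq> p" using p(2) i(2) by (auto simp: partial_in_def integral_in_def)
    then have "supp i = {j}" using floaters_unique[OF ic(1) pc(1) ic(2) pc(2)] pc(3) by blast
    then show "v \<in> (\<Union>i\<in>core j. S i)" using i(3) ic(1) V'_eq[OF i(1)] by (auto simp: core_eq)
  qed
  then have "integral_part {1..r} V' (P' j) = (\<Union>i\<in>core j. S i)"
    using core_sub_integral_part by blast
  then show ?thesis using card_core[OF order_refl] core_marked[OF j pc] by simp
qed

text \<open>Removing a core part from a class with a floater replaces it by a set that is no larger,
  so at most the core size \<tau> remains; without a floater the bound is
  \<open>core_move\<close>.\<close>

lemma card_remove_integral:
  assumes j: "j \<in> {1..s}" and i: "i \<in> {1..r}" "integral_in (V' i) (P' j)"
  shows "card (P' j - V' i) \<le> \<tau>"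
proof -
  note ic = integral_cases[OF i]
  have V'i: "V' i = S i" using V'_eq[OF i(1)] ic(1) by simp
  have P'_cases: "\<exists>l\<in>B. v \<in> S l \<and> j \<in> supp l" if "v \<in> P' j" for v
    using that col_supp unfolding P'_eq by blast
  have core_fin: "finite (\<Union>l\<in>A. S l)" if "A \<subseteq> core j" for A
    using that finite_core[of j] S_finite core_B(1) by (meson finite_UN_I finite_subset subsetD)
  show ?thesis
  proof (cases "supp i = {j}")
    \<comment> \<open>Here \<open>i\<close> is a split part that trimming has made integral; no
      second floater meets the class, so only the core is left, and it has size \<tau>.\<close>
    case False
    have "P' j - S i \<subseteq> (\<Union>l\<in>core j. S l)"
    proof
      fix v assume v: "v \<in> P' j - S i"
      then obtain l where l: "l \<in> B" "v \<in> S l" "j \<in> supp l" using P'_cases by blast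
      then have "supp l = {j}" using floaters_unique[OF l(1) ic(1) l(3) ic(2) _ False] v by blast
      then show "v \<in> (\<Union>l\<in>core j. S l)" using l by (auto simp: core_eq)
    qed
    then have "card (P' j - S i) \<le> card (\<Union>l\<in>core j. S l)" using core_fin by (intro card_mono) auto
    then show ?thesis
      using card_core[OF order_refl] core_marked[OF j ic(1,2) False] V'i by simp
  next
    case True
    then have iC: "i \<in> core j" using ic(1) by (simp add: core_eq)
    let ?R = "\<Union>l\<in>core j - {i}. S l"
    have sum: "(\<Sum>l\<in>core j. card (S l)) = card (S i) + card ?R"
      using card_core[of "core j - {i}" j] sum.remove[OF finite_core iC] by auto
    show ?thesis
    proof (cases "\<exists>p\<in>B. j \<in> supp p \<and> supp p \<noteq> {j}")
      case fl: True
      then obtain p where p: "p \<in> B" "j \<in> supp p" "supp p \<noteq> {j}" by blast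
      have "P' j - S i \<subseteq> ?R \<union> S p"
      proof
        fix v assume v: "v \<in> P' j - S i"
        then obtain l where l: "l \<in> B" "v \<in> S l" "j \<in> supp l" using P'_cases by blast
        show "v \<in> ?R \<union> S p"
        proof (cases "supp l = {j}")
          case True
          then show ?thesis using l v by (auto simp: core_eq)
        next
          case False
          then show ?thesis using floaters_unique[OF l(1) p(1) l(3) p(2) False p(3)] l by blast
        qed
      qed
      then have "card (P' j - S i) \<le> card (?R \<union> S p)"
        using core_fin[of "core j - {i}"] S_finite[OF p(1)] by (intro card_mono) auto
      also have "\<dots> \<le> card ?R + card (S p)" by (rule card_Un_le)
      also have "card (S p) \<le> card (S i)" by (rule floater_le[OF j p iC])
      finally show ?thesis using sum core_marked[OF j p] V'i by simp
    next
      case nofl: False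
      have "P' j - S i \<subseteq> ?R"
      proof
        fix v assume v: "v \<in> P' j - S i"
        then obtain l where l: "l \<in> B" "v \<in> S l" "j \<in> supp l" using P'_cases by blast
        then have "l \<in> core j" using nofl by (auto simp: core_eq)
        then show "v \<in> ?R" using l v by blast
      qed
      then have "card (P' j - S i) \<le> card ?R"
        using core_fin[of "core j - {i}"] by (intro card_mono) auto
      then show ?thesis using sum core_move[OF j iC] V'i by simp
    qed
  qed
qed

lemma stable: "stable_to {1..s} P' {1..r} V'"
  unfolding stable_to_def
proof (intro conjI ballI impI)
  fix j i i' assume "j \<in> {1..s}" "i \<in> {1..r}" "i' \<in> {1..r}"
    "partial_in (V' i) (P' j) \<and> partial_in (V' i') (P' j)"
  then show "i = i'"
    using floaters_unique partial_cases[of i j] partial_cases[of i' j] by blast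
next
  fix j k assume jk: "j \<in> {1..s}" "k \<in> {1..s}" "partial_class {1..r} V' (P' j)"
  have "\<tau> \<le> card (P' k)"
    using integral_part_ge[OF jk(2)] card_mono[OF finite_P' integral_part_sub] le_trans by blast
  then show "if partial_class {1..r} V' (P' k)
      then card (integral_part {1..r} V' (P' j)) = card (integral_part {1..r} V' (P' k))
      else card (integral_part {1..r} V' (P' j)) \<le> card (P' k)"
    using integral_part_partial[OF jk(1,3)] integral_part_partial[OF jk(2)] by presburger
next
  fix j i assume ji: "j \<in> {1..s}" "i \<in> {1..r}" "\<exists>k\<in>{1..s}. partial_in (V' i) (P' k)"
  then obtain k where k: "k \<in> {1..s}" "partial_in (V' i) (P' k)" by blast
  note pc = partial_cases[OF ji(2) k(2)]
  \<comment> \<open>One core part of a class that \<open>i\<close> meets already dominates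
    \<open>V' i\<close>, and that core has size \<tau>, which the integral part of every class
    attains.\<close>
  obtain l where l: "l \<in> core k" using core_nonempty[OF k(1)] by blast
  have "card (V' i) \<le> card (S l)" using floater_le[OF k(1) pc l] pc(1) V'_eq[OF ji(2)] by simp
  also have "\<dots> \<le> (\<Sum>l\<in>core k. card (S l))" using l finite_core by (intro member_le_sum) auto
  also have "\<dots> = \<tau>" by (rule core_marked[OF k(1) pc])
  also have "\<tau> \<le> card (integral_part {1..r} V' (P' j))" by (rule integral_part_ge[OF ji(1)])
  finally show "card (V' i) \<le> card (integral_part {1..r} V' (P' j))" .
next
  fix j i k assume "j \<in> {1..s}" "i \<in> {1..r}" "integral_in (V' i) (P' j)" "k \<in> {1..s}" "k \<noteq> j"
  then show "card (P' j - V' i) \<le> card (integral_part {1..r} V' (P' k))"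
    using card_remove_integral integral_part_ge le_trans by blast
qed

end

section \<open>Assembling the partition and the deleted set\<close>

context reference_colouring
begin

abbreviation vertices :: "'a set" where "vertices \<equiv> \<Union>i\<in>{1..r}. V i"

definition P :: "nat \<Rightarrow> 'a set" where "P j = (\<Union>i\<in>{1..r}. {v \<in> V i. col i v = j})"

lemma mem_P: "i \<in> {1..r} \<Longrightarrow> v \<in> V i \<Longrightarrow> v \<in> P j \<longleftrightarrow> col i v = j"
  unfolding P_def using V_unique by blast

lemma P_partition: "indexed_partition {1..s} P vertices"
  unfolding indexed_partition_def
proof
  show "disjoint_family_on P {1..s}"
    unfolding disjoint_family_on_def
  proof (intro ballI impI, rule equals0I)
    fix j k v assume jk: "j \<noteq> k" and "v \<in> P j \<inter> P k"
    then obtain i where "i \<in> {1..r}" "v \<in> V i" unfolding P_def by blast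
    then show False using mem_P[of i v j] mem_P[of i v k] \<open>v \<in> P j \<inter> P k\<close> jk by simp
  qed
  show "(\<Union>j\<in>{1..s}. P j) = vertices"
  proof
    show "vertices \<subseteq> (\<Union>j\<in>{1..s}. P j)"
    proof
      fix v assume "v \<in> vertices"
      then obtain i where "i \<in> {1..r}" "v \<in> V i" by blast
      then have "v \<in> P (col i v)" by (simp add: mem_P)
      then show "v \<in> (\<Union>j\<in>{1..s}. P j)" using col_range by blast
    qed
  qed (auto simp: P_def)
qed

lemma outside_exceptional:
  assumes "i \<in> B" "v \<in> V i" "v \<notin> exceptional"
  shows "v \<in> typical i" "col i v \<in> supp i" "\<And>k. k \<in> B \<Longrightarrow> k \<noteq> i \<Longrightarrow> v \<notin> high i k"
proof -
  show t: "v \<in> typical i" using assms unfolding exceptional_def by blast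
  show "col i v \<in> supp i"
  proof (rule ccontr)
    assume "col i v \<notin> supp i"
    then have "col i v \<in> {1..s} - supp i" using col_range by blast
    moreover have "v \<in> piece i (col i v)" using t by (simp add: piece_def)
    ultimately show False using assms(1,3) unfolding exceptional_def by blast
  qed
  show "v \<notin> high i k" if "k \<in> B" "k \<noteq> i" for k
    using assms(1,3) that unfolding exceptional_def by blast
qed

lemma small_in_exceptional: "i \<in> {1..r} - B \<Longrightarrow> V i \<subseteq> exceptional"
  unfolding exceptional_def by blast

lemma exceptional_vertices: "exceptional \<subseteq> vertices"
proof
  fix v assume "v \<in> exceptional"
  then consider i where "i \<in> {1..r} - B" "v \<in> V i" | i where "i \<in> B" "v \<in> V i"
    | i k where "i \<in> B" "v \<in> high i k" | i j where "i \<in> B" "v \<in> piece i j"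
    unfolding exceptional_def by blast
  then obtain i where "i \<in> {1..r}" "v \<in> V i"
  proof cases
    case (3 i k)
    then have "v \<in> typical i" by (simp add: high_def)
    then show ?thesis using that B_r[OF 3(1)] subsetD[OF typical_V] by blast
  next
    case (4 i j)
    then have "v \<in> typical i" by (simp add: piece_def)
    then show ?thesis using that B_r[OF 4(1)] subsetD[OF typical_V] by blast
  qed (use that B_r in blast)+
  then show "v \<in> vertices" by blast
qed

text \<open>The parts are disjoint, so the loss \<open>h\<close> is paid once for all parts together
  and not once per part.\<close>

lemma sum_outside_exceptional:
  assumes "I \<subseteq> B"
  shows "sum n I \<le> (\<Sum>i\<in>I. card (V i - exceptional)) + h"
proof -
  have fin: "finite I" "\<And>i. i \<in> I \<Longrightarrow> finite (V i)"
    using assms finite_B finite_subset V_finite B_r by blast+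
  have "n i = card (V i - exceptional) + card (V i \<inter> exceptional)" if "i \<in> I" for i
    using card_Diff_subset_Int[of "V i" exceptional] card_mono[of "V i" "V i \<inter> exceptional"] fin(2)[OF that] card_V[OF B_r] that assms
    by (metis (no_types, lifting) Int_lower1 finite_Int le_add_diff_inverse2 subsetD)
  then have "sum n I = (\<Sum>i\<in>I. card (V i - exceptional)) + (\<Sum>i\<in>I. card (V i \<inter> exceptional))"
    by (simp add: sum.distrib)
  also have "(\<Sum>i\<in>I. card (V i \<inter> exceptional)) = card (\<Union>i\<in>I. V i \<inter> exceptional)"
  proof (rule card_UN_disjoint[symmetric])
    show "\<forall>i\<in>I. \<forall>k\<in>I. i \<noteq> k \<longrightarrow> (V i \<inter> exceptional) \<inter> (V k \<inter> exceptional) = {}"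
      using assms V_unique B_r by blast
  qed (use fin in auto)
  also have "\<dots> \<le> card exceptional" by (intro card_mono finite_exceptional) blast
  finally show ?thesis using card_exceptional by linarith
qed

text \<open>Outside \<open>X\<close> every disagreement at \<open>v\<close> is a wrong pair with a
  vertex of another part, and \<open>v\<close>, lying in no set \<open>high i k\<close>, has at most
  \<open>\<zeta> * N\<close> of these in each part.\<close>

lemma close:
  assumes X: "X \<subseteq> vertices" "exceptional \<subseteq> X" and v: "v \<in> vertices - X"
  shows "real (card (sym_diff
    (neighbourhood (delete_vertices (complete_multipartite {1..r} V \<inter> complete_multipartite {1..s} P) X) v)
    (neighbourhood (delete_vertices E X) v))) \<le> real r * (\<zeta> * N)" (is "real (card ?D) \<le> _")
proof -
  obtain i where i: "i \<in> {1..r}" "v \<in> V i" using v by blast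
  have iB: "i \<in> B" using small_in_exceptional i v X(2) by blast
  note vi = outside_exceptional[OF iB i(2)]
  have vX: "v \<notin> exceptional" using v X by blast
  have fin: "finite (\<Union>k\<in>B - {i}. {w \<in> typical k. wrong i k v w})"
    using finite_B finite_typical by auto
  have "?D \<subseteq> (\<Union>k\<in>B - {i}. {w \<in> typical k. wrong i k v w})"
  proof
    fix w assume w: "w \<in> ?D"
    let ?K = "{v, w} \<in> complete_multipartite {1..r} V \<and> {v, w} \<in> complete_multipartite {1..s} P"
    have D: "w \<notin> X" "?K \<noteq> ({v, w} \<in> E)"
      using w v by (auto simp: neighbourhood_def delete_vertices_def)
    then have KV: "{v, w} \<in> complete_multipartite {1..r} V" using E_multipartite by blast
    then obtain a a' u u' where u: "{v, w} = {u, u'}" "a \<in> {1..r}" "a' \<in> {1..r}" "a \<noteq> a'" "u \<in> V a" "u' \<in> V a'"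
      unfolding complete_multipartite_def by blast
    obtain k where k: "k \<in> {1..r}" "k \<noteq> i" "w \<in> V k"
    proof (cases "v = u")
      case True
      then have "w = u'" using u(1) by (auto simp: doubleton_eq_iff)
      moreover have "i = a" using V_unique[OF i(2) _ i(1) u(2)] True u(5) by blast
      ultimately show ?thesis using that u by blast
    next
      case False
      then have "v = u'" "w = u" using u(1) by (auto simp: doubleton_eq_iff)
      moreover have "i = a'" using V_unique[OF i(2) _ i(1) u(3)] \<open>v = u'\<close> u(6) by blast
      ultimately show ?thesis using that u by blast
    qed
    have kB: "k \<in> B" using small_in_exceptional k D(1) X(2) by blast
    have wk: "w \<in> typical k" using outside_exceptional(1)[OF kB k(3)] D(1) X(2) by blast
    have "{v, w} \<in> complete_multipartite {1..s} P \<longleftrightarrow> col i v \<noteq> col k w"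
    proof
      assume "{v, w} \<in> complete_multipartite {1..s} P"
      then obtain b b' y y' where y: "{v, w} = {y, y'}" "b \<noteq> b'" "y \<in> P b" "y' \<in> P b'"
        unfolding complete_multipartite_def by blast
      then show "col i v \<noteq> col k w"
        using mem_P[OF i] mem_P[OF k(1,3)] by (auto simp: doubleton_eq_iff)
    next
      assume "col i v \<noteq> col k w"
      moreover have "v \<in> P (col i v)" "w \<in> P (col k w)" using mem_P i k by auto
      ultimately show "{v, w} \<in> complete_multipartite {1..s} P"
        unfolding complete_multipartite_def using col_range by blast
    qed
    then have "wrong i k v w" using D(2) KV by (auto simp: wrong_def)
    then show "w \<in> (\<Union>k\<in>B - {i}. {w \<in> typical k. wrong i k v w})" using kB k(2) wk by blast
  qed
  then have "card ?D \<le> card (\<Union>k\<in>B - {i}. {w \<in> typical k. wrong i k v w})"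
    by (rule card_mono[OF fin])
  moreover have "real (card (\<Union>k\<in>B - {i}. {w \<in> typical k. wrong i k v w})) \<le> real r * (\<zeta> * N)"
  proof (rule real_card_UN_le)
    show "real (card {w \<in> typical k. wrong i k v w}) \<le> \<zeta> * N" if "k \<in> B - {i}" for k
      using vi(3)[OF vX, of k] vi(1)[OF vX] that by (simp add: high_def not_less)
    show "card (B - {i}) \<le> r" using card_B card_mono[of B "B - {i}"] finite_B by auto
  qed (use finite_B \<zeta>(1) in auto)
  ultimately show ?thesis by linarith
qed

lemma stable_partition_exists:
  assumes \<epsilon>: "\<gamma> \<le> \<epsilon>"
  shows "\<exists>X P. stable_partition r (Suc s) V E X \<epsilon> P \<and>
    (\<forall>j\<in>{1..s}. (1 - \<epsilon>) * N < real (card (integral_part {1..r} (\<lambda>i. V i - X) (P j - X))))"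
proof -
  define w where "w i = card (V i - exceptional)" for i
  define C where "C = {i \<in> B. \<exists>j\<in>{1..s}. supp i = {j}}"
  define \<kappa> where "\<kappa> i = (THE j. supp i = {j})" for i
  define D where "D = {j \<in> {1..s}. \<exists>i\<in>B. j \<in> supp i \<and> supp i \<noteq> {j}}"
  have \<kappa>: "\<kappa> i = j" if "supp i = {j}" for i j using that by (simp add: \<kappa>_def)
  have C_core: "{i \<in> C. \<kappa> i = j} = core j" if "j \<in> {1..s}" for j
    using that \<kappa> by (auto simp: C_def core_def)
  have core_C: "i \<in> C" if "i \<in> core j" for i j
    using that supp_sub[of i] by (auto simp: C_def core_def)
  have \<kappa>_core: "l \<in> core (\<kappa> l)" "\<kappa> l \<in> {1..s}" if "l \<in> C" for l
    using that \<kappa> by (auto simp: C_def core_def)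
  have core_sub: "core j \<subseteq> B" for j by (auto simp: core_def)
  have w_le: "w i \<le> n i" if "i \<in> B" for i
    unfolding w_def using card_mono[of "V i" "V i - exceptional"] V_finite B_r[OF that] card_V by fastforce
  have w_sum: "sum n I \<le> sum w I + h" "sum w I \<le> sum n I" if "I \<subseteq> B" for I
    using sum_outside_exceptional[OF that] w_le that unfolding w_def by (auto intro!: sum_mono)
  have w_ge: "n i \<le> w i + h" if "i \<in> B" for i using w_sum(1)[of "{i}"] that by simp
  have C: "finite C" "card C \<le> r"
    using finite_B card_mono[of B C] card_B by (auto simp: C_def)
  \<comment> \<open>The lemma is applied with \<open>g = 2 * h\<close>: cores compare up to
    \<open>h\<close> in the sizes \<open>n\<close>, and passing to the sizes \<open>w\<close> costs
    one further \<open>h\<close>.\<close>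
  obtain m \<tau> where m: "\<And>i. m i \<le> w i" "\<And>i. w i \<le> m i + 3 * (2 * h)"
    "\<And>i. i \<notin> C \<Longrightarrow> m i = w i - 3 * (2 * h)"
    "\<And>j. j \<in> {1..s} \<Longrightarrow> \<tau> \<le> sum m {i \<in> C. \<kappa> i = j}" "\<And>j. j \<in> D \<Longrightarrow> sum m {i \<in> C. \<kappa> i = j} = \<tau>"
    "\<And>l. l \<in> C \<Longrightarrow> \<kappa> l \<in> {1..s} \<Longrightarrow> sum m {i \<in> C. \<kappa> i = \<kappa> l} \<le> \<tau> + m l"
    "\<And>l. l \<in> C \<Longrightarrow> \<kappa> l \<in> D \<Longrightarrow> w l \<le> m l + 2 * h" "\<exists>k\<in>{1..s}. \<tau> = sum w {i \<in> C. \<kappa> i = k}"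
  proof (rule trim_sizes[OF C, of "{1..s}" D \<kappa> w "2 * h"])
    show "\<exists>i\<in>C. \<kappa> i = j" if "j \<in> {1..s}" for j
      using core_nonempty[OF that] C_core[OF that] by blast
    show "sum w {i \<in> C. \<kappa> i = j} \<le> sum w {i \<in> C. \<kappa> i = k} + 2 * h" if "j \<in> D" "k \<in> {1..s}" for j k
    proof -
      obtain i where "i \<in> B" "j \<in> supp i" "supp i \<noteq> {j}" "j \<in> {1..s}" using \<open>j \<in> D\<close> by (auto simp: D_def)
      from core_marked[OF this(1-3) that(2)] show ?thesis
        using w_sum(2)[OF core_sub, of j] w_sum(1)[OF core_sub, of k] C_core \<open>j \<in> {1..s}\<close> that(2) by simp
    qed
    show "sum w {i \<in> C. \<kappa> i = \<kappa> l} \<le> sum w {i \<in> C. \<kappa> i = k} + w l + 2 * h"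
      if l: "l \<in> C" and k: "k \<in> {1..s}" "k \<noteq> \<kappa> l" for l k
    proof -
      \<comment> \<open>The part \<open>l\<close> is split off before comparing, so
        \<open>n l\<close> cancels exactly and its exceptional vertices cause no third error
        \<open>h\<close>.\<close>
      have "sum w (core (\<kappa> l)) = w l + sum w (core (\<kappa> l) - {l})"
        "sum n (core (\<kappa> l)) = n l + sum n (core (\<kappa> l) - {l})"
        using sum.remove[OF finite_core \<kappa>_core(1)[OF l]] by blast+
      moreover have "sum w (core (\<kappa> l) - {l}) \<le> sum n (core (\<kappa> l) - {l})"
        using core_sub by (intro w_sum(2)) blast
      moreover note core_move[OF \<kappa>_core(1)[OF l] k] w_sum(1)[OF core_sub, of k]
      ultimately show ?thesis using C_core k \<kappa>_core(2)[OF l] by simp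
    qed
    show "3 * r * (2 * h) \<le> w i" if "i \<in> C" for i
    proof -
      have iB: "i \<in> B" using that by (simp add: C_def)
      have "h * 1 \<le> h * r" using s_pos s_le by (intro mult_le_mono2) simp
      moreover have "100 * (h * r) \<le> n i" using h_small(1)[OF iB] by (simp add: mult_ac)
      ultimately have "6 * (h * r) \<le> w i" using w_ge[OF iB] by linarith
      then show ?thesis by (simp add: mult_ac)
    qed
  qed (use s_pos s_le in \<open>auto simp: D_def\<close>)
  have mB: "\<exists>A. A \<subseteq> V i - exceptional \<and> card A = m i \<and> finite A" for i
    using obtain_subset_with_card_n[of "m i" "V i - exceptional"] m(1)[of i] unfolding w_def by metis
  then obtain S where S: "\<And>i. S i \<subseteq> V i - exceptional" "\<And>i. card (S i) = m i" "\<And>i. finite (S i)" by metis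
  define X where "X = vertices - (\<Union>i\<in>B. S i)"
  have S_unique: "i = k" if "i \<in> {1..r}" "k \<in> B" "v \<in> V i" "v \<in> S k" for i k v
    using that S(1) V_unique B_r by blast
  have V'_eq: "V i - X = (if i \<in> B then S i else {})" if "i \<in> {1..r}" for i
    using that S(1)[of i] S_unique[OF that] unfolding X_def by auto
  have P'_eq: "P j - X = (\<Union>i\<in>B. {v \<in> S i. col i v = j})" for j
  proof -
    have "v \<in> P j - X \<longleftrightarrow> (\<exists>i\<in>B. v \<in> S i \<and> v \<in> P j)" for v
      unfolding X_def P_def by blast
    moreover have "v \<in> P j \<longleftrightarrow> col i v = j" if "i \<in> B" "v \<in> S i" for i v
      using mem_P[OF B_r[OF that(1)]] S(1) that(2) by blast
    ultimately show ?thesis by blast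
  qed
  have m_pos: "0 < m i" if "i \<in> B" for i
    using m(2)[of i] w_ge[OF that] h_less_n[OF that] by linarith
  have core_sum: "sum m {i \<in> C. \<kappa> i = j} = (\<Sum>i\<in>core j. card (S i))" if "j \<in> {1..s}" for j
    using C_core[OF that] S(2) by simp
  interpret tp: trimmed_partition r s \<tau> B S col supp core "\<lambda>i. V i - X" "\<lambda>j. P j - X"
  proof
    show "core j = {i \<in> B. supp i = {j}}" for j by (rule core_def)
    show "V i - X = (if i \<in> B then S i else {})" if "i \<in> {1..r}" for i by (rule V'_eq[OF that])
    show "P j - X = (\<Union>i\<in>B. {v \<in> S i. col i v = j})" for j by (rule P'_eq)
    show "B \<subseteq> {1..r}" by (rule B_sub)
    show "i = k" if "i \<in> B" "k \<in> B" "v \<in> S i" "v \<in> S k" for i k v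
      using S_unique[OF B_r[OF that(1)] that(2) _ that(4)] S(1) that(3) by blast
    show "col i v \<in> supp i" if "i \<in> B" "v \<in> S i" for i v
      using outside_exceptional(2)[OF that(1)] S(1) that(2) by blast
    show "i = k" if "i \<in> B" "k \<in> B" "j \<in> supp i" "j \<in> supp k" "supp i \<noteq> {j}" "supp k \<noteq> {j}" for i k j
      using that by (rule floaters_disjoint)
    show "S i \<noteq> {}" if "i \<in> core j" for i j
      using m_pos[of i] S(2)[of i] that core_sub by force
    show "\<tau> \<le> (\<Sum>i\<in>core j. card (S i))" if "j \<in> {1..s}" for j
      using m(4)[OF that] core_sum[OF that] by simp
    show "(\<Sum>i\<in>core j. card (S i)) = \<tau>" if "j \<in> {1..s}" "i \<in> B" "j \<in> supp i" "supp i \<noteq> {j}" for i j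
      using m(5)[of j] core_sum[OF that(1)] that by (auto simp: D_def)
    show "(\<Sum>i\<in>core j. card (S i)) \<le> \<tau> + card (S l)" if "j \<in> {1..s}" "l \<in> core j" for j l
    proof -
      have "\<kappa> l = j" using that(2) \<kappa> by (simp add: core_def)
      then show ?thesis using m(6)[OF core_C[OF that(2)]] core_sum[OF that(1)] S(2)[of l] that(1) by simp
    qed
    show "card (S i) \<le> card (S l)"
      if "j \<in> {1..s}" "i \<in> B" "j \<in> supp i" "supp i \<noteq> {j}" "l \<in> core j" for i j l
    proof -
      have l: "l \<in> B" "\<kappa> l = j" using that(5) \<kappa> by (auto simp: core_def)
      have "i \<notin> C" using that(3,4) by (auto simp: C_def)
      then have "m i = w i - 3 * (2 * h)" by (rule m(3))
      moreover have "w l \<le> m l + 2 * h"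
        using m(7)[OF core_C[OF that(5)]] l(2) that(1-4) by (auto simp: D_def)
      \<comment> \<open>Before trimming, \<open>w i\<close> exceeds \<open>w l\<close> by at most
        \<open>3 * h\<close>: \<open>2 * h\<close> from \<open>floater_size\<close> and
        \<open>h\<close> from the exceptional vertices. Trimming takes \<open>6 * h\<close> from
        \<open>i\<close>, or all of it, but at most \<open>2 * h\<close> from
        \<open>l\<close>.\<close>
      ultimately show ?thesis
        using floater_size[OF that(2-5)] w_le[OF that(2)] w_ge[OF l(1)] S(2)[of i] S(2)[of l] by linarith
    qed
  qed (use S(3) core_nonempty in auto)
  have exceptional_X: "exceptional \<subseteq> X"
    using exceptional_vertices S(1) unfolding X_def by blast
  have X_V: "X \<subseteq> vertices" by (simp add: X_def)
  have card_X: "real (card X) \<le> \<epsilon> * N"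
  proof -
    \<comment> \<open>Besides at most \<open>h\<close> exceptional vertices, \<open>X\<close> takes
      at most \<open>6 * h\<close> from each part of \<open>B\<close>; the total
      \<open>7 * r * h\<close> is below \<open>\<epsilon> * N\<close> since
      \<open>100 * r * \<zeta> \<le> \<gamma>\<close>.\<close>
    have "X \<subseteq> exceptional \<union> (\<Union>i\<in>B. V i - exceptional - S i)"
      using small_in_exceptional unfolding X_def by blast
    then have "card X \<le> card (exceptional \<union> (\<Union>i\<in>B. V i - exceptional - S i))"
      using finite_exceptional finite_B V_finite B_r by (intro card_mono) auto
    also have "\<dots> \<le> card exceptional + (\<Sum>i\<in>B. card (V i - exceptional - S i))"
      by (intro order_trans[OF card_Un_le] add_left_mono card_UN_le finite_B)
    also have "\<dots> \<le> h + (\<Sum>i\<in>B. 6 * h)"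
    proof (intro add_mono card_exceptional sum_mono)
      fix i
      have "card (V i - exceptional - S i) = w i - m i"
        using card_Diff_subset[OF S(3) S(1)] S(2) by (simp add: w_def)
      then show "card (V i - exceptional - S i) \<le> 6 * h" using m(2)[of i] by linarith
    qed
    also have "\<dots> = h + card B * (6 * h)" by simp
    also have "\<dots> \<le> r * h + r * (6 * h)"
      using mult_le_mono1[OF card_B, of "6 * h"] mult_le_mono1[of 1 r h] s_pos s_le by linarith
    also have "\<dots> = 7 * r * h" by simp
    finally have "real (card X) \<le> real (7 * r * h)" by (rule of_nat_mono)
    also have "\<dots> \<le> 7 * real r * (\<zeta> * N)" using h_le by (simp add: mult_left_mono)
    also have "\<dots> = (7 * real r * \<zeta>) * N" by simp
    also have "\<dots> \<le> \<epsilon> * N"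
    proof (rule mult_right_mono)
      have "0 \<le> real r * \<zeta>" using \<zeta>(1) by simp
      then show "7 * real r * \<zeta> \<le> \<epsilon>" using \<zeta>_le(1) \<epsilon> by linarith
    qed simp
    finally show ?thesis .
  qed
  have r\<zeta>: "real r * (\<zeta> * N) \<le> \<epsilon> * N"
  proof -
    have "0 \<le> real r * \<zeta>" using \<zeta>(1) by simp
    then have "real r * \<zeta> \<le> \<epsilon>" using \<zeta>_le(1) \<epsilon> by linarith
    then show ?thesis unfolding mult.assoc[symmetric] by (intro mult_right_mono) auto
  qed
  have "stable_partition r (Suc s) V E X \<epsilon> P"
    unfolding stable_partition_def close_to_def
    using P_partition X_V card_X card_V[of s] s_pos s_le order_trans[OF close[OF X_V exceptional_X] r\<zeta>] tp.stable
    by simp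
  moreover have "(1 - \<epsilon>) * N < real (card (integral_part {1..r} (\<lambda>i. V i - X) (P j - X)))"
    if j: "j \<in> {1..s}" for j
  proof -
    \<comment> \<open>\<tau> is itself the size of a core without exceptional vertices, so
      \<open>core_size\<close> applies to it.\<close>
    obtain k where k: "k \<in> {1..s}" "\<tau> = sum w (core k)" using m(8) C_core by auto
    have "n s \<le> \<tau> + 2 * h" using core_size[OF k(1)] w_sum(1)[OF core_sub, of k] k(2) by linarith
    also have "\<tau> \<le> card (integral_part {1..r} (\<lambda>i. V i - X) (P j - X))"
      by (rule tp.integral_part_ge[OF j])
    finally have "N \<le> real (card (integral_part {1..r} (\<lambda>i. V i - X) (P j - X))) + 2 * real h"
      by linarith
    moreover have "2 * (\<zeta> * N) < \<epsilon> * N"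
      using mult_strict_right_mono[of "2 * \<zeta>" \<epsilon> N] \<zeta>_le(2) \<epsilon> \<zeta>(1) N_pos by simp
    ultimately show ?thesis using h_le by (simp add: left_diff_distrib)
  qed
  ultimately show ?thesis by blast
qed

end

section \<open>Choice of the parameters\<close>

text \<open>All left sides are multiples of \<delta> and tend to 0 with it, while the right sides
  are fixed and positive.\<close>

lemma small_parameters:
  fixes r :: nat and \<gamma> \<zeta> \<theta> \<mu> :: real
  assumes "1 \<le> r" "0 < \<gamma>" "0 < \<zeta>" "0 < \<theta>" "0 < \<mu>"
  defines "b \<equiv> \<lambda>\<delta>. 2 * \<delta> / \<theta>" and "\<psi> \<equiv> \<lambda>\<delta>. (1 + real r) ^ 2 * (2 * \<delta> / \<theta>)"
  defines "\<sigma> \<equiv> \<lambda>\<delta>. 4 * real r ^ 2 * ((1 + real r) ^ 2 * (2 * \<delta> / \<theta>)) + 2 * \<delta>"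
  shows "eventually (\<lambda>\<delta>. 8 * real r ^ 2 * \<psi> \<delta> < \<zeta> \<and> 4 * real r ^ 2 * \<sigma> \<delta> < \<zeta> ^ 2 \<and>
    b \<delta> + real r ^ 2 * (\<sigma> \<delta> / \<gamma> ^ 2) < (\<mu> / (2 * real r)) ^ r) (at_right 0)"
proof (intro eventually_conj)
  have \<psi>: "((\<lambda>\<delta>. 8 * real r ^ 2 * \<psi> \<delta>) \<longlongrightarrow> 8 * real r ^ 2 * ((1 + real r) ^ 2 * (2 * 0 / \<theta>))) (at_right 0)"
    unfolding \<psi>_def using assms by (intro tendsto_intros) auto
  then show "eventually (\<lambda>\<delta>. 8 * real r ^ 2 * \<psi> \<delta> < \<zeta>) (at_right 0)"
    using assms(3) by (intro order_tendstoD(2)) auto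
  have \<sigma>: "(\<sigma> \<longlongrightarrow> 4 * real r ^ 2 * ((1 + real r) ^ 2 * (2 * 0 / \<theta>)) + 2 * 0) (at_right 0)"
    unfolding \<sigma>_def using assms by (intro tendsto_intros) auto
  then have "((\<lambda>\<delta>. 4 * real r ^ 2 * \<sigma> \<delta>) \<longlongrightarrow> 4 * real r ^ 2 * 0) (at_right 0)"
    by (intro tendsto_intros) simp
  then show "eventually (\<lambda>\<delta>. 4 * real r ^ 2 * \<sigma> \<delta> < \<zeta> ^ 2) (at_right 0)"
    using assms(3) by (intro order_tendstoD(2)) auto
  have "(b \<longlongrightarrow> 2 * 0 / \<theta>) (at_right 0)"
    unfolding b_def using assms by (intro tendsto_intros) auto
  then have "((\<lambda>\<delta>. b \<delta> + real r ^ 2 * (\<sigma> \<delta> / \<gamma> ^ 2)) \<longlongrightarrow> 0 + real r ^ 2 * (0 / \<gamma> ^ 2)) (at_right 0)"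
    using \<sigma> assms(2) by (intro tendsto_intros) auto
  then show "eventually (\<lambda>\<delta>. b \<delta> + real r ^ 2 * (\<sigma> \<delta> / \<gamma> ^ 2) < (\<mu> / (2 * real r)) ^ r) (at_right 0)"
    using assms by (intro order_tendstoD(2)) auto
qed

text \<open>Dictated by \<open>4 * r * \<gamma>' \<le> \<zeta>\<close> for
  \<open>\<zeta> = \<gamma> / (100 * r ^ 2)\<close>.\<close>

definition gap_ratio :: "nat \<Rightarrow> real" where "gap_ratio r = 1 / (400 * real r ^ 3)"

text \<open>The set of admissible \<delta> depends on \<gamma>, and \<gamma> will depend on the
  graph. Stating the result for all sufficiently small \<delta> allows finitely many values of
  \<gamma> to be combined.\<close>

lemma stability_at_gap:
  assumes "1 \<le> s" "s \<le> r" "0 < \<gamma>" "\<gamma> \<le> \<epsilon>" "\<epsilon> < 1"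
  shows "eventually (\<lambda>\<delta>. \<forall>n (V :: nat \<Rightarrow> 'a set) E.
    multipartite_graph r s n V E \<longrightarrow> 0 < n s \<longrightarrow>
    (\<forall>i\<in>{1..r}. real (n i) < \<gamma> * real (n s) \<longrightarrow> real (n i) < \<gamma> * gap_ratio r * real (n s)) \<longrightarrow>
    real (multipartite_turan n r (Suc s)) - \<delta> * real (n s) ^ 2 \<le> real (card E) \<longrightarrow>
    (\<exists>X P. stable_partition r (Suc s) V E X \<epsilon> P \<and> (\<forall>j\<in>{1..s}.
      (1 - \<epsilon>) * real (n s) < real (card (integral_part {1..r} (\<lambda>i. V i - X) (P j - X)))))) (at_right 0)"
proof -
  define \<zeta> where "\<zeta> = \<gamma> / (100 * real r ^ 2)"
  \<comment> \<open>Both demands on \<theta> are met: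
    \<open>2 * \<theta> \<le> \<gamma> * \<zeta>\<close> with room to spare, and
    \<open>\<theta> < \<gamma> ^ 2\<close> because \<open>\<zeta> \<le> \<gamma>\<close>.\<close>
  define \<theta> where "\<theta> = \<gamma> * \<zeta> / 4"
  define \<mu> where "\<mu> = \<zeta> / (4 * real r ^ 2)"
  have r: "1 \<le> r" "0 < real r" "1 \<le> real r" using assms by auto
  have \<zeta>: "0 < \<zeta>" using r assms(3) by (simp add: \<zeta>_def)
  have \<theta>: "0 < \<theta>" using \<zeta> assms(3) by (simp add: \<theta>_def)
  have \<mu>: "0 < \<mu>" using \<zeta> r by (simp add: \<mu>_def)
  have r2: "1 \<le> real r ^ 2" using r by simp
  have "\<zeta> \<le> \<gamma>"
    unfolding \<zeta>_def using r2 assms(3) by (simp add: divide_le_eq)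
  then have "\<gamma> * \<zeta> \<le> \<gamma> * \<gamma>" using assms(3) by (intro mult_left_mono) auto
  moreover have "0 < \<gamma> * \<zeta>" using assms(3) \<zeta> by simp
  ultimately have \<theta>_less: "\<theta> < \<gamma> ^ 2"
    unfolding \<theta>_def power2_eq_square by linarith
  have "\<forall>\<^sub>F \<delta> in at_right 0. 0 < (\<delta> :: real)"
    by (rule eventually_at_right_less)
  with small_parameters[OF r(1) assms(3) \<zeta> \<theta> \<mu>] show ?thesis
  proof eventually_elim
    case (elim \<delta>)
    let ?b = "2 * \<delta> / \<theta>"
    let ?\<psi> = "(1 + real r) ^ 2 * ?b"
    let ?\<sigma> = "4 * real r ^ 2 * ?\<psi> + 2 * \<delta>"
    show ?case
    proof (intro allI impI)
      fix n and V :: "nat \<Rightarrow> 'a set" and E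
      assume graph: "multipartite_graph r s n V E" and n: "0 < n s"
        and gap: "\<forall>i\<in>{1..r}. real (n i) < \<gamma> * real (n s) \<longrightarrow> real (n i) < \<gamma> * gap_ratio r * real (n s)"
        and dense: "real (multipartite_turan n r (Suc s)) - \<delta> * real (n s) ^ 2 \<le> real (card E)"
      interpret multipartite_graph r s n V E by (rule graph)
      interpret near_extremal r s n V E \<gamma> "\<gamma> * gap_ratio r" \<delta> \<zeta> \<theta> \<mu> ?b ?\<psi> ?\<sigma>
      proof
        show "100 * real r ^ 2 * \<zeta> \<le> \<gamma>" using r by (simp add: \<zeta>_def)
        show "4 * real r * (\<gamma> * gap_ratio r) \<le> \<zeta>"
          using r assms(3) by (simp add: \<zeta>_def gap_ratio_def field_simps power2_eq_square power3_eq_cube)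
        show "0 < \<gamma> * gap_ratio r" using r assms(3) by (simp add: gap_ratio_def)
        show "2 * \<theta> \<le> \<gamma> * \<zeta>" using assms(3) \<zeta> by (simp add: \<theta>_def)
        show "4 * real r ^ 2 * \<mu> \<le> \<zeta>" using r by (simp add: \<mu>_def)
        show "2 * \<delta> \<le> ?b * \<theta>" using \<theta> by simp
      qed (use assms \<zeta> \<theta> \<mu> \<theta>_less elim n gap dense in auto)
      obtain x where x: "good x"
        "\<And>i. i \<in> M \<Longrightarrow> real (card {v \<in> V i. \<not> good (x(i := v))}) \<le> ?\<psi> * real (n i)"
        "\<And>i k. i \<in> M \<Longrightarrow> k \<in> M \<Longrightarrow> i \<noteq> k \<Longrightarrow>
          real (card {(v, w) \<in> V i \<times> V k. \<not> good (x(i := v, k := w))}) \<le> ?\<psi> * (real (n i) * real (n k))"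
        by (rule reference) blast
      obtain c where c: "balanced c" "represents x c"
        using x(1) by (rule good_colouring)
      interpret reference_colouring r s n V E \<gamma> "\<gamma> * gap_ratio r" \<delta> \<zeta> \<theta> \<mu> ?b ?\<psi> ?\<sigma> x c
        by unfold_locales (use x c in auto)
      show "\<exists>X P. stable_partition r (Suc s) V E X \<epsilon> P \<and> (\<forall>j\<in>{1..s}.
          (1 - \<epsilon>) * real (n s) < real (card (integral_part {1..r} (\<lambda>i. V i - X) (P j - X))))"
        by (rule stable_partition_exists[OF assms(4)])
    qed
  qed
qed

text \<open>The \<open>r + 1\<close> half-open intervals from \<open>q ^ Suc k * L\<close> to
  \<open>q ^ k * L\<close> are disjoint, so \<open>r\<close> numbers miss one of them.\<close>

lemma scale_gap:
  fixes a :: "nat \<Rightarrow> real" and q :: real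
  assumes "0 < q" "q \<le> 1" "0 \<le> L"
  shows "\<exists>k\<le>r. \<forall>i\<in>{1..r}. a i < q ^ k * L \<longrightarrow> a i < q ^ Suc k * L"
proof (rule ccontr)
  assume "\<not> ?thesis"
  then have "\<forall>k\<in>{..r}. \<exists>i\<in>{1..r}. a i < q ^ k * L \<and> q ^ Suc k * L \<le> a i"
    by (auto simp: not_less)
  then obtain f where f: "\<And>k. k \<in> {..r} \<Longrightarrow> f k \<in> {1..r} \<and> a (f k) < q ^ k * L \<and> q ^ Suc k * L \<le> a (f k)"
    by metis
  have ne: "f k \<noteq> f l" if "k < l" "l \<le> r" for k l
  proof
    assume eq: "f k = f l"
    have "q ^ l * L \<le> q ^ Suc k * L"
      using assms that(1) by (intro mult_right_mono power_decreasing) auto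
    then show False using f[of k] f[of l] that eq by auto
  qed
  have "inj_on f {..r}"
  proof (rule inj_onI)
    fix k l assume "k \<in> {..r}" "l \<in> {..r}" "f k = f l"
    then show "k = l" using ne[of k l] ne[of l k] by (cases k l rule: linorder_cases) auto
  qed
  moreover have "f ` {..r} \<subseteq> {1..r}" using f by blast
  ultimately have "card {..r} \<le> card {1..r}" by (rule card_inj_on_le) simp
  then show False by simp
qed

theorem theorem4p1:
  fixes r t :: nat and \<epsilon> :: real
  assumes "3 \<le> t" and "t \<le> r" and "0 < \<epsilon>" and "\<epsilon> < 1"
  shows "\<exists>\<delta>::real. 0 < \<delta> \<and>
    (\<forall>(n :: nat \<Rightarrow> nat) (V :: nat \<Rightarrow> 'a set) (E :: 'a set set).
       antimono_on {1..r} n \<and>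
       real (n (t - 1)) \<ge> 1 / \<delta> \<and>
       (\<forall>i\<in>{1..r}. finite (V i) \<and> card (V i) = n i) \<and>
       disjoint_family_on V {1..r} \<and>
       E \<subseteq> complete_multipartite {1..r} V \<and>
       clique_free (\<Union>i\<in>{1..r}. V i) E t \<and>
       real (card E) \<ge> real (multipartite_turan n r t) - \<delta> * real (n (t - 1)) ^ 2 \<longrightarrow>
       (\<exists>X P. stable_partition r t V E X \<epsilon> P \<and>
          (\<forall>j\<in>{1..t - 1}.
             real (card (integral_part {1..r} (\<lambda>i. V i - X) (P j - X)))
               > (1 - \<epsilon>) * real (n (t - 1)))))"
proof -
  define s where "s = t - 1"
  have s: "1 \<le> s" "s \<le> r" "t = Suc s" using assms by (auto simp: s_def)
  define q where "q = gap_ratio r"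
  have "1 \<le> real r ^ 3" using s by simp
  then have "1 \<le> 400 * real r ^ 3" by linarith
  moreover have "0 < 1 / y \<and> 1 / y \<le> 1" if "1 \<le> y" for y :: real using that by simp
  ultimately have q: "0 < q" "q \<le> 1" unfolding q_def gap_ratio_def by blast+
  define works where "works \<delta> \<gamma> \<longleftrightarrow> (\<forall>n (V :: nat \<Rightarrow> 'a set) E.
    multipartite_graph r s n V E \<longrightarrow> 0 < n s \<longrightarrow>
    (\<forall>i\<in>{1..r}. real (n i) < \<gamma> * real (n s) \<longrightarrow> real (n i) < \<gamma> * gap_ratio r * real (n s)) \<longrightarrow>
    real (multipartite_turan n r (Suc s)) - \<delta> * real (n s) ^ 2 \<le> real (card E) \<longrightarrow>
    (\<exists>X P. stable_partition r (Suc s) V E X \<epsilon> P \<and> (\<forall>j\<in>{1..s}.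
      (1 - \<epsilon>) * real (n s) < real (card (integral_part {1..r} (\<lambda>i. V i - X) (P j - X))))))"
    for \<delta> \<gamma>
  \<comment> \<open>Which scale has the gap is known only once the sizes are given, so one \<delta>
    is chosen that works for all \<open>r + 1\<close> scales.\<close>
  have "eventually (\<lambda>\<delta>. \<forall>k\<in>{..r}. works \<delta> (\<epsilon> * q ^ k)) (at_right 0)"
  proof (intro eventually_ball_finite ballI)
    fix k
    have "\<epsilon> * q ^ k \<le> \<epsilon>" using q assms(3) by (simp add: mult_left_le power_le_one)
    then show "eventually (\<lambda>\<delta>. works \<delta> (\<epsilon> * q ^ k)) (at_right 0)"
      unfolding works_def using q assms(3,4) s by (intro stability_at_gap) auto
  qed simp
  then have "eventually (\<lambda>\<delta>. 0 < \<delta> \<and> (\<forall>k\<in>{..r}. works \<delta> (\<epsilon> * q ^ k))) (at_right 0)"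
    by (intro eventually_conj eventually_at_right_less)
  then have "\<exists>\<delta>. 0 < \<delta> \<and> (\<forall>k\<in>{..r}. works \<delta> (\<epsilon> * q ^ k))"
    by (rule eventually_happens'[OF trivial_limit_at_right_real])
  then obtain \<delta> where \<delta>: "0 < \<delta>" "\<And>k. k \<le> r \<Longrightarrow> works \<delta> (\<epsilon> * q ^ k)" by auto
  show ?thesis
  proof (intro exI[of _ \<delta>] conjI allI impI)
    show "0 < \<delta>" by (rule \<delta>(1))
    fix n and V :: "nat \<Rightarrow> 'a set" and E
    assume H: "antimono_on {1..r} n \<and> 1 / \<delta> \<le> real (n (t - 1)) \<and>
       (\<forall>i\<in>{1..r}. finite (V i) \<and> card (V i) = n i) \<and> disjoint_family_on V {1..r} \<and>
       E \<subseteq> complete_multipartite {1..r} V \<and> clique_free (\<Union>i\<in>{1..r}. V i) E t \<and>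
       real (multipartite_turan n r t) - \<delta> * real (n (t - 1)) ^ 2 \<le> real (card E)"
    then have graph: "multipartite_graph r s n V E"
      unfolding multipartite_graph_def using s by auto
    have "0 < 1 / \<delta>" using \<delta>(1) by simp
    also have "\<dots> \<le> real (n s)" using H s_def by simp
    finally have n: "0 < n s" by simp
    obtain k where k: "k \<le> r" "\<forall>i\<in>{1..r}. real (n i) < q ^ k * (\<epsilon> * real (n s)) \<longrightarrow>
        real (n i) < q ^ Suc k * (\<epsilon> * real (n s))"
      using scale_gap[OF q, of "\<epsilon> * real (n s)" r "\<lambda>i. real (n i)"] assms(3) by auto
    have "\<forall>i\<in>{1..r}. real (n i) < \<epsilon> * q ^ k * real (n s) \<longrightarrow>
        real (n i) < \<epsilon> * q ^ k * gap_ratio r * real (n s)"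
      using k(2) by (simp add: q_def mult_ac)
    moreover have "real (multipartite_turan n r (Suc s)) - \<delta> * real (n s) ^ 2 \<le> real (card E)"
      using H s by simp
    ultimately have "\<exists>X P. stable_partition r (Suc s) V E X \<epsilon> P \<and> (\<forall>j\<in>{1..s}.
        (1 - \<epsilon>) * real (n s) < real (card (integral_part {1..r} (\<lambda>i. V i - X) (P j - X))))"
      using \<delta>(2)[OF k(1)] graph n unfolding works_def by blast
    then show "\<exists>X P. stable_partition r t V E X \<epsilon> P \<and> (\<forall>j\<in>{1..t - 1}.
        (1 - \<epsilon>) * real (n (t - 1)) < real (card (integral_part {1..r} (\<lambda>i. V i - X) (P j - X))))"
      by (simp add: s(3))
  qed
qed

end
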